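(* Let $(\Pi,c)$ be a complete, separable, locally compact semimetric space such that $c$ is jointly (sequentially) continuous and, for some $B\ge 1$, $c(x,y)\le B[c(x,z)+c(z,y)]$ for all $x,y,z\in\Pi$. Let $\beta\ge0$, $\mathcal A,\mathcal B\in\mathcal G_c^0(\Pi)$ and $f,g\in C_{b,c}(\Pi)$. Then the following are equivalent: (a) for all $x,y\in\Pi$ and $t\ge0$, $$\mathcal C_c(\delta_xe^{t\mathcal A},\delta_ye^{t\mathcal B})\le e^{\beta t}c(x,y)+\int_0^te^{\beta(t-s)}e^{s\mathcal A}f(x)\,ds+\int_0^te^{\beta(t-s)}e^{s\mathcal B}g(y)\,ds;$$ (b) for all $\mu,\nu\in\mathcal P_c(\Pi)$ and $t\ge0$, $$\mathcal C_c(\mu e^{t\mathcal A},\nu e^{t\mathcal B})\le e^{\beta t}\mathcal C_c(\mu,\nu)+\int_0^te^{\beta(t-s)}\langle\mu,e^{s\mathcal A}f\rangle\,ds+\int_0^te^{\beta(t-s)}\langle\nu,e^{s\mathcal B}g\rangle\,ds;$$ (c) for all $\mu,\nu\in\mathcal P_c(\Pi)$, $\ \omega_c(\mu,\nu;\mathcal A,\mathcal B)\le\langle\mu,f\rangle+\langle\nu,g\rangle+\beta\,\mathcal C_c(\mu,\nu)$; (d) for all $x,y\in\Pi$, $\ \omega_c(x,y;\mathcal A,\mathcal B)\le f(x)+g(y)+\beta c(x,y)$; (e) for all $\phi\in D(\mathcal A)$, $\psi\in D(\mathcal B)$ such that $(x,y)\mapsto c(x,y)-\phi(x)-\psi(y)$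 achieves a global minimum at some $(x_0,y_0)\in\Pi^2$, it holds that $$\mathcal A\phi(x_0)+\mathcal B\psi(y_0)\le f(x_0)+g(y_0)+\beta c(x_0,y_0).$$
   Context: A semimetric on a set $\Pi$ is a map $c:\Pi\times\Pi\to[0,\infty)$ with $c(x,y)=c(y,x)$ and $c(x,y)=0$ iff $x=y$; $x_n\to x$ means $c(x_n,x)\to0$, and $\Pi$ carries the topology generated by the balls $\{y:c(x,y)<r\}$. Complete: every sequence with $\lim_n\sup_{m\ge n}c(x_n,x_m)=0$ converges. Continuity of $c$: $x_n\to x$, $y_n\to y$ imply $c(x_n,y_n)\to c(x,y)$. $\mathcal P(\Pi)$ is the set of Borel probability measures on $\Pi$; $\langle\mu,\phi\rangle=\int\phi\,d\mu$. $\mathcal C_c(\mu,\nu)=\inf_\gamma\int_{\Pi^2}c\,d\gamma$, the infimum over all couplings $\gamma$ of $\mu,\nu$. $\mathcal P_c(\Pi)$ is the set of $\mu\in\mathcal P(\Pi)$ with $\int c(z,x)\,d\mu(x)<\infty$ for some (equivalently all) $z\in\Pi$, topologized by convergence $\mathcal C_c(\mu_n,\mu)\to0$. $C_0(\Pi)$: continuous real functions vanishing at infinity, with sup norm. $C_{b,c}(\Pi)$: continuous $\phi:\Pi\to\mathbb R$ with $|\phi(x)|\le M_0+M_1c(z,x)$ for all $x$, for some $M_0,M_1\ge0$ and some (equivalently all) $z\in\Pi$. A probability semigroup on $\Pi$ is a family $(T_t)_{t\ge0}$ of the form $T_t\phi(x)=\int\phi(y)\,\kappa_t(x,dy)$,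 with $\kappa_t(x,\cdot)\in\mathcal P(\Pi)$ weakly continuous in $x$, $T_t$ preserving $C_0(\Pi)$, $T_0=I$, $T_{t+s}=T_tT_s$, and $\|T_t\phi-\phi\|_\infty\to0$ as $t\searrow0$ for $\phi\in C_0(\Pi)$. Its generator $\mathcal A$ is $\mathcal A\phi=\lim_{t\searrow0}(T_t\phi-\phi)/t$ (uniform limit) with domain $D(\mathcal A)\subset C_0(\Pi)$ the set of $\phi$ for which the limit exists; write $T_t=e^{t\mathcal A}$. For unbounded measurable $\phi$, $e^{t\mathcal A}\phi$ is given by the same integral when it is well-defined. $\mu e^{t\mathcal A}\in\mathcal P(\Pi)$ is determined by $\langle\mu e^{t\mathcal A},\phi\rangle=\langle\mu,e^{t\mathcal A}\phi\rangle$ for bounded continuous $\phi$. $\mathcal G_c^0(\Pi)$ is the set of generators $\mathcal A$ of probability semigroups such that for every $\mu\in\mathcal P_c(\Pi)$: $\mu e^{t\mathcal A}\in\mathcal P_c(\Pi)$ for all $t\ge0$, and $t\mapsto\mu e^{t\mathcal A}$ is continuous with respect to $\mathcal C_c$. For $\mathcal A,\mathcal B\in\mathcal G_c^0(\Pi)$ and $\mu,\nu\in\mathcal P_c(\Pi)$, $$\omega_c(\mu,\nu;\mathcal A,\mathcal B)=\limsup_{t\searrow0}\frac{\mathcal C_c(\mu e^{t\mathcal A},\nu e^{t\mathcal B})-\mathcal C_c(\mu,\nu)}{t},$$ and $\omega_c(x,y;\mathcal A,\mathcal B)=\omega_c(\delta_x,\delta_y;\mathcal A,\mathcal B)$. 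*)

theory Defs
  imports "HOL-Probability.Probability"
begin

section \<open>Semimetric spaces\<close>

text \<open>The space is a type \<open>'a\<close> of class \<^class>\<open>topological_space\<close> carrying a cost
  function \<open>c\<close>; \<open>semimetric_topology\<close> states that the open sets of the type are exactly those of
  the topology generated by the balls of \<open>c\<close>, so that \<^const>\<open>continuous_on\<close>, \<^const>\<open>compact\<close>,
  \<^const>\<open>borel\<close> etc. refer to this topology.\<close>

definition semimetric :: "('a \<Rightarrow> 'a \<Rightarrow> real) \<Rightarrow> bool" where
  "semimetric c \<longleftrightarrow>
     (\<forall>x y. 0 \<le> c x y) \<and> (\<forall>x y. c x y = c y x) \<and> (\<forall>x y. c x y = 0 \<longleftrightarrow> x = y)"

definition semimetric_topology :: "('a::topological_space \<Rightarrow> 'a \<Rightarrow> real) \<Rightarrow> bool" where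
  "semimetric_topology c \<longleftrightarrow>
     (\<forall>U. open U \<longleftrightarrow> generate_topology {{y. c x y < r} | x r. True} U)"

definition semimetric_conv :: "('a \<Rightarrow> 'a \<Rightarrow> real) \<Rightarrow> (nat \<Rightarrow> 'a) \<Rightarrow> 'a \<Rightarrow> bool" where
  "semimetric_conv c X x \<longleftrightarrow> (\<lambda>n. c (X n) x) \<longlonglongrightarrow> 0"

definition semimetric_complete :: "('a \<Rightarrow> 'a \<Rightarrow> real) \<Rightarrow> bool" where
  "semimetric_complete c \<longleftrightarrow>
     (\<forall>X. (\<lambda>n. SUP m\<in>{n..}. ereal (c (X n) (X m))) \<longlonglongrightarrow> 0 \<longrightarrow> (\<exists>x. semimetric_conv c X x))"

definition semimetric_continuous :: "('a \<Rightarrow> 'a \<Rightarrow> real) \<Rightarrow> bool" where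
  "semimetric_continuous c \<longleftrightarrow>
     (\<forall>X Y x y. semimetric_conv c X x \<longrightarrow> semimetric_conv c Y y \<longrightarrow>
        (\<lambda>n. c (X n) (Y n)) \<longlonglongrightarrow> c x y)"

section \<open>Function spaces\<close>

definition C_b :: "('a::topological_space \<Rightarrow> real) set" where
  "C_b = {\<phi>. continuous_on UNIV \<phi> \<and> (\<exists>M. \<forall>x. \<bar>\<phi> x\<bar> \<le> M)}"

definition C_0 :: "('a::topological_space \<Rightarrow> real) set" where
  "C_0 = {\<phi>. continuous_on UNIV \<phi> \<and> (\<forall>\<epsilon>>0. \<exists>K. compact K \<and> (\<forall>x. x \<notin> K \<longrightarrow> \<bar>\<phi> x\<bar> < \<epsilon>))}"

definition C_bc :: "('a::topological_space \<Rightarrow> 'a \<Rightarrow> real) \<Rightarrow> ('a \<Rightarrow> real) set" where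
  "C_bc c = {\<phi>. continuous_on UNIV \<phi> \<and>
     (\<exists>z M0 M1. 0 \<le> M0 \<and> 0 \<le> M1 \<and> (\<forall>x. \<bar>\<phi> x\<bar> \<le> M0 + M1 * c z x))}"

section \<open>Probability measures and transport cost\<close>

definition borel_probs :: "'a::topological_space measure set" where
  "borel_probs = {\<mu>. prob_space \<mu> \<and> sets \<mu> = sets borel}"

definition P_c :: "('a::topological_space \<Rightarrow> 'a \<Rightarrow> real) \<Rightarrow> 'a measure set" where
  "P_c c = {\<mu> \<in> borel_probs. \<exists>z. (\<integral>\<^sup>+x. ennreal (c z x) \<partial>\<mu>) < \<infinity>}"

text \<open>For the second countable spaces considered here, the product of the Borel
  sigma-algebras is the Borel sigma-algebra of the product space.\<close>

definition couplings :: "'a::topological_space measure \<Rightarrow> 'a measure \<Rightarrow> ('a \<times> 'a) measure set" where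
  "couplings \<mu> \<nu> = {\<gamma>. prob_space \<gamma> \<and> sets \<gamma> = sets (borel \<Otimes>\<^sub>M borel) \<and>
     distr \<gamma> borel fst = \<mu> \<and> distr \<gamma> borel snd = \<nu>}"

text \<open>The cost is extended-real valued (rather than \<^typ>\<open>ennreal\<close>) because differences of costs
  are needed; it is finite on \<open>P_c c\<close>.\<close>

definition transport_cost ::
    "('a::topological_space \<Rightarrow> 'a \<Rightarrow> real) \<Rightarrow> 'a measure \<Rightarrow> 'a measure \<Rightarrow> ereal" where
  "transport_cost c \<mu> \<nu> =
     enn2ereal (INF \<gamma>\<in>couplings \<mu> \<nu>. \<integral>\<^sup>+p. ennreal (c (fst p) (snd p)) \<partial>\<gamma>)"

section \<open>Probability semigroups and their generators\<close>

text \<open>A semigroup is represented by its family of kernels; only the kernels \<open>\<kappa> t\<close> with \<open>t \<ge> 0\<close>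
  matter.\<close>

type_synonym 'a kernels = "real \<Rightarrow> 'a \<Rightarrow> 'a measure"

definition kernel_op :: "'a kernels \<Rightarrow> real \<Rightarrow> ('a \<Rightarrow> real) \<Rightarrow> 'a \<Rightarrow> real" where
  "kernel_op \<kappa> t \<phi> x = (\<integral>y. \<phi> y \<partial>(\<kappa> t x))"

definition prob_semigroup :: "'a::topological_space kernels \<Rightarrow> bool" where
  "prob_semigroup \<kappa> \<longleftrightarrow>
     (\<forall>t\<ge>0. \<forall>x. \<kappa> t x \<in> borel_probs) \<and>
     (\<forall>t\<ge>0. \<forall>\<phi>\<in>C_b. continuous_on UNIV (kernel_op \<kappa> t \<phi>)) \<and>
     (\<forall>t\<ge>0. \<forall>\<phi>\<in>C_0. kernel_op \<kappa> t \<phi> \<in> C_0) \<and>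
     (\<forall>\<phi>\<in>C_0. kernel_op \<kappa> 0 \<phi> = \<phi>) \<and>
     (\<forall>s\<ge>0. \<forall>t\<ge>0. \<forall>\<phi>\<in>C_0. kernel_op \<kappa> (t + s) \<phi> = kernel_op \<kappa> t (kernel_op \<kappa> s \<phi>)) \<and>
     (\<forall>\<phi>\<in>C_0. uniform_limit UNIV (\<lambda>t. kernel_op \<kappa> t \<phi>) \<phi> (at_right 0))"

text \<open>An unbounded operator is a partial map; its domain is \<^const>\<open>dom\<close>.\<close>

type_synonym 'a operator = "('a \<Rightarrow> real) \<rightharpoonup> ('a \<Rightarrow> real)"

definition generator_limit :: "'a kernels \<Rightarrow> ('a \<Rightarrow> real) \<Rightarrow> ('a \<Rightarrow> real) \<Rightarrow> bool" where
  "generator_limit \<kappa> \<phi> \<psi> \<longleftrightarrow>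
     uniform_limit UNIV (\<lambda>t x. (kernel_op \<kappa> t \<phi> x - \<phi> x) / t) \<psi> (at_right 0)"

definition generator :: "'a::topological_space kernels \<Rightarrow> 'a operator" where
  "generator \<kappa> \<phi> =
     (if \<phi> \<in> C_0 \<and> (\<exists>\<psi>. generator_limit \<kappa> \<phi> \<psi>) then Some (THE \<psi>. generator_limit \<kappa> \<phi> \<psi>) else None)"

definition is_generator :: "'a::topological_space operator \<Rightarrow> bool" where
  "is_generator A \<longleftrightarrow> (\<exists>\<kappa>. prob_semigroup \<kappa> \<and> generator \<kappa> = A)"

text \<open>A generator determines its semigroup, hence the kernels \<open>\<kappa> t\<close> for \<open>t \<ge> 0\<close>. The choice below
  only fixes the irrelevant kernels at negative times.\<close>

definition semigroup_of :: "'a::topological_space operator \<Rightarrow> 'a kernels" where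
  "semigroup_of A = (SOME \<kappa>. prob_semigroup \<kappa> \<and> generator \<kappa> = A)"

definition exp_op :: "real \<Rightarrow> 'a::topological_space operator \<Rightarrow> ('a \<Rightarrow> real) \<Rightarrow> 'a \<Rightarrow> real" where
  "exp_op t A = kernel_op (semigroup_of A) t"

definition exp_measure :: "'a::topological_space measure \<Rightarrow> real \<Rightarrow> 'a operator \<Rightarrow> 'a measure" where
  "exp_measure \<mu> t A =
     (THE \<nu>. \<nu> \<in> borel_probs \<and> (\<forall>\<phi>\<in>C_b. (\<integral>x. \<phi> x \<partial>\<nu>) = (\<integral>x. exp_op t A \<phi> x \<partial>\<mu>)))"

definition G_c0 :: "('a::topological_space \<Rightarrow> 'a \<Rightarrow> real) \<Rightarrow> 'a operator set" where
  "G_c0 c = {A. is_generator A \<and>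
     (\<forall>\<mu>\<in>P_c c. (\<forall>t\<ge>0. exp_measure \<mu> t A \<in> P_c c) \<and>
       (\<forall>t\<ge>0. ((\<lambda>s. transport_cost c (exp_measure \<mu> s A) (exp_measure \<mu> t A)) \<longlongrightarrow> 0)
                 (at t within {0..})))}"

definition \<omega>_c :: "('a::topological_space \<Rightarrow> 'a \<Rightarrow> real) \<Rightarrow> 'a measure \<Rightarrow> 'a measure \<Rightarrow>
    'a operator \<Rightarrow> 'a operator \<Rightarrow> ereal" where
  "\<omega>_c c \<mu> \<nu> A B =
     Limsup (at_right 0)
       (\<lambda>t. (transport_cost c (exp_measure \<mu> t A) (exp_measure \<nu> t B) - transport_cost c \<mu> \<nu>) / ereal t)"

abbreviation dirac :: "'a::topological_space \<Rightarrow> 'a measure" where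
  "dirac x \<equiv> return borel x"

end

(*
  In the cycle (a) => (b) => (c) => (d) => (e) => (a) the substance lies in (a) => (b) and
  (e) => (a). Both use Kantorovich duality: the transport cost of mu and nu is at most
  L as soon as int phi dmu + int psi dnu <= L for all bounded continuous phi, psi with
  phi(x) + psi(y) <= c(x,y). Integrating (a) against a coupling then gives (b) without any measurable
  selection of couplings. For (e) => (a), fix such phi and psi and put
    u_t = e^(-beta t) P_t phi - int_0^t e^(-beta s) P_s f ds
  and likewise v_t; the claim is u_t(x) + v_t(y) <= c(x,y). If this failed, then a maximum of the
  difference would be a minimum of c - u_t - v_t, and (e) would contradict the equation
  u' = A u - beta u - f. To stay inside the domains of the generators one replaces phi by phi_0 - a with
  phi_0 smoothed and vanishing at infinity and f by a truncation of f + k.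
  Duality itself comes from the finite-dimensional case by a fine partition of unity.
*)
theory Submission
  imports Defs
begin

section \<open>Continuous functions vanishing at infinity\<close>

text \<open>Two obstacles shape the comparison. Nothing forces \<open>c\<close> to grow at infinity,
  so a maximum of u_t(x) + v_t(y) - c(x,y) need not be attained; and the constants and
  \<open>f\<close>, \<open>g\<close> need not belong to \<open>C_0\<close>, where the generators
  live. The shift a meets the first and avoids constants in the second: it enters only as the scalar
  -a e^(-beta t), which no generator has to see, and for a large it makes u_t + v_t nonpositive as
  soon as x or y leaves a compact set. One compact set serves all times in [0,T], because the orbit
  of a \<open>C_0\<close> function is continuous in sup norm. The truncation of f + k has to be
  exact on that set alone; elsewhere it only has to lie between 0 and f + k. The bound f >= -k comes
  from replacing f by max(f,-n), which only weakens (e), and is removed by dominated convergence.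
  Continuity of t -> mu e^(tA) in transport cost is what controls the time integrals of the
  unbounded f and g.\<close>

lemma C_0_continuous: "\<phi> \<in> C_0 \<Longrightarrow> continuous_on UNIV \<phi>"
  by (simp add: C_0_def)

lemma C_b_continuous: "\<phi> \<in> C_b \<Longrightarrow> continuous_on UNIV \<phi>"
  by (simp add: C_b_def)

lemma C_0_vanishes:
  assumes "\<phi> \<in> C_0" "\<epsilon> > 0"
  obtains C where "compact C" "\<And>x. x \<notin> C \<Longrightarrow> \<bar>\<phi> x\<bar> < \<epsilon>"
  using assms by (auto simp: C_0_def)

lemma C_bI: "continuous_on UNIV \<phi> \<Longrightarrow> (\<And>x. \<bar>\<phi> x\<bar> \<le> M) \<Longrightarrow> \<phi> \<in> C_b"
  by (auto simp: C_b_def)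

lemma C_0_dominated:
  assumes "\<phi> \<in> C_0" "continuous_on UNIV \<psi>" "\<And>x. \<bar>\<psi> x\<bar> \<le> \<bar>\<phi> x\<bar>"
  shows "\<psi> \<in> C_0"
  unfolding C_0_def
proof safe
  show "\<exists>C. compact C \<and> (\<forall>x. x \<notin> C \<longrightarrow> \<bar>\<psi> x\<bar> < \<epsilon>)" if "\<epsilon> > 0" for \<epsilon>
    using assms(1,3) that unfolding C_0_def by (smt (verit, best) mem_Collect_eq)
qed (rule assms)

lemma C_0_add:
  assumes "\<phi> \<in> C_0" "\<psi> \<in> C_0"
  shows "(\<lambda>x. \<phi> x + \<psi> x) \<in> C_0"
proof -
  have "\<exists>C. compact C \<and> (\<forall>x. x \<notin> C \<longrightarrow> \<bar>\<phi> x + \<psi> x\<bar> < \<epsilon>)" if \<epsilon>: "\<epsilon> > 0" for \<epsilon>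
  proof -
    obtain C where C: "compact C" "\<And>x. x \<notin> C \<Longrightarrow> \<bar>\<phi> x\<bar> < \<epsilon> / 2"
      using C_0_vanishes[OF assms(1) half_gt_zero[OF \<epsilon>]] by blast
    obtain D where D: "compact D" "\<And>x. x \<notin> D \<Longrightarrow> \<bar>\<psi> x\<bar> < \<epsilon> / 2"
      using C_0_vanishes[OF assms(2) half_gt_zero[OF \<epsilon>]] by blast
    have "\<bar>\<phi> x + \<psi> x\<bar> < \<epsilon>" if "x \<notin> C \<union> D" for x
      using C(2)[of x] D(2)[of x] that by auto
    then show ?thesis
      using C(1) D(1) by (meson compact_Un)
  qed
  then show ?thesis
    using assms by (auto simp: C_0_def intro!: continuous_intros)
qed

lemma C_0_scale:
  assumes "\<phi> \<in> C_0"
  shows "(\<lambda>x. a * \<phi> x) \<in> C_0"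
proof (cases "a = 0")
  case True
  then show ?thesis
    by (auto simp: C_0_def intro!: exI[of _ "{}"])
next
  case False
  have "\<exists>C. compact C \<and> (\<forall>x. x \<notin> C \<longrightarrow> \<bar>a * \<phi> x\<bar> < \<epsilon>)" if "\<epsilon> > 0" for \<epsilon>
  proof -
    have "\<epsilon> / \<bar>a\<bar> > 0" using that False by simp
    then obtain C where "compact C" "\<And>x. x \<notin> C \<Longrightarrow> \<bar>\<phi> x\<bar> < \<epsilon> / \<bar>a\<bar>"
      using C_0_vanishes[OF assms] by blast
    then show ?thesis
      using False by (auto simp: abs_mult field_simps)
  qed
  then show ?thesis
    using assms by (auto simp: C_0_def intro!: continuous_intros)
qed

lemma C_0_zero: "(\<lambda>x. 0) \<in> C_0"
  by (auto simp: C_0_def intro!: exI[of _ "{}"])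

lemma C_0_diff:
  assumes "\<phi> \<in> C_0" "\<psi> \<in> C_0"
  shows "(\<lambda>x. \<phi> x - \<psi> x) \<in> C_0"
  using C_0_add[OF assms(1) C_0_scale[OF assms(2), of "-1"]] by simp

lemma C_0_sum:
  assumes "finite I" "\<And>i. i \<in> I \<Longrightarrow> \<phi> i \<in> C_0"
  shows "(\<lambda>x. \<Sum>i\<in>I. \<phi> i x) \<in> C_0"
  using assms by (induction I rule: finite_induct) (auto intro: C_0_zero C_0_add)

lemma C_0_bounded:
  assumes "\<phi> \<in> C_0"
  obtains M where "M \<ge> 0" "\<And>x. \<bar>\<phi> x\<bar> \<le> M"
proof -
  obtain C where C: "compact C" "\<And>x. x \<notin> C \<Longrightarrow> \<bar>\<phi> x\<bar> < 1"
    using C_0_vanishes[OF assms, of 1] by auto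
  have "compact (\<phi> ` C)"
    using C(1) C_0_continuous[OF assms] by (meson compact_continuous_image continuous_on_subset subset_UNIV)
  then obtain B where "\<And>y. y \<in> \<phi> ` C \<Longrightarrow> \<bar>y\<bar> \<le> B"
    by (metis compact_imp_bounded bounded_real)
  then have "\<bar>\<phi> x\<bar> \<le> max 1 B" for x
    using C(2)[of x] by (cases "x \<in> C") (auto intro: max.coboundedI2 less_imp_le max.coboundedI1)
  then show ?thesis
    by (intro that[of "max 1 B"]) auto
qed

lemma C_0_C_b: "\<phi> \<in> C_0 \<Longrightarrow> \<phi> \<in> C_b"
  by (metis C_0_bounded C_0_continuous C_bI)

lemma continuous_attains_bound:
  fixes \<phi> :: "'a::topological_space \<Rightarrow> real"
  assumes "compact S" "continuous_on UNIV \<phi>"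
  obtains M where "M \<ge> 0" "\<And>x. x \<in> S \<Longrightarrow> \<bar>\<phi> x\<bar> \<le> M"
proof -
  have "compact (\<phi> ` S)"
    using assms by (meson compact_continuous_image continuous_on_subset subset_UNIV)
  then obtain B where "\<And>y. y \<in> \<phi> ` S \<Longrightarrow> \<bar>y\<bar> \<le> B"
    by (metis compact_imp_bounded bounded_real)
  then show ?thesis
    by (intro that[of "max 0 B"]) (auto intro: max.coboundedI2)
qed

section \<open>The topology of a semimetric\<close>

text \<open>\<open>K\<close> is the constant of the relaxed triangle inequality, which the statement
  in words calls B; the letter \<open>B\<close> is kept for the second operator.\<close>

locale cost_space =
  fixes c :: "'a::topological_space \<Rightarrow> 'a \<Rightarrow> real" and K :: real
  assumes semimetric: "semimetric c"
    and topology: "semimetric_topology c"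
    and separable: "separable_space (euclidean :: 'a topology)"
    and locally_compact: "locally_compact_space (euclidean :: 'a topology)"
    and seq_continuous: "semimetric_continuous c"
    and K_ge_1: "K \<ge> 1"
    and quasi_triangle: "\<And>x y z. c x y \<le> K * (c x z + c z y)"
begin

lemma cost_nonneg [simp]: "0 \<le> c x y"
  and cost_sym: "c x y = c y x"
  and cost_eq_0_iff [simp]: "c x y = 0 \<longleftrightarrow> x = y"
  using semimetric by (auto simp: semimetric_def)

lemma cost_self [simp]: "c x x = 0"
  by simp

text \<open>Despite the name these are open balls; the letter c stands for the cost.\<close>

abbreviation cball :: "'a \<Rightarrow> real \<Rightarrow> 'a set" where
  "cball x r \<equiv> {y. c x y < r}"

text \<open>Bad points at distance below \<open>1 / Suc n\<close> would give two convergent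
  sequences that violate sequential continuity. No topology enters, since the description of open
  sets by balls is itself derived from this lemma.\<close>

lemma cost_continuous_eps:
  assumes "\<epsilon> > 0"
  obtains \<delta> where "\<delta> > 0" "\<And>x' y'. c x x' < \<delta> \<Longrightarrow> c y y' < \<delta> \<Longrightarrow> \<bar>c x' y' - c x y\<bar> < \<epsilon>"
proof -
  have "\<exists>\<delta>>0. \<forall>x' y'. c x x' < \<delta> \<longrightarrow> c y y' < \<delta> \<longrightarrow> \<bar>c x' y' - c x y\<bar> < \<epsilon>"
  proof (rule ccontr)
    assume "\<not> ?thesis"
    then have "\<exists>x' y'. c x x' < 1 / Suc n \<and> c y y' < 1 / Suc n \<and> \<not> \<bar>c x' y' - c x y\<bar> < \<epsilon>" for n
      by (metis zero_less_divide_1_iff of_nat_0_less_iff zero_less_Suc)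
    then obtain X Y where XY: "c x (X n) < 1 / Suc n" "c y (Y n) < 1 / Suc n"
      "\<not> \<bar>c (X n) (Y n) - c x y\<bar> < \<epsilon>" for n
      by metis
    have lim: "(\<lambda>n. 1 / real (Suc n)) \<longlonglongrightarrow> 0"
      using LIMSEQ_inverse_real_of_nat by (simp add: inverse_eq_divide)
    have "(\<lambda>n. c (X n) x) \<longlonglongrightarrow> 0" "(\<lambda>n. c (Y n) y) \<longlonglongrightarrow> 0"
      using XY(1,2) unfolding cost_sym[of _ x] cost_sym[of _ y]
      by (intro tendsto_sandwich[OF _ _ tendsto_const lim] always_eventually allI less_imp_le cost_nonneg; simp)+
    then have "(\<lambda>n. c (X n) (Y n)) \<longlonglongrightarrow> c x y"
      using seq_continuous by (auto simp: semimetric_continuous_def semimetric_conv_def)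
    then have "\<forall>\<^sub>F n in sequentially. dist (c (X n) (Y n)) (c x y) < \<epsilon>"
      using assms by (rule tendstoD)
    then show False
      using XY(3) by (auto simp: dist_real_def)
  qed
  then show ?thesis
    using that by blast
qed

lemma open_cball: "open (cball x r)"
proof -
  have "generate_topology {{y. c x y < r} | x r. True} (cball x r)"
    by (rule generate_topology.Basis) blast
  then show ?thesis
    using topology by (simp add: semimetric_topology_def)
qed

text \<open>The balls are only a subbase, and without the triangle inequality a ball need not
  contain a ball around each of its points. Continuity of \<open>c\<close> at \<open>(z, x)\<close>
  with tolerance \<open>r - c z x\<close> supplies one.\<close>

lemma open_iff_cball: "open U \<longleftrightarrow> (\<forall>x\<in>U. \<exists>r>0. cball x r \<subseteq> U)"
proof
  assume "open U"
  then have "generate_topology {{y. c x y < r} | x r. True} U"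
    using topology unfolding semimetric_topology_def by blast
  then show "\<forall>x\<in>U. \<exists>r>0. cball x r \<subseteq> U"
  proof induction
    case UNIV
    then show ?case by (auto intro: exI[of _ 1])
  next
    case (Int a b)
    show ?case
    proof
      fix x assume "x \<in> a \<inter> b"
      then obtain r s where "r > 0" "cball x r \<subseteq> a" "s > 0" "cball x s \<subseteq> b"
        using Int by blast
      then show "\<exists>r>0. cball x r \<subseteq> a \<inter> b"
        by (intro exI[of _ "min r s"]) auto
    qed
  next
    case (UN \<K>)
    then show ?case by (meson Union_iff Union_upper subset_trans)
  next
    case (Basis s)
    then obtain z r where s: "s = cball z r" by auto
    show ?case
    proof
      fix x assume "x \<in> s"
      then have "r - c z x > 0" using s by auto
      then obtain \<delta> where "\<delta> > 0" "\<And>x' y'. c z x' < \<delta> \<Longrightarrow> c x y' < \<delta> \<Longrightarrow> \<bar>c x' y' - c z x\<bar> < r - c z x"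
        using cost_continuous_eps by blast
      then show "\<exists>r>0. cball x r \<subseteq> s"
        unfolding s by (intro exI[of _ \<delta>]) (force dest: spec[of _ z])
    qed
  qed
next
  assume *: "\<forall>x\<in>U. \<exists>r>0. cball x r \<subseteq> U"
  show "open U"
  proof (subst open_subopen, intro ballI)
    fix x assume "x \<in> U"
    then obtain r where "r > 0" "cball x r \<subseteq> U"
      using * by blast
    then show "\<exists>T. open T \<and> x \<in> T \<and> T \<subseteq> U"
      by (intro exI[of _ "cball x r"]) (auto simp: open_cball)
  qed
qed

lemma eventually_nhds_cball: "eventually P (nhds x) \<longleftrightarrow> (\<exists>r>0. \<forall>y. c x y < r \<longrightarrow> P y)"
proof
  assume "eventually P (nhds x)"
  then obtain S where "open S" "x \<in> S" "\<And>y. y \<in> S \<Longrightarrow> P y"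
    by (auto simp: eventually_nhds)
  then show "\<exists>r>0. \<forall>y. c x y < r \<longrightarrow> P y"
    by (metis (mono_tags, lifting) open_iff_cball mem_Collect_eq subsetD)
next
  assume "\<exists>r>0. \<forall>y. c x y < r \<longrightarrow> P y"
  then obtain r where "r > 0" "\<And>y. c x y < r \<Longrightarrow> P y" by blast
  then show "eventually P (nhds x)"
    unfolding eventually_nhds by (intro exI[of _ "cball x r"]) (auto simp: open_cball)
qed

lemma continuous_on_cost_pair: "continuous_on UNIV (\<lambda>p. c (fst p) (snd p))"
proof -
  have "((\<lambda>p. c (fst p) (snd p)) \<longlongrightarrow> c x y) (nhds (x, y))" for x y
  proof (rule tendstoI)
    fix \<epsilon> :: real assume "\<epsilon> > 0"
    then obtain \<delta> where \<delta>: "\<delta> > 0" "\<And>x' y'. c x x' < \<delta> \<Longrightarrow> c y y' < \<delta> \<Longrightarrow> \<bar>c x' y' - c x y\<bar> < \<epsilon>"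
      using cost_continuous_eps by blast
    show "\<forall>\<^sub>F p in nhds (x, y). dist (c (fst p) (snd p)) (c x y) < \<epsilon>"
      unfolding nhds_prod eventually_prod_filter eventually_nhds_cball
      by (rule exI[of _ "\<lambda>x'. c x x' < \<delta>"], rule exI[of _ "\<lambda>y'. c y y' < \<delta>"])
        (use \<delta> in \<open>auto simp: dist_real_def\<close>)
  qed
  then have "((\<lambda>p. c (fst p) (snd p)) \<longlongrightarrow> c (fst p) (snd p)) (nhds p)" for p
    by (metis prod.collapse)
  then show ?thesis
    unfolding continuous_on_def by (meson at_within_le_nhds tendsto_mono)
qed

lemma continuous_on_cost [continuous_intros]:
  assumes "continuous_on S u" "continuous_on S v"
  shows "continuous_on S (\<lambda>x. c (u x) (v x))"
  using continuous_on_compose2[OF continuous_on_cost_pair, of S "\<lambda>x. (u x, v x)"] assms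
  by (simp add: continuous_on_Pair)

lemma relatively_compact_cball: "\<exists>r>0. \<exists>C. compact C \<and> cball x r \<subseteq> C"
proof -
  obtain U C where "openin euclidean U" "compactin euclidean C" "x \<in> U" "U \<subseteq> C"
    using locally_compact unfolding locally_compact_space_def by (metis UNIV_I topspace_euclidean)
  then have "open U" "compact C" "x \<in> U" "U \<subseteq> C" by simp_all
  then obtain r where "r > 0" "cball x r \<subseteq> U"
    using open_iff_cball by blast
  then show ?thesis
    using \<open>compact C\<close> \<open>U \<subseteq> C\<close> by blast
qed

text \<open>Balls of radius \<open>1 / Suc m\<close> around a countable dense set form a base.
  Keeping only the relatively compact ones costs nothing by local compactness and puts the tent
  functions on them into \<open>C_0\<close>.\<close>

lemma countable_base:
  "\<exists>(z :: nat \<Rightarrow> 'a) r. (\<forall>n. r n > 0) \<and> (\<forall>n. \<exists>C. compact C \<and> cball (z n) (r n) \<subseteq> C) \<and>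
    (\<forall>U x. open U \<longrightarrow> x \<in> U \<longrightarrow> (\<exists>n. c (z n) x < r n \<and> cball (z n) (r n) \<subseteq> U))"
proof -
  obtain D :: "'a set" where D: "countable D" "closure D = UNIV"
    using separable unfolding separable_space_def by auto
  have dense: "\<exists>d\<in>D. c x d < \<epsilon>" if "\<epsilon> > 0" for x \<epsilon>
  proof -
    have "x \<in> cball x \<epsilon> \<inter> closure D" using D that by simp
    then have "D \<inter> cball x \<epsilon> \<noteq> {}"
      using open_Int_closure_eq_empty[OF open_cball[of x \<epsilon>], of D] by blast
    then show ?thesis by auto
  qed
  define I where "I = {p \<in> D \<times> range (\<lambda>m. 1 / real (Suc m)). \<exists>C. compact C \<and> cball (fst p) (snd p) \<subseteq> C}"
  have "countable (D \<times> range (\<lambda>m. 1 / real (Suc m)))"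
    using D(1) by auto
  then have "countable I"
    unfolding I_def by (rule countable_subset[rotated]) auto
  have base: "\<exists>p\<in>I. c (fst p) x < snd p \<and> cball (fst p) (snd p) \<subseteq> U" if U: "open U" "x \<in> U" for U x
  proof -
    obtain r1 where r1: "r1 > 0" "cball x r1 \<subseteq> U"
      using U open_iff_cball by blast
    obtain r2 C where r2: "r2 > 0" "compact C" "cball x r2 \<subseteq> C"
      using relatively_compact_cball by blast
    \<comment> \<open>Two steps shorter than \<open>\<rho>\<close> add up, by the relaxed triangle
      inequality, to less than \<open>K * (2 * \<rho>) = min r1 r2\<close>.\<close>
    define \<rho> where "\<rho> = min r1 r2 / (2 * K)"
    have "\<rho> > 0" using r1(1) r2(1) K_ge_1 by (simp add: \<rho>_def)
    then obtain m where m: "1 / real (Suc m) < \<rho>"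
      using reals_Archimedean[of \<rho>] by (auto simp: inverse_eq_divide)
    obtain d where d: "d \<in> D" "c x d < 1 / real (Suc m)"
      using dense[of "1 / real (Suc m)" x] by auto
    have "c x y < min r1 r2" if "c d y < 1 / real (Suc m)" for y
    proof -
      have "c x y \<le> K * (c x d + c d y)" by (rule quasi_triangle)
      also have "\<dots> < K * (2 * \<rho>)"
        using K_ge_1 d(2) m that by (intro mult_strict_left_mono) linarith+
      also have "\<dots> = min r1 r2" using K_ge_1 by (simp add: \<rho>_def)
      finally show ?thesis .
    qed
    then have "cball d (1 / real (Suc m)) \<subseteq> U" "cball d (1 / real (Suc m)) \<subseteq> C"
      using r1(2) r2(3) by fastforce+
    then show ?thesis
      using d r2(2) by (intro bexI[of _ "(d, 1 / real (Suc m))"]) (auto simp: I_def cost_sym)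
  qed
  then have "I \<noteq> {}" by (metis open_UNIV UNIV_I empty_iff)
  define p where "p = from_nat_into I"
  have rng: "range p = I" unfolding p_def using \<open>countable I\<close> \<open>I \<noteq> {}\<close> by (rule range_from_nat_into[rotated])
  have pI: "p n \<in> I" for n using rng by blast
  show ?thesis
  proof (intro exI[of _ "\<lambda>n. fst (p n)"] exI[of _ "\<lambda>n. snd (p n)"] conjI allI impI)
    show "snd (p n) > 0" for n using pI[of n] by (auto simp: I_def)
    show "\<exists>C. compact C \<and> cball (fst (p n)) (snd (p n)) \<subseteq> C" for n
      using pI[of n] by (auto simp: I_def)
    show "\<exists>n. c (fst (p n)) x < snd (p n) \<and> cball (fst (p n)) (snd (p n)) \<subseteq> U"
      if U: "open U" "x \<in> U" for U x
    proof -
      obtain q where q: "q \<in> I" "c (fst q) x < snd q \<and> cball (fst q) (snd q) \<subseteq> U"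
        using base[OF U] by (rule bexE)
      from q(1) obtain n where "q = p n" unfolding rng[symmetric] by (rule rangeE)
      then show ?thesis using q(2) by (intro exI[of _ n]) simp
    qed
  qed
qed

section \<open>Cutoff functions and uniform continuity on compact sets\<close>

lemma bump_C_0:
  assumes "r > 0" "compact C" "cball x r \<subseteq> C"
  shows "(\<lambda>y. max 0 (1 - c x y / r)) \<in> C_0"
proof -
  have *: "max 0 (1 - c x y / r) = 0" if "y \<notin> C" for y
  proof -
    have "\<not> c x y < r" using that assms(3) by auto
    then show ?thesis using assms(1) by (simp add: field_simps)
  qed
  then show ?thesis
    using assms unfolding C_0_def
    by (auto simp: * simp del: max_less_iff_conj intro!: continuous_intros exI[of _ C])
qed

text \<open>Sum the tents on those of the first \<open>n\<close> base balls that lie inside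
  \<open>U\<close>. A point of \<open>U\<close> is eventually in the support of a tent, a point
  outside never is, so multiplying by \<open>n\<close> and cutting at 1 increases to the indicator.
  Finite sums keep everything in \<open>C_0\<close>.\<close>

lemma open_indicator_approx:
  assumes "open U"
  obtains \<phi> :: "nat \<Rightarrow> 'a \<Rightarrow> real"
  where "\<And>n. \<phi> n \<in> C_0" "\<And>n x. 0 \<le> \<phi> n x" "\<And>n x. \<phi> n x \<le> 1" "\<And>x. incseq (\<lambda>n. \<phi> n x)"
    "\<And>x. (\<lambda>n. \<phi> n x) \<longlonglongrightarrow> indicator U x"
proof -
  obtain z :: "nat \<Rightarrow> 'a" and r where zr: "(\<forall>n. r n > 0)" "(\<forall>n. \<exists>C. compact C \<and> cball (z n) (r n) \<subseteq> C)"
    "(\<forall>U x. open U \<longrightarrow> x \<in> U \<longrightarrow> (\<exists>n. c (z n) x < r n \<and> cball (z n) (r n) \<subseteq> U))"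
    using countable_base by (elim exE conjE) (rule that)
  define b where "b i y = max 0 (1 - c (z i) y / r i)" for i y
  have b_C0: "b i \<in> C_0" for i
  proof -
    obtain C where "compact C" "cball (z i) (r i) \<subseteq> C" using zr(2) by metis
    then show ?thesis unfolding b_def by (intro bump_C_0[of "r i" C] zr(1)[rule_format])
  qed
  have b_nonneg: "0 \<le> b i y" for i y by (simp add: b_def)
  define I where "I n = {i. i < n \<and> cball (z i) (r i) \<subseteq> U}" for n
  have fin: "finite (I n)" for n by (simp add: I_def)
  define s where "s n x = real n * (\<Sum>i\<in>I n. b i x)" for n x
  have s_C0: "s n \<in> C_0" for n
    unfolding s_def by (intro C_0_scale C_0_sum fin b_C0)
  have s_nonneg: "0 \<le> s n x" for n x
    unfolding s_def by (intro mult_nonneg_nonneg sum_nonneg b_nonneg) simp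
  have s_mono: "s m x \<le> s n x" if "m \<le> n" for m n x
    unfolding s_def using that
    by (intro mult_mono sum_mono2 fin sum_nonneg b_nonneg) (auto simp: I_def)
  show ?thesis
  proof (rule that[of "\<lambda>n x. min 1 (s n x)"])
    show "(\<lambda>x. min 1 (s n x)) \<in> C_0" for n
      by (rule C_0_dominated[OF s_C0[of n]])
        (use s_nonneg C_0_continuous[OF s_C0] in \<open>auto intro!: continuous_intros\<close>)
    show "0 \<le> min 1 (s n x)" for n x using s_nonneg by simp
    show "incseq (\<lambda>n. min 1 (s n x))" for x
      by (intro monoI min.mono s_mono) auto
    show "(\<lambda>n. min 1 (s n x)) \<longlonglongrightarrow> indicator U x" for x
    proof (cases "x \<in> U")
      case True
      then obtain i where i: "c (z i) x < r i" "cball (z i) (r i) \<subseteq> U"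
        using zr(3) assms by meson
      have "b i x > 0" using i(1) zr(1)[rule_format, of i] by (simp add: b_def)
      then obtain N where N: "real N * b i x \<ge> 1"
        using reals_Archimedean3[of "b i x"] by (meson less_eq_real_def)
      have "min 1 (s n x) = 1" if n: "n \<ge> max N (Suc i)" for n
      proof -
        have "1 \<le> real n * b i x"
          using N n \<open>b i x > 0\<close> by (smt (verit) max.boundedE mult_right_mono of_nat_mono)
        also have "\<dots> \<le> s n x"
          unfolding s_def using n i(2)
          by (intro mult_left_mono member_le_sum fin b_nonneg) (auto simp: I_def)
        finally show ?thesis by simp
      qed
      then have "\<forall>\<^sub>F n in sequentially. min 1 (s n x) = 1"
        using eventually_sequentially by blast
      then show ?thesis using True by (auto intro: tendsto_eventually)
    next
      case False
      have "b i x = 0" if "i \<in> I n" for i n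
      proof -
        have "\<not> c (z i) x < r i" using that False by (auto simp: I_def)
        then show ?thesis using zr(1)[rule_format, of i] by (simp add: b_def field_simps)
      qed
      then have "s n x = 0" for n by (simp add: s_def)
      then show ?thesis using False by simp
    qed
  qed simp
qed

text \<open>The sets where the approximations of the constant 1 exceed 1/2 form an open cover. A
  finite subcover suffices, and the factor 2 raises the sum of the corresponding functions to at
  least 1 on \<open>S\<close>.\<close>

lemma compact_cutoff:
  assumes "compact (S :: 'a set)"
  obtains \<theta> where "\<theta> \<in> C_0" "\<And>x. 0 \<le> \<theta> x" "\<And>x. x \<in> S \<Longrightarrow> 1 \<le> \<theta> x"
proof -
  obtain \<phi> :: "nat \<Rightarrow> 'a \<Rightarrow> real" where \<phi>: "\<And>n. \<phi> n \<in> C_0" "\<And>n x. 0 \<le> \<phi> n x" "\<And>x. incseq (\<lambda>n. \<phi> n x)"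
    "\<And>x. (\<lambda>n. \<phi> n x) \<longlonglongrightarrow> indicator UNIV x"
    using open_indicator_approx[OF open_UNIV] by metis
  have op: "open {x. \<phi> n x > 1/2}" for n
    by (intro open_Collect_less continuous_on_const C_0_continuous \<phi>(1))
  have "S \<subseteq> (\<Union>n. {x. \<phi> n x > 1/2})"
  proof
    fix x
    have "\<forall>\<^sub>F n in sequentially. \<phi> n x > 1/2"
      using \<phi>(4)[of x] by (rule order_tendstoD) simp
    then show "x \<in> (\<Union>n. {x. \<phi> n x > 1/2})"
      by (auto simp: eventually_sequentially)
  qed
  then obtain N where N: "finite N" "S \<subseteq> (\<Union>n\<in>N. {x. \<phi> n x > 1/2})"
    using compactE_image[OF assms, of UNIV "\<lambda>n. {x. \<phi> n x > 1/2}"] op by (metis (no_types, lifting))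
  show ?thesis
  proof (rule that[of "\<lambda>x. 2 * (\<Sum>n\<in>N. \<phi> n x)"])
    show "(\<lambda>x. 2 * (\<Sum>n\<in>N. \<phi> n x)) \<in> C_0"
      by (intro C_0_scale C_0_sum N \<phi>)
    show "0 \<le> 2 * (\<Sum>n\<in>N. \<phi> n x)" for x by (simp add: sum_nonneg \<phi>)
    show "1 \<le> 2 * (\<Sum>n\<in>N. \<phi> n x)" if x: "x \<in> S" for x
    proof -
      obtain n where "n \<in> N" "\<phi> n x > 1/2" using N x by blast
      then show ?thesis
        using member_le_sum[of n N "\<lambda>n. \<phi> n x"] N(1) \<phi>(2) by force
    qed
  qed
qed

text \<open>A Lebesgue number argument on \<open>S \<times> S\<close>. The perturbed points
  \<open>x'\<close>, \<open>y'\<close> may leave \<open>S\<close>, which a partition of unity near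
  \<open>S\<close> requires.\<close>

lemma uniform_continuity_cost:
  assumes "compact S" "\<epsilon> > 0"
  obtains \<delta> where "\<delta> > 0"
    "\<And>x y x' y'. x \<in> S \<Longrightarrow> y \<in> S \<Longrightarrow> c x x' < \<delta> \<Longrightarrow> c y y' < \<delta> \<Longrightarrow> \<bar>c x' y' - c x y\<bar> < \<epsilon>"
proof -
  have "\<forall>p. \<exists>d>0. \<forall>x' y'. c (fst p) x' < d \<longrightarrow> c (snd p) y' < d \<longrightarrow> \<bar>c x' y' - c (fst p) (snd p)\<bar> < \<epsilon> / 2"
    using cost_continuous_eps[of "\<epsilon> / 2"] assms(2) by (metis half_gt_zero)
  then obtain d where d: "\<And>p. d p > 0"
    "\<And>p x' y'. c (fst p) x' < d p \<Longrightarrow> c (snd p) y' < d p \<Longrightarrow> \<bar>c x' y' - c (fst p) (snd p)\<bar> < \<epsilon> / 2"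
    by metis
  \<comment> \<open>Dividing by \<open>2 * K\<close> lets a point be reached from the centre
    \<open>p\<close> in two steps without leaving the radius \<open>d p\<close>.\<close>
  define e where "e p = d p / (2 * K)" for p
  have e: "e p > 0" "2 * K * e p = d p" for p using d(1)[of p] K_ge_1 by (auto simp: e_def)
  have "compact (S \<times> S)" using assms(1) by (simp add: compact_Times)
  then obtain P where P: "finite P" "P \<subseteq> S \<times> S" "S \<times> S \<subseteq> (\<Union>p\<in>P. cball (fst p) (e p) \<times> cball (snd p) (e p))"
  proof (rule compactE_image[of _ "S \<times> S" "\<lambda>p. cball (fst p) (e p) \<times> cball (snd p) (e p)"])
    show "open (cball (fst p) (e p) \<times> cball (snd p) (e p))" for p
      by (intro open_Times open_cball)
    show "S \<times> S \<subseteq> (\<Union>p\<in>S \<times> S. cball (fst p) (e p) \<times> cball (snd p) (e p))"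
      using e by force
  qed blast
  define \<delta> where "\<delta> = Min (insert 1 (e ` P))"
  have "\<delta> > 0" using P(1) e by (auto simp: \<delta>_def)
  moreover have "\<bar>c x' y' - c x y\<bar> < \<epsilon>"
    if "x \<in> S" "y \<in> S" "c x x' < \<delta>" "c y y' < \<delta>" for x y x' y'
  proof -
    have "(x, y) \<in> (\<Union>p\<in>P. cball (fst p) (e p) \<times> cball (snd p) (e p))"
      using P(3) that(1,2) by blast
    then obtain p where p: "p \<in> P" "c (fst p) x < e p" "c (snd p) y < e p" by auto
    have \<delta>: "\<delta> \<le> e p" using P(1) p(1) by (auto simp: \<delta>_def)
    have tri: "c u w < d p" if "c u v < e p" "c v w < \<delta>" for u v w
    proof -
      have "c u w \<le> K * (c u v + c v w)" by (rule quasi_triangle)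
      also have "\<dots> < K * (e p + e p)" using K_ge_1 that \<delta> by (intro mult_strict_left_mono) auto
      finally show ?thesis using e(2)[of p] by simp
    qed
    have "c u v < e p \<Longrightarrow> c u v < d p" for u v
      using tri[of u v v] \<open>\<delta> > 0\<close> by simp
    then have "\<bar>c x y - c (fst p) (snd p)\<bar> < \<epsilon> / 2" "\<bar>c x' y' - c (fst p) (snd p)\<bar> < \<epsilon> / 2"
      using d(2) p tri that by blast+
    then show ?thesis by linarith
  qed
  ultimately show ?thesis using that by blast
qed

text \<open>The countable base writes \<open>W\<close> as a countable union of rectangles. This
  makes \<open>c\<close>, and every continuous function of two points, measurable for the
  sigma-algebra on which couplings live.\<close>

lemma open_pair_sets:
  assumes "open (W :: ('a \<times> 'a) set)"
  shows "W \<in> sets (borel \<Otimes>\<^sub>M borel)"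
proof -
  obtain z :: "nat \<Rightarrow> 'a" and r where zr: "(\<forall>n. r n > 0)" "(\<forall>n. \<exists>C. compact C \<and> cball (z n) (r n) \<subseteq> C)"
    "(\<forall>U x. open U \<longrightarrow> x \<in> U \<longrightarrow> (\<exists>n. c (z n) x < r n \<and> cball (z n) (r n) \<subseteq> U))"
    using countable_base by (elim exE conjE) (rule that)
  define R where "R p = cball (z (fst p)) (r (fst p)) \<times> cball (z (snd p)) (r (snd p))" for p
  have "W = (\<Union>p\<in>{p. R p \<subseteq> W}. R p)"
  proof (intro equalityI subsetI)
    fix w assume "w \<in> W"
    from open_prod_elim[OF assms this]
    obtain A B where AB: "open A" "open B" "w \<in> A \<times> B" "A \<times> B \<subseteq> W" .
    obtain m where m: "c (z m) (fst w) < r m" "cball (z m) (r m) \<subseteq> A"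
      using zr(3)[rule_format, of A "fst w"] AB by (auto simp: mem_Times_iff)
    obtain n where n: "c (z n) (snd w) < r n" "cball (z n) (r n) \<subseteq> B"
      using zr(3)[rule_format, of B "snd w"] AB by (auto simp: mem_Times_iff)
    have "R (m, n) \<subseteq> W" "w \<in> R (m, n)"
      using m n AB(4) by (auto simp: R_def mem_Times_iff)
    then show "w \<in> (\<Union>p\<in>{p. R p \<subseteq> W}. R p)" by blast
  qed auto
  moreover have "R p \<in> sets (borel \<Otimes>\<^sub>M borel)" for p
    unfolding R_def by (intro pair_measureI borel_open open_cball)
  ultimately show ?thesis
    by (metis (no_types, lifting) countableI_type sets.countable_UN'')
qed

lemma continuous_pair_measurable:
  fixes h :: "'a \<times> 'a \<Rightarrow> real"
  assumes "continuous_on UNIV h"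
  shows "h \<in> borel_measurable (borel \<Otimes>\<^sub>M borel)"
proof (rule borel_measurableI)
  fix S :: "real set" assume "open S"
  then have "open (h -` S)"
    using assms by (simp add: continuous_on_open_vimage)
  then show "h -` S \<inter> space (borel \<Otimes>\<^sub>M borel) \<in> sets (borel \<Otimes>\<^sub>M borel)"
    by (simp add: open_pair_sets space_pair_measure)
qed

lemma measurable_cost_pair [measurable]: "(\<lambda>p. c (fst p) (snd p)) \<in> borel_measurable (borel \<Otimes>\<^sub>M borel)"
  by (rule continuous_pair_measurable[OF continuous_on_cost_pair])

lemma measurable_cost_left [measurable]: "c z \<in> borel_measurable borel"
  by (rule borel_measurable_continuous_onI) (intro continuous_intros)

lemma singleton_sets [measurable]: "{x} \<in> sets (borel :: 'a measure)"
proof -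
  have "{x} = {y \<in> space borel. c x y = 0}" by auto
  also have "\<dots> \<in> sets borel" by measurable
  finally show ?thesis .
qed

end

section \<open>Transport duality for finitely many points\<close>

text \<open>The marginal constraints are penalized: at a minimizer of
  \<open>\<Sum> \<pi> c + (\<parallel>r - p\<parallel>\<^sup>2 + \<parallel>s - q\<parallel>\<^sup>2) / (2 e)\<close> over the nonnegative \<open>\<pi>\<close>
  (with marginals \<open>r\<close>, \<open>s\<close>) the scaled
  defects \<open>(p - r) / e\<close> and \<open>(q - s) / e\<close> are dual feasible.\<close>

lemma right_derivative_nonneg:
  fixes F :: "real \<Rightarrow> real"
  assumes "(F has_real_derivative D) (at 0)" "\<delta> > 0" "\<And>h. 0 < h \<Longrightarrow> h < \<delta> \<Longrightarrow> F 0 \<le> F h"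
  shows "D \<ge> 0"
proof (rule ccontr)
  assume "\<not> D \<ge> 0"
  then obtain d where "d > 0" "\<And>h. 0 < h \<Longrightarrow> h < d \<Longrightarrow> F 0 > F h"
    using DERIV_neg_dec_right[OF assms(1)] by auto
  then show False
    using assms(2) assms(3)[of "min d \<delta> / 2"] by (smt (verit, best) field_sum_of_halves min_def)
qed

definition penalized :: "nat \<Rightarrow> (nat \<Rightarrow> nat \<Rightarrow> real) \<Rightarrow> (nat \<Rightarrow> real) \<Rightarrow> (nat \<Rightarrow> real) \<Rightarrow> real \<Rightarrow>
    (nat \<times> nat \<Rightarrow> real) \<Rightarrow> real" where
  "penalized n C p q e \<pi> = (\<Sum>i<n. \<Sum>j<n. \<pi> (i,j) * C i j)
     + ((\<Sum>i<n. ((\<Sum>j<n. \<pi> (i,j)) - p i)\<^sup>2) + (\<Sum>j<n. ((\<Sum>i<n. \<pi> (i,j)) - q j)\<^sup>2)) / (2 * e)"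

lemma continuous_on_coordinate [continuous_intros]:
  "continuous_on S (\<lambda>\<pi> :: 'i \<Rightarrow> real. \<pi> i)"
  by (rule continuous_on_subset[OF continuous_on_product_coordinates]) auto

text \<open>Tychonoff's theorem. Plans are functions on all index pairs, although only an
  \<open>n\<close> by \<open>n\<close> block enters the functional, so boxes replace bounded closed
  sets of a finite-dimensional space.\<close>

lemma compact_box: "compact {\<pi> :: 'i \<Rightarrow> real. \<forall>i. 0 \<le> \<pi> i \<and> \<pi> i \<le> M}"
proof -
  have "{\<pi> :: 'i \<Rightarrow> real. \<forall>i. 0 \<le> \<pi> i \<and> \<pi> i \<le> M} = PiE UNIV (\<lambda>i. {0..M})"
    by (auto simp: PiE_def)
  then show ?thesis
    using compactin_PiE[of "\<lambda>i. euclidean :: real topology" "UNIV :: 'i set" "\<lambda>i. {0..M}"]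
    by (simp add: euclidean_product_topology)
qed

text \<open>Raising one entry changes one row sum and one column sum by the same amount. The
  derivative is therefore the cost of that entry plus two scaled defects, that is, the slack in the
  dual constraint.\<close>

lemma penalized_direction:
  fixes \<pi> :: "nat \<times> nat \<Rightarrow> real"
  assumes "k < n" "l < n" "e > 0"
  shows "((\<lambda>h. penalized n C p q e (\<pi>((k,l) := \<pi> (k,l) + h))) has_real_derivative
     C k l + (((\<Sum>j<n. \<pi> (k,j)) - p k) + ((\<Sum>i<n. \<pi> (i,l)) - q l)) / e) (at 0)"
proof -
  let ?u = "\<lambda>h. \<pi>((k,l) := \<pi> (k,l) + h)"
  have upd: "?u h (i, j) = \<pi> (i, j) + (if i = k then if j = l then h else 0 else 0)" for h i j by auto
  have "penalized n C p q e (?u h) = (\<Sum>i<n. \<Sum>j<n. \<pi> (i,j) * C i j) + h * C k l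
     + ((\<Sum>i<n. ((\<Sum>j<n. \<pi> (i,j)) - p i + (if i = k then h else 0))\<^sup>2)
     + (\<Sum>j<n. ((\<Sum>i<n. \<pi> (i,j)) - q j + (if j = l then h else 0))\<^sup>2)) / (2 * e)" for h
  proof -
    have "(\<Sum>i<n. \<Sum>j<n. ?u h (i,j) * C i j) = (\<Sum>i<n. \<Sum>j<n. \<pi> (i,j) * C i j)
        + (\<Sum>i<n. \<Sum>j<n. if i = k then if j = l then h * C i j else 0 else 0)"
      unfolding upd distrib_right sum.distrib by (intro arg_cong2[of _ _ _ _ "(+)"] sum.cong) auto
    also have "(\<Sum>i<n. \<Sum>j<n. if i = k then if j = l then h * C i j else 0 else 0)
        = (\<Sum>i<n. if i = k then h * C i l else 0)"
      using assms by (intro sum.cong) auto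
    also have "\<dots> = h * C k l" using assms by simp
    finally have 1: "(\<Sum>i<n. \<Sum>j<n. ?u h (i,j) * C i j) = (\<Sum>i<n. \<Sum>j<n. \<pi> (i,j) * C i j) + h * C k l" .
    have 2: "(\<Sum>j<n. ?u h (i,j)) = (\<Sum>j<n. \<pi> (i,j)) + (if i = k then h else 0)" for i
      unfolding upd sum.distrib using assms by auto
    have 3: "(\<Sum>i<n. ?u h (i,j)) = (\<Sum>i<n. \<pi> (i,j)) + (if j = l then h else 0)" for j
      unfolding upd sum.distrib using assms by (auto simp: sum.delta)
    show ?thesis
      unfolding penalized_def 1 2 3 by (simp add: algebra_simps)
  qed
  then have *: "(\<lambda>h. penalized n C p q e (?u h)) = (\<lambda>h. (\<Sum>i<n. \<Sum>j<n. \<pi> (i,j) * C i j) + h * C k l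
     + ((\<Sum>i<n. ((\<Sum>j<n. \<pi> (i,j)) - p i + (if i = k then h else 0))\<^sup>2)
     + (\<Sum>j<n. ((\<Sum>i<n. \<pi> (i,j)) - q j + (if j = l then h else 0))\<^sup>2)) / (2 * e))" by auto
  have sq: "((\<lambda>h. \<Sum>i<n. (w i + (if i = m then h else 0))\<^sup>2) has_real_derivative 2 * w m) (at 0)"
    if "m < n" for w :: "nat \<Rightarrow> real" and m
  proof -
    have "((\<lambda>h. (w i + (if i = m then h else 0))\<^sup>2) has_real_derivative (if i = m then 2 * w m else 0)) (at 0)" for i
      by (auto intro!: derivative_eq_intros)
    then have "((\<lambda>h. \<Sum>i<n. (w i + (if i = m then h else 0))\<^sup>2) has_real_derivative
        (\<Sum>i<n. if i = m then 2 * w m else 0)) (at 0)"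
      by (rule DERIV_sum)
    then show ?thesis using that by simp
  qed
  note DERIV_add[OF DERIV_add[OF DERIV_const DERIV_cmult_right[OF DERIV_ident]]
      DERIV_cdivide[OF DERIV_add[OF sq[OF assms(1)] sq[OF assms(2)]]]]
  note this[of "\<Sum>i<n. \<Sum>j<n. \<pi> (i,j) * C i j" "C k l" "\<lambda>i. (\<Sum>j<n. \<pi> (i,j)) - p i"
      "\<lambda>j. (\<Sum>i<n. \<pi> (i,j)) - q j" "2 * e"]
  then show ?thesis
    unfolding * by (rule back_subst[where P = "\<lambda>D. (_ has_real_derivative D) _"])
      (use assms(3) in \<open>simp add: add_divide_distrib diff_divide_distrib\<close>)
qed

text \<open>First-order conditions at a minimizer give dual feasibility of the scaled defects
  \<open>a\<close>, \<open>b\<close> and complementary slackness on positive entries. Hence the cost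
  equals the dual value minus \<open>e\<close> times the squared norm of the potentials. Both
  conclusions follow, because the squared defect is \<open>e * e\<close> times that norm and the
  cost is nonnegative. The bound 4 only provides compactness and never binds.\<close>

lemma penalized_minimizer:
  fixes n :: nat
  assumes "e > 0" and C: "\<And>i j. 0 \<le> (C i j :: real)"
    and p: "\<And>i. 0 \<le> p i" "(\<Sum>i<n. p i) = 1" and q: "\<And>j. 0 \<le> q j" "(\<Sum>j<n. q j) = 1"
    and dual: "\<And>a b :: nat \<Rightarrow> real. (\<And>i j. i < n \<Longrightarrow> j < n \<Longrightarrow> a i + b j \<le> C i j) \<Longrightarrow>
         (\<Sum>i<n. a i * p i) + (\<Sum>j<n. b j * q j) \<le> L"
  obtains \<pi> where "\<And>i. 0 \<le> \<pi> i \<and> \<pi> i \<le> 4" "(\<Sum>i<n. \<Sum>j<n. \<pi> (i,j) * C i j) \<le> L"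
    "(\<Sum>i<n. ((\<Sum>j<n. \<pi> (i,j)) - p i)\<^sup>2) + (\<Sum>j<n. ((\<Sum>i<n. \<pi> (i,j)) - q j)\<^sup>2) \<le> e * L"
proof -
  let ?X = "{\<pi> :: nat \<times> nat \<Rightarrow> real. \<forall>i. 0 \<le> \<pi> i \<and> \<pi> i \<le> 4}"
  let ?F = "penalized n C p q e"
  have "continuous_on ?X ?F"
    unfolding penalized_def using \<open>e > 0\<close> by (auto intro!: continuous_intros)
  moreover have "?X \<noteq> {}" by (auto intro!: exI[of _ "\<lambda>_. 0"])
  ultimately have "\<exists>\<pi>\<in>?X. \<forall>\<pi>'\<in>?X. ?F \<pi> \<le> ?F \<pi>'"
    by (intro continuous_attains_inf compact_box)
  then obtain \<pi> where \<pi>: "\<pi> \<in> ?X" and min: "\<forall>\<pi>'\<in>?X. ?F \<pi> \<le> ?F \<pi>'"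
    by (elim bexE) (rule that)
  define r where "r i = (\<Sum>j<n. \<pi> (i,j))" for i
  define s where "s j = (\<Sum>i<n. \<pi> (i,j))" for j
  have \<pi>0: "0 \<le> \<pi> x" "\<pi> x \<le> 4" for x using \<pi> by blast+
  have cost_nn: "0 \<le> (\<Sum>i<n. \<Sum>j<n. \<pi> (i,j) * C i j)"
    by (intro sum_nonneg mult_nonneg_nonneg C \<pi>0)
  have p1: "p i \<le> 1" if "i < n" for i
    using member_le_sum[of i "{..<n}" p] p that by auto
  have q1: "q i \<le> 1" if "i < n" for i
    using member_le_sum[of i "{..<n}" q] q that by auto
  have sqp: "(\<Sum>i<n. (p i)\<^sup>2) \<le> 1" "(\<Sum>i<n. (q i)\<^sup>2) \<le> 1"
  proof -
    have "(\<Sum>i<n. (p i)\<^sup>2) \<le> (\<Sum>i<n. p i)"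
      by (intro sum_mono) (use p p1 in \<open>auto simp: power2_eq_square intro: mult_left_le\<close>)
    then show "(\<Sum>i<n. (p i)\<^sup>2) \<le> 1" using p by simp
    have "(\<Sum>i<n. (q i)\<^sup>2) \<le> (\<Sum>i<n. q i)"
      by (intro sum_mono) (use q q1 in \<open>auto simp: power2_eq_square intro: mult_left_le\<close>)
    then show "(\<Sum>i<n. (q i)\<^sup>2) \<le> 1" using q by simp
  qed
  \<comment> \<open>The zero plan is a competitor with penalty at most \<open>2 / (2 * e)\<close>.
    So every row sum exceeds its target by at most 2, and all entries of the block are at most 3,
    strictly inside the box.\<close>
  have "?F \<pi> \<le> ?F (\<lambda>_. 0)" by (rule min[rule_format]) auto
  also have "\<dots> = ((\<Sum>i<n. (p i)\<^sup>2) + (\<Sum>i<n. (q i)\<^sup>2)) / (2 * e)"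
    by (simp add: penalized_def)
  also have "\<dots> \<le> 2 / (2 * e)"
    using sqp \<open>e > 0\<close> by (intro divide_right_mono) linarith+
  finally have "((\<Sum>i<n. (r i - p i)\<^sup>2) + (\<Sum>j<n. (s j - q j)\<^sup>2)) / (2 * e) \<le> 2 / (2 * e)"
    using cost_nn by (simp add: penalized_def r_def s_def)
  then have defect: "(\<Sum>i<n. (r i - p i)\<^sup>2) + (\<Sum>j<n. (s j - q j)\<^sup>2) \<le> 2"
    using \<open>e > 0\<close> by (subst (asm) divide_le_cancel) simp
  have r3: "r i \<le> 3" if "i < n" for i
  proof -
    have "(r i - p i)\<^sup>2 \<le> (\<Sum>i<n. (r i - p i)\<^sup>2)"
      using that by (intro member_le_sum) auto
    also have "\<dots> \<le> 2" using defect sum_nonneg[of "{..<n}" "\<lambda>j. (s j - q j)\<^sup>2"] by simp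
    finally have "(r i - p i)\<^sup>2 \<le> 2\<^sup>2" by simp
    then have "r i - p i \<le> 2" using power2_le_imp_le[of "r i - p i" 2] by simp
    then show ?thesis using p1[OF that] by simp
  qed
  have small: "\<pi> (i, j) \<le> 3" if "i < n" "j < n" for i j
    using member_le_sum[of j "{..<n}" "\<lambda>j. \<pi> (i, j)"] \<pi>0 r3[OF that(1)] that(2) by (auto simp: r_def)
  define a where "a i = (p i - r i) / e" for i
  define b where "b j = (q j - s j) / e" for j
  have D: "((\<lambda>h. ?F (\<pi>((k,l) := \<pi> (k,l) + h))) has_real_derivative C k l - a k - b l) (at 0)"
    if "k < n" "l < n" for k l
  proof -
    have "C k l + (((\<Sum>j<n. \<pi> (k,j)) - p k) + ((\<Sum>i<n. \<pi> (i,l)) - q l)) / e = C k l - a k - b l"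
      using \<open>e > 0\<close> by (simp add: a_def b_def r_def s_def field_simps)
    then show ?thesis using penalized_direction[OF that \<open>e > 0\<close>, of C p q \<pi>] by metis
  qed
  \<comment> \<open>Entries are at most 3, so raising one of them by less than 1 stays in the
    box.\<close>
  have feas: "a k + b l \<le> C k l" if "k < n" "l < n" for k l
  proof -
    have "C k l - a k - b l \<ge> 0"
    proof (rule right_derivative_nonneg[OF D[OF that], of 1])
      show "?F (\<pi>((k, l) := \<pi> (k, l) + 0)) \<le> ?F (\<pi>((k, l) := \<pi> (k, l) + h))" if "0 < h" "h < 1" for h
        using \<pi>0 small[OF \<open>k < n\<close> \<open>l < n\<close>] that by (auto intro!: min[rule_format])
    qed simp
    then show ?thesis by simp
  qed
  \<comment> \<open>A positive entry can also be lowered a little, so the derivative vanishes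
    there.\<close>
  have slack: "\<pi> (k, l) * C k l = \<pi> (k, l) * (a k + b l)" if "k < n" "l < n" for k l
  proof (cases "\<pi> (k, l) = 0")
    case False
    then have pos: "\<pi> (k, l) > 0" using \<pi>0[of "(k, l)"] by auto
    have "((\<lambda>h. - h) has_real_derivative - 1) (at (0::real))"
      by (auto intro!: derivative_eq_intros)
    moreover have "((\<lambda>h. ?F (\<pi>((k,l) := \<pi> (k,l) + h))) has_real_derivative C k l - a k - b l) (at (- 0))"
      using D[OF that] by simp
    ultimately have "((\<lambda>h. ?F (\<pi>((k,l) := \<pi> (k,l) + - h))) has_real_derivative (C k l - a k - b l) * - 1) (at 0)"
      by (rule DERIV_chain2[rotated])
    then have "(C k l - a k - b l) * - 1 \<ge> 0"
    proof (rule right_derivative_nonneg[of _ _ "\<pi> (k,l)"])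
      show "?F (\<pi>((k, l) := \<pi> (k, l) + - 0)) \<le> ?F (\<pi>((k, l) := \<pi> (k, l) + - h))" if "0 < h" "h < \<pi> (k,l)" for h
      proof -
        have "\<pi> (k,l) + - h \<le> 4" "0 \<le> \<pi> (k,l) + - h" using \<pi>0(2)[of "(k,l)"] that by linarith+
        then have "\<pi>((k,l) := \<pi> (k,l) + - h) \<in> ?X" using \<pi>0 by simp
        from min[rule_format, OF this] show ?thesis by simp
      qed
    qed (rule pos)
    then show ?thesis using feas[OF that] by simp
  qed simp
  have "(\<Sum>i<n. \<Sum>j<n. \<pi> (i,j) * C i j) = (\<Sum>i<n. \<Sum>j<n. \<pi> (i,j) * a i + \<pi> (i,j) * b j)"
    by (intro sum.cong refl) (simp add: slack distrib_left)
  also have "\<dots> = (\<Sum>i<n. a i * r i) + (\<Sum>j<n. b j * s j)"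
    unfolding sum.distrib r_def s_def sum.swap[of "\<lambda>i j. \<pi> (i,j) * b j"]
    by (simp add: sum_distrib_left mult.commute)
  \<comment> \<open>The actual marginals are \<open>r i = p i - e * a i\<close> and
    \<open>s j = q j - e * b j\<close>.\<close>
  also have "\<dots> = (\<Sum>i<n. a i * p i) + (\<Sum>j<n. b j * q j)
      - e * ((\<Sum>i<n. (a i)\<^sup>2) + (\<Sum>j<n. (b j)\<^sup>2))"
  proof -
    have "a i * r i = a i * p i - e * (a i)\<^sup>2" for i
      using \<open>e > 0\<close> by (simp add: a_def field_simps power2_eq_square)
    moreover have "b i * s i = b i * q i - e * (b i)\<^sup>2" for i
      using \<open>e > 0\<close> by (simp add: b_def field_simps power2_eq_square)
    ultimately show ?thesis
      by (simp add: sum_subtractf sum_distrib_left distrib_left)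
  qed
  finally have eq: "(\<Sum>i<n. \<Sum>j<n. \<pi> (i,j) * C i j) \<le> L - e * ((\<Sum>i<n. (a i)\<^sup>2) + (\<Sum>j<n. (b j)\<^sup>2))"
    using dual[OF feas] by simp
  have nn: "0 \<le> (\<Sum>i<n. (a i)\<^sup>2) + (\<Sum>j<n. (b j)\<^sup>2)" by (intro add_nonneg_nonneg sum_nonneg) auto
  have ab: "(r i - p i)\<^sup>2 = e * (e * (a i)\<^sup>2)" "(s i - q i)\<^sup>2 = e * (e * (b i)\<^sup>2)" for i
    using \<open>e > 0\<close> by (auto simp: a_def b_def power2_eq_square field_simps)
  have "(\<Sum>i<n. (r i - p i)\<^sup>2) + (\<Sum>j<n. (s j - q j)\<^sup>2) = e * (e * ((\<Sum>i<n. (a i)\<^sup>2) + (\<Sum>j<n. (b j)\<^sup>2)))"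
    unfolding ab by (simp add: sum_distrib_left distrib_left)
  also have "\<dots> \<le> e * L" using eq cost_nn \<open>e > 0\<close> by (intro mult_left_mono) auto
  finally have "(\<Sum>i<n. (r i - p i)\<^sup>2) + (\<Sum>j<n. (s j - q j)\<^sup>2) \<le> e * L" .
  moreover have "(\<Sum>i<n. \<Sum>j<n. \<pi> (i,j) * C i j) \<le> L"
    using eq nn \<open>e > 0\<close> by (smt (verit) mult_nonneg_nonneg)
  ultimately show ?thesis
    using that[OF conjI[OF \<pi>0]] by (simp add: r_def s_def)
qed

text \<open>Instead of extracting a limit of penalized minimizers, minimize the defect over the
  compact set of plans with cost at most \<open>L\<close>. Its minimum is at most
  \<open>e * L\<close> for every \<open>e > 0\<close>, hence zero.\<close>

theorem finite_transport_duality: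
  fixes n :: nat
  assumes C: "\<And>i j. 0 \<le> (C i j :: real)"
    and p: "\<And>i. 0 \<le> p i" "(\<Sum>i<n. p i) = 1" and q: "\<And>j. 0 \<le> q j" "(\<Sum>j<n. q j) = 1"
    and dual: "\<And>a b :: nat \<Rightarrow> real. (\<And>i j. i < n \<Longrightarrow> j < n \<Longrightarrow> a i + b j \<le> C i j) \<Longrightarrow>
         (\<Sum>i<n. a i * p i) + (\<Sum>j<n. b j * q j) \<le> L"
  obtains \<pi> :: "nat \<Rightarrow> nat \<Rightarrow> real" where "\<And>i j. 0 \<le> \<pi> i j" "(\<Sum>i<n. \<Sum>j<n. \<pi> i j * C i j) \<le> L"
    "\<And>i. i < n \<Longrightarrow> (\<Sum>j<n. \<pi> i j) = p i" "\<And>j. j < n \<Longrightarrow> (\<Sum>i<n. \<pi> i j) = q j"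
proof -
  let ?cost = "\<lambda>\<pi> :: nat \<times> nat \<Rightarrow> real. \<Sum>i<n. \<Sum>j<n. \<pi> (i,j) * C i j"
  let ?G = "\<lambda>\<pi>. (\<Sum>i<n. ((\<Sum>j<n. \<pi> (i,j)) - p i)\<^sup>2) + (\<Sum>j<n. ((\<Sum>i<n. \<pi> (i,j)) - q j)\<^sup>2)"
  let ?X = "{\<pi> :: nat \<times> nat \<Rightarrow> real. \<forall>i. 0 \<le> \<pi> i \<and> \<pi> i \<le> 4} \<inter> {\<pi>. ?cost \<pi> \<le> L}"
  have "closed {\<pi>. ?cost \<pi> \<le> L}"
    by (intro closed_Collect_le continuous_intros)
  then have "compact ?X"
    using compact_box by (rule compact_Int_closed[rotated])
  have ex: "\<exists>\<pi>\<in>?X. ?G \<pi> \<le> e * L" if "e > 0" for e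
    by (rule penalized_minimizer[of e C p n q L]) (use that C p q dual in blast)+
  have "continuous_on ?X ?G" by (intro continuous_intros)
  moreover have "?X \<noteq> {}" using ex[of 1] by auto
  ultimately have "\<exists>\<pi>\<in>?X. \<forall>\<pi>'\<in>?X. ?G \<pi> \<le> ?G \<pi>'"
    by (intro continuous_attains_inf \<open>compact ?X\<close>)
  then obtain \<pi> where \<pi>: "\<pi> \<in> ?X" and min: "\<forall>\<pi>'\<in>?X. ?G \<pi> \<le> ?G \<pi>'"
    by (elim bexE) (rule that)
  have le: "?G \<pi> \<le> e * L" if "e > 0" for e
    using ex[OF that] min by (elim bexE) (rule order_trans[OF min[rule_format]])
  have nn: "0 \<le> (\<Sum>i<n. ((\<Sum>j<n. \<pi> (i,j)) - p i)\<^sup>2)" "0 \<le> (\<Sum>j<n. ((\<Sum>i<n. \<pi> (i,j)) - q j)\<^sup>2)"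
    by (auto intro: sum_nonneg)
  have "?G \<pi> \<le> 0"
  proof (rule field_le_epsilon)
    fix \<epsilon> :: real assume "\<epsilon> > 0"
    have "?G \<pi> \<le> \<epsilon> / (\<bar>L\<bar> + 1) * L" using \<open>\<epsilon> > 0\<close> by (intro le) auto
    also have "\<dots> \<le> \<epsilon> / (\<bar>L\<bar> + 1) * (\<bar>L\<bar> + 1)" using \<open>\<epsilon> > 0\<close> by (intro mult_left_mono) auto
    finally show "?G \<pi> \<le> 0 + \<epsilon>" by simp
  qed
  then have 0: "(\<Sum>i<n. ((\<Sum>j<n. \<pi> (i,j)) - p i)\<^sup>2) = 0" "(\<Sum>j<n. ((\<Sum>i<n. \<pi> (i,j)) - q j)\<^sup>2) = 0"
    using nn by linarith+
  show ?thesis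
  proof (rule that[of "\<lambda>i j. \<pi> (i, j)"])
    show "(\<Sum>j<n. \<pi> (i, j)) = p i" if "i < n" for i
      using 0(1) that by (subst (asm) sum_nonneg_eq_0_iff) auto
    show "(\<Sum>i<n. \<pi> (i, j)) = q j" if "j < n" for j
      using 0(2) that by (subst (asm) sum_nonneg_eq_0_iff) auto
  qed (use \<pi> in auto)
qed

section \<open>Borel probability measures and kernels\<close>

lemma borel_probsD:
  assumes "\<mu> \<in> borel_probs"
  shows "prob_space \<mu>" "sets \<mu> = sets borel" "space \<mu> = UNIV"
  using assms sets_eq_imp_space_eq[of \<mu> borel] by (auto simp: borel_probs_def)

lemma borel_probs_measurable: "\<mu> \<in> borel_probs \<Longrightarrow> borel_measurable \<mu> = borel_measurable borel"
  by (rule measurable_cong_sets) (auto dest: borel_probsD)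

lemma C_b_measurable: "\<phi> \<in> C_b \<Longrightarrow> \<phi> \<in> borel_measurable borel"
  by (rule borel_measurable_continuous_onI) (rule C_b_continuous)

lemma C_b_integrable:
  assumes "\<mu> \<in> borel_probs" "\<phi> \<in> C_b"
  shows "integrable \<mu> \<phi>"
proof -
  interpret prob_space \<mu> by (rule borel_probsD[OF assms(1)])
  obtain M where "\<And>x. \<bar>\<phi> x\<bar> \<le> M" using assms(2) by (auto simp: C_b_def)
  then show ?thesis
    using C_b_measurable[OF assms(2)] borel_probs_measurable[OF assms(1)]
    by (intro integrable_const_bound[of _ M]) auto
qed

lemma borel_probs_integral_le:
  fixes \<phi> :: "_ \<Rightarrow> real"
  assumes "\<mu> \<in> borel_probs" "integrable \<mu> \<phi>" "\<And>x. \<phi> x \<le> M"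
  shows "(\<integral>x. \<phi> x \<partial>\<mu>) \<le> M"
proof -
  interpret prob_space \<mu> by (rule borel_probsD[OF assms(1)])
  have "(\<integral>x. \<phi> x \<partial>\<mu>) \<le> (\<integral>x. M \<partial>\<mu>)"
    by (rule integral_mono[OF assms(2)]) (simp_all add: assms(3))
  then show ?thesis by (simp add: prob_space)
qed

lemma C_b_integral_bound:
  assumes "\<mu> \<in> borel_probs" "\<phi> \<in> C_b" "\<And>x. \<bar>\<phi> x\<bar> \<le> M"
  shows "\<bar>\<integral>x. \<phi> x \<partial>\<mu>\<bar> \<le> M"
proof -
  have "\<bar>\<integral>x. \<phi> x \<partial>\<mu>\<bar> \<le> (\<integral>x. \<bar>\<phi> x\<bar> \<partial>\<mu>)" by (rule integral_abs_bound)
  also have "\<dots> \<le> M"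
    using C_b_integrable[OF assms(1,2)] assms(3) by (intro borel_probs_integral_le[OF assms(1)]) auto
  finally show ?thesis .
qed

lemma C_b_diff: "\<phi> \<in> C_b \<Longrightarrow> \<psi> \<in> C_b \<Longrightarrow> (\<lambda>x. \<phi> x - \<psi> x) \<in> C_b"
proof -
  assume *: "\<phi> \<in> C_b" "\<psi> \<in> C_b"
  then obtain M N where b: "\<And>x. \<bar>\<phi> x\<bar> \<le> M" "\<And>x. \<bar>\<psi> x\<bar> \<le> N" by (auto simp: C_b_def)
  have "\<bar>\<phi> x - \<psi> x\<bar> \<le> M + N" for x
    by (rule order_trans[OF abs_triangle_ineq4 add_mono]) (rule b)+
  then show ?thesis using * by (intro C_bI) (auto intro!: continuous_intros simp: C_b_continuous)
qed

text \<open>Fubini for a mixture of measures. An unbounded \<open>f\<close> that is integrable for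
  the mixture is integrable only for almost every component, so the finite nonnegative integral is
  used to discard the exceptional ones.\<close>

lemma has_bochner_integral_bind_nonneg:
  fixes f :: "'b \<Rightarrow> real"
  assumes N [measurable]: "N \<in> M \<rightarrow>\<^sub>M subprob_algebra B" and f [measurable]: "f \<in> borel_measurable B"
    and nn: "\<And>x. 0 \<le> f x" and int: "integrable (M \<bind> N) f"
  shows "has_bochner_integral M (\<lambda>x. \<integral>y. f y \<partial>N x) (\<integral>y. f y \<partial>(M \<bind> N))"
    "AE x in M. integrable (N x) f"
proof -
  have meas: "f \<in> borel_measurable (N x)" if "x \<in> space M" for x
    using sets_kernel[OF N that] f by (simp cong: measurable_cong_sets)
  have fin: "(\<integral>\<^sup>+x. \<integral>\<^sup>+y. f y \<partial>N x \<partial>M) = ennreal (\<integral>y. f y \<partial>(M \<bind> N))"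
    using nn_integral_bind[of f B N M] nn_integral_eq_integral[OF int] nn by simp
  have "AE x in M. (\<integral>\<^sup>+y. f y \<partial>N x) \<noteq> \<infinity>"
    by (rule nn_integral_noteq_infinite) (simp_all add: fin)
  with AE_space show ae: "AE x in M. integrable (N x) f"
    by eventually_elim (auto intro!: integrableI_bounded meas simp: nn less_top)
  have "(\<integral>\<^sup>+x. ennreal (\<integral>y. f y \<partial>N x) \<partial>M) = (\<integral>\<^sup>+x. \<integral>\<^sup>+y. f y \<partial>N x \<partial>M)"
    using ae by (intro nn_integral_cong_AE) (auto simp: nn nn_integral_eq_integral elim!: eventually_mono)
  then show "has_bochner_integral M (\<lambda>x. \<integral>y. f y \<partial>N x) (\<integral>y. f y \<partial>(M \<bind> N))"
    by (intro has_bochner_integral_nn_integral) (auto simp: fin intro!: AE_I2 Bochner_Integration.integral_nonneg nn)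
qed

lemma has_bochner_integral_bind:
  fixes f :: "'b \<Rightarrow> real"
  assumes N [measurable]: "N \<in> M \<rightarrow>\<^sub>M subprob_algebra B" and f [measurable]: "f \<in> borel_measurable B"
    and int: "integrable (M \<bind> N) f"
  shows "has_bochner_integral M (\<lambda>x. \<integral>y. f y \<partial>N x) (\<integral>y. f y \<partial>(M \<bind> N))"
    "AE x in M. integrable (N x) f"
proof -
  have p: "integrable (M \<bind> N) (\<lambda>y. max 0 (f y))" and n: "integrable (M \<bind> N) (\<lambda>y. max 0 (- f y))"
    using int by (auto intro!: integrable_max)
  note P = has_bochner_integral_bind_nonneg[OF N _ _ p] has_bochner_integral_bind_nonneg[OF N _ _ n]
  have ae: "AE x in M. integrable (N x) (\<lambda>y. max 0 (f y)) \<and> integrable (N x) (\<lambda>y. max 0 (- f y))"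
    using P(2,4) by simp
  have f_eq: "f = (\<lambda>y. max 0 (f y) - max 0 (- f y))" by (auto simp: fun_eq_iff max_def)
  show "AE x in M. integrable (N x) f"
    using ae
  proof eventually_elim
    case (elim x)
    then have "integrable (N x) (\<lambda>y. max 0 (f y) - max 0 (- f y))" by (intro Bochner_Integration.integrable_diff) auto
    then show ?case using f_eq by simp
  qed
  have "has_bochner_integral M (\<lambda>x. (\<integral>y. max 0 (f y) \<partial>N x) - (\<integral>y. max 0 (- f y) \<partial>N x))
      ((\<integral>y. max 0 (f y) \<partial>(M \<bind> N)) - (\<integral>y. max 0 (- f y) \<partial>(M \<bind> N)))"
    by (intro has_bochner_integral_diff P) auto
  also have "(\<integral>y. max 0 (f y) \<partial>(M \<bind> N)) - (\<integral>y. max 0 (- f y) \<partial>(M \<bind> N)) = (\<integral>y. f y \<partial>(M \<bind> N))"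
    by (subst (3) f_eq) (simp add: p n)
  finally show "has_bochner_integral M (\<lambda>x. \<integral>y. f y \<partial>N x) (\<integral>y. f y \<partial>(M \<bind> N))"
  proof (rule has_bochner_integral_cong_AE[THEN iffD1, rotated -1])
    show "AE x in M. (\<integral>y. max 0 (f y) \<partial>N x) - (\<integral>y. max 0 (- f y) \<partial>N x) = (\<integral>y. f y \<partial>N x)"
      using ae by eventually_elim (subst (3) f_eq, simp)
  qed (auto intro!: borel_measurable_diff measurable_compose[OF N integral_measurable_subprob_algebra]
      borel_measurable_max)
qed

section \<open>Measures and kernels are determined by their integrals of \<open>C_0\<close>
  functions\<close>

context cost_space
begin

text \<open>One sequence serves all measures simultaneously. This uniformity makes the mass of an
  open set a measurable function of the parameter of a kernel.\<close>

lemma open_measure_limit: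
  assumes "open (U :: 'a set)"
  obtains \<phi> where "\<And>n. \<phi> n \<in> C_0"
    "\<And>\<mu>. \<mu> \<in> borel_probs \<Longrightarrow> (\<lambda>n. \<integral>x. \<phi> n x \<partial>\<mu>) \<longlonglongrightarrow> measure \<mu> U"
proof -
  obtain \<phi> :: "nat \<Rightarrow> 'a \<Rightarrow> real" where \<phi>: "\<And>n. \<phi> n \<in> C_0" "\<And>n x. 0 \<le> \<phi> n x" "\<And>n x. \<phi> n x \<le> 1"
    "\<And>x. incseq (\<lambda>n. \<phi> n x)" "\<And>x. (\<lambda>n. \<phi> n x) \<longlonglongrightarrow> indicator U x"
    by (rule open_indicator_approx[OF assms]) (rule that)
  show ?thesis
  proof (rule that[of \<phi>])
    fix \<mu> :: "'a measure" assume \<mu>: "\<mu> \<in> borel_probs"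
    interpret prob_space \<mu> by (rule borel_probsD[OF \<mu>])
    have [measurable]: "U \<in> sets \<mu>" using assms borel_probsD[OF \<mu>] by simp
    have [measurable]: "\<phi> n \<in> borel_measurable \<mu>" for n
      unfolding borel_probs_measurable[OF \<mu>] by (intro C_b_measurable C_0_C_b \<phi>)
    have "(\<lambda>n. \<integral>x. \<phi> n x \<partial>\<mu>) \<longlonglongrightarrow> (\<integral>x. indicator U x \<partial>\<mu>)"
      by (rule integral_dominated_convergence[where w = "\<lambda>_. 1"])
        (use \<phi> in \<open>auto simp: abs_of_nonneg\<close>)
    then show "(\<lambda>n. \<integral>x. \<phi> n x \<partial>\<mu>) \<longlonglongrightarrow> measure \<mu> U" by simp
  qed (rule \<phi>)
qed

lemma sets_borel_open: "sets (borel :: 'a measure) = sigma_sets UNIV {S. open S}"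
  by (simp add: borel_def)

text \<open>Integrals of \<open>C_0\<close> functions recover the mass of every open set, and open
  sets are an intersection-stable generator.\<close>

lemma borel_probs_eqI:
  fixes \<mu> \<nu> :: "'a measure"
  assumes "\<mu> \<in> borel_probs" "\<nu> \<in> borel_probs"
    and eq: "\<And>\<phi>. \<phi> \<in> C_0 \<Longrightarrow> (\<integral>x. \<phi> x \<partial>\<mu>) = (\<integral>x. \<phi> x \<partial>\<nu>)"
  shows "\<mu> = \<nu>"
proof (rule measure_eqI_generator_eq[where E = "{S. open S}" and \<Omega> = UNIV and A = "\<lambda>_. UNIV"])
  interpret M: prob_space \<mu> by (rule borel_probsD[OF assms(1)])
  interpret N: prob_space \<nu> by (rule borel_probsD[OF assms(2)])
  show "Int_stable {S :: 'a set. open S}" by (auto simp: Int_stable_def)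
  show "emeasure \<mu> X = emeasure \<nu> X" if "X \<in> {S. open S}" for X
  proof -
    have "open X" using that by simp
    then obtain \<phi> where \<phi>: "\<And>n. \<phi> n \<in> C_0"
      "\<And>\<mu>. \<mu> \<in> borel_probs \<Longrightarrow> (\<lambda>n. \<integral>x. \<phi> n x \<partial>\<mu>) \<longlonglongrightarrow> measure \<mu> X"
      by (rule open_measure_limit) (rule that)
    have "(\<lambda>n. \<integral>x. \<phi> n x \<partial>\<mu>) \<longlonglongrightarrow> measure \<nu> X"
      using \<phi>(2)[OF assms(2)] by (simp add: eq[OF \<phi>(1)])
    then have "measure \<mu> X = measure \<nu> X" using \<phi>(2)[OF assms(1)] LIMSEQ_unique by blast
    then show ?thesis by (simp add: M.emeasure_eq_measure N.emeasure_eq_measure)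
  qed
  show "sets \<mu> = sigma_sets UNIV {S. open S}" "sets \<nu> = sigma_sets UNIV {S. open S}"
    using assms by (auto simp: borel_probsD sets_borel_open)
  show "emeasure \<mu> UNIV \<noteq> \<infinity>" by simp
qed auto

text \<open>The mass of an open set is a pointwise limit of integrals of \<open>C_0\<close>
  functions, so measurability need only be tested on \<open>C_0\<close>.\<close>

lemma measurable_kernelI:
  assumes "\<And>a. a \<in> space M \<Longrightarrow> (N a :: 'a measure) \<in> borel_probs"
    and meas: "\<And>\<phi>. \<phi> \<in> C_0 \<Longrightarrow> (\<lambda>a. \<integral>x. \<phi> x \<partial>N a) \<in> borel_measurable M"
  shows "N \<in> M \<rightarrow>\<^sub>M subprob_algebra borel"
proof (rule measurable_subprob_algebra_generated[OF sets_borel_open])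
  show "Int_stable {S :: 'a set. open S}" by (auto simp: Int_stable_def)
  show "subprob_space (N a)" if "a \<in> space M" for a
    using borel_probsD(1)[OF assms(1)[OF that]] by (rule prob_space_imp_subprob_space)
  show "sets (N a) = sets borel" if "a \<in> space M" for a
    using borel_probsD(2)[OF assms(1)[OF that]] .
  have em: "emeasure (N a) X = ennreal (measure (N a) X)" if "a \<in> space M" for a X
  proof -
    interpret prob_space "N a" by (rule borel_probsD[OF assms(1)[OF that]])
    show ?thesis by (rule emeasure_eq_measure)
  qed
  show *: "(\<lambda>a. emeasure (N a) X) \<in> borel_measurable M" if "X \<in> {S. open S}" for X
  proof -
    have "open X" using that by simp
    then obtain \<phi> where \<phi>: "\<And>n. \<phi> n \<in> C_0"
      "\<And>\<mu>. \<mu> \<in> borel_probs \<Longrightarrow> (\<lambda>n. \<integral>x. \<phi> n x \<partial>\<mu>) \<longlonglongrightarrow> measure \<mu> X"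
      by (rule open_measure_limit) (rule that)
    have "(\<lambda>a. measure (N a) X) \<in> borel_measurable M"
      by (rule borel_measurable_LIMSEQ_real[of _ "\<lambda>n a. \<integral>x. \<phi> n x \<partial>N a"]) (use assms(1) \<phi> meas in auto)
    then have "(\<lambda>a. ennreal (measure (N a) X)) \<in> borel_measurable M" by measurable
    then show ?thesis by (subst measurable_cong[OF em])
  qed
  from *[of UNIV] show "(\<lambda>a. emeasure (N a) UNIV) \<in> borel_measurable M" by simp
qed auto

end

section \<open>Probability semigroups\<close>

locale cost_semigroup = cost_space c K for c :: "'a::topological_space \<Rightarrow> 'a \<Rightarrow> real" and K +
  fixes \<kappa> :: "'a kernels"
  assumes semigroup: "prob_semigroup \<kappa>"
begin

lemma kernel_borel_probs: "t \<ge> 0 \<Longrightarrow> \<kappa> t x \<in> borel_probs"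
  and kernel_op_continuous: "t \<ge> 0 \<Longrightarrow> \<phi> \<in> C_b \<Longrightarrow> continuous_on UNIV (kernel_op \<kappa> t \<phi>)"
  and kernel_op_C_0: "t \<ge> 0 \<Longrightarrow> \<phi> \<in> C_0 \<Longrightarrow> kernel_op \<kappa> t \<phi> \<in> C_0"
  and kernel_op_0: "\<phi> \<in> C_0 \<Longrightarrow> kernel_op \<kappa> 0 \<phi> = \<phi>"
  and kernel_op_semigroup: "s \<ge> 0 \<Longrightarrow> t \<ge> 0 \<Longrightarrow> \<phi> \<in> C_0 \<Longrightarrow>
      kernel_op \<kappa> (t + s) \<phi> = kernel_op \<kappa> t (kernel_op \<kappa> s \<phi>)"
  and kernel_op_uniform_limit: "\<phi> \<in> C_0 \<Longrightarrow> uniform_limit UNIV (\<lambda>t. kernel_op \<kappa> t \<phi>) \<phi> (at_right 0)"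
  using semigroup by (auto simp: prob_semigroup_def)

lemma kernel_op_bound:
  assumes "t \<ge> 0" "\<phi> \<in> C_b" "\<And>x. \<bar>\<phi> x\<bar> \<le> M"
  shows "\<bar>kernel_op \<kappa> t \<phi> x\<bar> \<le> M"
  unfolding kernel_op_def using assms by (intro C_b_integral_bound kernel_borel_probs)

lemma kernel_op_diff:
  assumes "t \<ge> 0" "\<phi> \<in> C_b" "\<psi> \<in> C_b"
  shows "kernel_op \<kappa> t (\<lambda>x. \<phi> x - \<psi> x) x = kernel_op \<kappa> t \<phi> x - kernel_op \<kappa> t \<psi> x"
  unfolding kernel_op_def using assms
  by (intro Bochner_Integration.integral_diff C_b_integrable kernel_borel_probs)

text \<open>For \<open>s \<le> t\<close> the difference of the two operators is the operator at time
  \<open>s\<close> applied to a function of sup norm at most \<open>\<epsilon>\<close>. The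
  contraction property thus transports continuity at time 0 to all times, uniformly in
  \<open>x\<close>.\<close>

lemma kernel_op_equicontinuous:
  assumes "\<phi> \<in> C_0" "\<epsilon> > 0"
  obtains \<delta> where "\<delta> > 0"
    "\<And>s t x. 0 \<le> s \<Longrightarrow> 0 \<le> t \<Longrightarrow> \<bar>s - t\<bar> < \<delta> \<Longrightarrow> \<bar>kernel_op \<kappa> t \<phi> x - kernel_op \<kappa> s \<phi> x\<bar> \<le> \<epsilon>"
proof -
  have "\<forall>\<^sub>F t in at_right 0. \<forall>x\<in>UNIV. dist (kernel_op \<kappa> t \<phi> x) (\<phi> x) < \<epsilon>"
    using kernel_op_uniform_limit[OF assms(1)] assms(2) by (rule uniform_limitD)
  then obtain \<delta> where \<delta>: "\<delta> > 0" "\<And>t x. 0 < t \<Longrightarrow> t < \<delta> \<Longrightarrow> \<bar>kernel_op \<kappa> t \<phi> x - \<phi> x\<bar> < \<epsilon>"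
    unfolding eventually_at_right_field by (auto simp: dist_real_def)
  have near: "\<bar>kernel_op \<kappa> h \<phi> x - \<phi> x\<bar> \<le> \<epsilon>" if "0 \<le> h" "h < \<delta>" for h x
    using \<delta>(2)[of h x] that kernel_op_0[OF assms(1)] assms(2) by (cases "h = 0") (auto intro: less_imp_le)
  have le: "\<bar>kernel_op \<kappa> t \<phi> x - kernel_op \<kappa> s \<phi> x\<bar> \<le> \<epsilon>" if st: "0 \<le> s" "s \<le> t" "t - s < \<delta>" for s t x
  proof -
    have C: "kernel_op \<kappa> (t - s) \<phi> \<in> C_b" "\<phi> \<in> C_b"
      by (intro C_0_C_b kernel_op_C_0; use st assms(1) in simp)+
    have "kernel_op \<kappa> t \<phi> x - kernel_op \<kappa> s \<phi> x = kernel_op \<kappa> s (\<lambda>x. kernel_op \<kappa> (t - s) \<phi> x - \<phi> x) x"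
      using kernel_op_semigroup[of "t - s" s \<phi>] st assms(1) by (simp add: kernel_op_diff[OF st(1) C])
    also have "\<bar>\<dots>\<bar> \<le> \<epsilon>"
      using st near by (intro kernel_op_bound C_b_diff C) auto
    finally show ?thesis .
  qed
  show ?thesis
  proof (rule that[OF \<delta>(1)])
    fix s t x assume "0 \<le> s" "0 \<le> t" "\<bar>s - t\<bar> < \<delta>"
    then show "\<bar>kernel_op \<kappa> t \<phi> x - kernel_op \<kappa> s \<phi> x\<bar> \<le> \<epsilon>"
      using le[of s t x] le[of t s x] by (cases "s \<le> t") (auto simp: abs_minus_commute)
  qed
qed

lemma measurable_kernel: "t \<ge> 0 \<Longrightarrow> \<kappa> t \<in> borel \<rightarrow>\<^sub>M subprob_algebra borel"
  using kernel_op_continuous[OF _ C_0_C_b]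
  by (intro measurable_kernelI kernel_borel_probs borel_measurable_continuous_onI)
    (auto simp: kernel_op_def[abs_def])

text \<open>Continuity in \<open>x\<close> at each time and uniform continuity in time give joint
  measurability. The \<open>max 0\<close> makes the kernel total, as nothing is known at negative
  times.\<close>

lemma measurable_kernel_joint:
  "(\<lambda>p. \<kappa> (max 0 (fst p)) (snd p)) \<in> borel \<Otimes>\<^sub>M borel \<rightarrow>\<^sub>M subprob_algebra borel"
proof (intro measurable_kernelI kernel_borel_probs)
  fix \<phi> :: "'a \<Rightarrow> real" assume \<phi>: "\<phi> \<in> C_0"
  \<comment> \<open>Rounding down to the grid of mesh \<open>1 / Suc n\<close>: the time then takes
    countably many values, and at each of them the function is continuous in
    \<open>x\<close>.\<close>
  define r where "r n s = max 0 (of_int \<lfloor>real (Suc n) * s\<rfloor> / real (Suc n))" for n s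
  have r: "\<bar>r n s - max 0 s\<bar> \<le> 1 / real (Suc n)" for n s
  proof -
    have le: "\<bar>of_int \<lfloor>real (Suc n) * s\<rfloor> - real (Suc n) * s\<bar> \<le> 1" by linarith
    have "\<bar>of_int \<lfloor>real (Suc n) * s\<rfloor> / real (Suc n) - s\<bar> \<le> 1 / real (Suc n)"
      (is "\<bar>?l\<bar> \<le> _")
    proof -
      have "?l = (of_int \<lfloor>real (Suc n) * s\<rfloor> - real (Suc n) * s) / real (Suc n)"
        by (simp add: field_simps del: of_nat_Suc)
      with le show ?thesis by (simp add: divide_right_mono del: of_nat_Suc)
    qed
    then show ?thesis unfolding r_def by linarith
  qed
  have "(\<lambda>p. kernel_op \<kappa> (max 0 (fst p)) \<phi> (snd p)) \<in> borel_measurable (borel \<Otimes>\<^sub>M borel)"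
  proof (rule borel_measurable_LIMSEQ_real[of _ "\<lambda>n p. kernel_op \<kappa> (r n (fst p)) \<phi> (snd p)"])
    fix p :: "real \<times> 'a"
    show "(\<lambda>n. kernel_op \<kappa> (r n (fst p)) \<phi> (snd p)) \<longlonglongrightarrow> kernel_op \<kappa> (max 0 (fst p)) \<phi> (snd p)"
    proof (rule LIMSEQ_I)
      fix e :: real assume "e > 0"
      then have "e / 2 > 0" by simp
      with \<phi> obtain \<delta> where \<delta>: "\<delta> > 0" "\<And>s t x. 0 \<le> s \<Longrightarrow> 0 \<le> t \<Longrightarrow> \<bar>s - t\<bar> < \<delta> \<Longrightarrow>
          \<bar>kernel_op \<kappa> t \<phi> x - kernel_op \<kappa> s \<phi> x\<bar> \<le> e / 2"
        by (rule kernel_op_equicontinuous) (rule that)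
      obtain N where N: "1 / real (Suc N) < \<delta>"
        using reals_Archimedean[OF \<delta>(1)] by (auto simp: inverse_eq_divide)
      show "\<exists>no. \<forall>n\<ge>no. norm (kernel_op \<kappa> (r n (fst p)) \<phi> (snd p) - kernel_op \<kappa> (max 0 (fst p)) \<phi> (snd p)) < e"
      proof (intro exI allI impI)
        fix n assume "n \<ge> N"
        then have "1 / real (Suc n) \<le> 1 / real (Suc N)" by (intro divide_left_mono) auto
        then have "\<bar>max 0 (fst p) - r n (fst p)\<bar> < \<delta>" using r[of n "fst p"] N by linarith
        then have "\<bar>kernel_op \<kappa> (r n (fst p)) \<phi> (snd p) - kernel_op \<kappa> (max 0 (fst p)) \<phi> (snd p)\<bar> \<le> e / 2"
          by (intro \<delta>(2)) (auto simp: r_def)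
        then show "norm (kernel_op \<kappa> (r n (fst p)) \<phi> (snd p) - kernel_op \<kappa> (max 0 (fst p)) \<phi> (snd p)) < e"
          using \<open>e > 0\<close> by simp
      qed
    qed
  next
    fix n
    have "(\<lambda>p :: real \<times> 'a. kernel_op \<kappa> (max 0 (of_int i / real (Suc n))) \<phi> (snd p)) \<in> borel_measurable (borel \<Otimes>\<^sub>M borel)"
      for i :: int
      by (rule measurable_compose[OF measurable_snd], rule borel_measurable_continuous_onI,
          rule kernel_op_continuous) (auto intro: C_0_C_b \<phi>)
    moreover have "(\<lambda>p :: real \<times> 'a. \<lfloor>real (Suc n) * fst p\<rfloor>) \<in> (borel \<Otimes>\<^sub>M borel) \<rightarrow>\<^sub>M count_space UNIV"
      by measurable
    ultimately show "(\<lambda>p. kernel_op \<kappa> (r n (fst p)) \<phi> (snd p)) \<in> borel_measurable (borel \<Otimes>\<^sub>M borel)"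
      unfolding r_def by (rule measurable_compose_countable)
  qed
  then show "(\<lambda>p. \<integral>x. \<phi> x \<partial>\<kappa> (max 0 (fst p)) (snd p)) \<in> borel_measurable (borel \<Otimes>\<^sub>M borel)"
    by (simp add: kernel_op_def)
qed simp

lemma kernel_0: "\<kappa> 0 x = return borel x"
proof (rule borel_probs_eqI[OF kernel_borel_probs])
  show "return borel x \<in> borel_probs" by (simp add: borel_probs_def prob_space_return)
  show "(\<integral>y. \<phi> y \<partial>\<kappa> 0 x) = (\<integral>y. \<phi> y \<partial>return borel x)" if "\<phi> \<in> C_0" for \<phi>
    using kernel_op_0[OF that] C_b_measurable[OF C_0_C_b[OF that]]
    by (simp add: integral_return kernel_op_def[abs_def] fun_eq_iff)
qed simp

lemma bind_kernel_borel_probs: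
  assumes "\<mu> \<in> borel_probs" "t \<ge> 0"
  shows "\<mu> \<bind> \<kappa> t \<in> borel_probs"
proof -
  interpret prob_space \<mu> by (rule borel_probsD[OF assms(1)])
  have m: "\<kappa> t \<in> \<mu> \<rightarrow>\<^sub>M subprob_algebra borel"
    using measurable_kernel[OF assms(2)] borel_probsD(2)[OF assms(1)] by (simp cong: measurable_cong_sets)
  have "prob_space (\<mu> \<bind> \<kappa> t)"
    by (rule prob_space_bind[OF _ m]) (use kernel_borel_probs[OF assms(2)] in \<open>auto dest: borel_probsD\<close>)
  moreover have "sets (\<mu> \<bind> \<kappa> t) = sets borel"
    by (rule sets_bind_measurable[OF m]) (simp add: borel_probsD[OF assms(1)])
  ultimately show ?thesis by (simp add: borel_probs_def)
qed

lemma integral_bind_kernel: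
  assumes "\<mu> \<in> borel_probs" "t \<ge> 0" "f \<in> borel_measurable borel" "integrable (\<mu> \<bind> \<kappa> t) f"
  shows "integrable \<mu> (kernel_op \<kappa> t f)" "(\<integral>y. f y \<partial>(\<mu> \<bind> \<kappa> t)) = (\<integral>x. kernel_op \<kappa> t f x \<partial>\<mu>)"
proof -
  have m: "\<kappa> t \<in> \<mu> \<rightarrow>\<^sub>M subprob_algebra borel"
    using measurable_kernel[OF assms(2)] borel_probsD(2)[OF assms(1)] by (simp cong: measurable_cong_sets)
  from has_bochner_integral_bind(1)[OF m assms(3,4)]
  show "integrable \<mu> (kernel_op \<kappa> t f)" "(\<integral>y. f y \<partial>(\<mu> \<bind> \<kappa> t)) = (\<integral>x. kernel_op \<kappa> t f x \<partial>\<mu>)"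
    by (auto simp: has_bochner_integral_iff kernel_op_def[abs_def])
qed

end

text \<open>Resolves the definite description in \<open>exp_measure\<close>: the mixture of the
  kernels has the required integrals, and \<open>C_0\<close> functions already determine the
  measure.\<close>

lemma (in cost_space) exp_measure_eq_bind:
  fixes A :: "'a operator"
  assumes "is_generator A" "\<mu> \<in> borel_probs" "t \<ge> 0"
  shows "exp_measure \<mu> t A = \<mu> \<bind> semigroup_of A t"
proof -
  have "prob_semigroup (semigroup_of A) \<and> generator (semigroup_of A) = A"
    using assms(1) unfolding is_generator_def semigroup_of_def by (rule someI_ex)
  then interpret cost_semigroup c K "semigroup_of A"
    by unfold_locales auto
  have eq: "(\<integral>x. \<phi> x \<partial>(\<mu> \<bind> semigroup_of A t)) = (\<integral>x. exp_op t A \<phi> x \<partial>\<mu>)" if "\<phi> \<in> C_b" for \<phi>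
    unfolding exp_op_def using that assms
    by (intro integral_bind_kernel C_b_measurable C_b_integrable bind_kernel_borel_probs)
  show ?thesis
    unfolding exp_measure_def
  proof (rule the_equality)
    show "\<mu> \<bind> semigroup_of A t \<in> borel_probs \<and>
        (\<forall>\<phi>\<in>C_b. (\<integral>x. \<phi> x \<partial>(\<mu> \<bind> semigroup_of A t)) = (\<integral>x. exp_op t A \<phi> x \<partial>\<mu>))"
      using eq bind_kernel_borel_probs assms by auto
    show "\<nu> = \<mu> \<bind> semigroup_of A t"
      if "\<nu> \<in> borel_probs \<and> (\<forall>\<phi>\<in>C_b. (\<integral>x. \<phi> x \<partial>\<nu>) = (\<integral>x. exp_op t A \<phi> x \<partial>\<mu>))" for \<nu>
      using that assms by (intro borel_probs_eqI) (auto simp: eq C_0_C_b intro: bind_kernel_borel_probs)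
  qed
qed

section \<open>Transport costs\<close>

lemma C_bc_continuous: "f \<in> C_bc c \<Longrightarrow> continuous_on UNIV f"
  by (simp add: C_bc_def)

lemma C_bc_measurable: "f \<in> C_bc c \<Longrightarrow> f \<in> borel_measurable borel"
  by (rule borel_measurable_continuous_onI) (rule C_bc_continuous)

lemma P_c_borel_probs: "\<mu> \<in> P_c c \<Longrightarrow> \<mu> \<in> borel_probs"
  by (simp add: P_c_def)

lemma couplingsD:
  assumes "\<gamma> \<in> couplings \<mu> \<nu>"
  shows "prob_space \<gamma>" "sets \<gamma> = sets (borel \<Otimes>\<^sub>M borel)" "distr \<gamma> borel fst = \<mu>" "distr \<gamma> borel snd = \<nu>"
    "fst \<in> \<gamma> \<rightarrow>\<^sub>M borel" "snd \<in> \<gamma> \<rightarrow>\<^sub>M borel"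
proof -
  show *: "prob_space \<gamma>" "sets \<gamma> = sets (borel \<Otimes>\<^sub>M borel)" "distr \<gamma> borel fst = \<mu>" "distr \<gamma> borel snd = \<nu>"
    using assms by (auto simp: couplings_def)
  show "fst \<in> \<gamma> \<rightarrow>\<^sub>M borel" "snd \<in> \<gamma> \<rightarrow>\<^sub>M borel"
    by (simp_all add: measurable_cong_sets[OF *(2) refl])
qed

lemma couplings_integral:
  fixes f :: "'a::topological_space \<Rightarrow> real"
  assumes "\<gamma> \<in> couplings \<mu> \<nu>" "f \<in> borel_measurable borel"
  shows "integrable \<gamma> (\<lambda>p. f (fst p)) \<longleftrightarrow> integrable \<mu> f" "(\<integral>p. f (fst p) \<partial>\<gamma>) = (\<integral>x. f x \<partial>\<mu>)"
    "integrable \<gamma> (\<lambda>p. f (snd p)) \<longleftrightarrow> integrable \<nu> f" "(\<integral>p. f (snd p) \<partial>\<gamma>) = (\<integral>x. f x \<partial>\<nu>)"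
  using integrable_distr_eq[OF couplingsD(5)[OF assms(1)] assms(2)]
    integrable_distr_eq[OF couplingsD(6)[OF assms(1)] assms(2)]
    integral_distr[OF couplingsD(5)[OF assms(1)] assms(2)]
    integral_distr[OF couplingsD(6)[OF assms(1)] assms(2)]
  by (simp_all add: couplingsD[OF assms(1)])

text \<open>Provides at least one coupling, so that transport costs on \<open>P_c c\<close> are
  finite. The second marginal is computed as the first marginal of the swapped product.\<close>

lemma pair_couplings:
  assumes "\<mu> \<in> borel_probs" "\<nu> \<in> borel_probs"
  shows "\<mu> \<Otimes>\<^sub>M \<nu> \<in> couplings \<mu> \<nu>"
proof -
  interpret M: prob_space \<mu> by (rule borel_probsD[OF assms(1)])
  interpret N: prob_space \<nu> by (rule borel_probsD[OF assms(2)])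
  interpret P: pair_prob_space \<mu> \<nu> ..
  note s = borel_probsD(2)[OF assms(1)] borel_probsD(2)[OF assms(2)]
  have 1: "distr (\<mu> \<Otimes>\<^sub>M \<nu>) borel fst = distr (\<mu> \<Otimes>\<^sub>M \<nu>) \<mu> fst"
    "distr (\<mu> \<Otimes>\<^sub>M \<nu>) borel snd = distr (\<mu> \<Otimes>\<^sub>M \<nu>) \<nu> snd"
    using s by (auto intro!: distr_cong)
  have 2: "distr (\<mu> \<Otimes>\<^sub>M \<nu>) \<nu> snd = \<nu>"
  proof -
    interpret Q: pair_prob_space \<nu> \<mu> ..
    have "distr (\<mu> \<Otimes>\<^sub>M \<nu>) \<nu> snd = distr (distr (\<nu> \<Otimes>\<^sub>M \<mu>) (\<mu> \<Otimes>\<^sub>M \<nu>) (\<lambda>(x, y). (y, x))) \<nu> snd"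
      using P.distr_pair_swap by simp
    also have "\<dots> = distr (\<nu> \<Otimes>\<^sub>M \<mu>) \<nu> fst"
      by (subst distr_distr) (auto intro!: distr_cong measurable_pair_swap')
    finally show ?thesis by (simp add: M.distr_pair_fst)
  qed
  show ?thesis
    using P.prob_space_axioms s by (simp add: couplings_def 1 2 N.distr_pair_fst cong: sets_pair_measure_cong)
qed

section \<open>Elementary bounds on transport costs and integrals of functions in
  \<open>C_bc c\<close>\<close>

context cost_space
begin

abbreviation cost_pair :: "'a \<times> 'a \<Rightarrow> real" where
  "cost_pair p \<equiv> c (fst p) (snd p)"

lemma coupling_measurable_cost:
  assumes "\<gamma> \<in> couplings \<mu> \<nu>"
  shows "cost_pair \<in> borel_measurable \<gamma>"
  using measurable_cost_pair by (simp add: measurable_cong_sets[OF couplingsD(2)[OF assms] refl])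

lemma transport_cost_le:
  assumes "\<gamma> \<in> couplings \<mu> \<nu>" "integrable \<gamma> cost_pair"
  shows "transport_cost c \<mu> \<nu> \<le> ereal (\<integral>p. cost_pair p \<partial>\<gamma>)"
proof -
  have "(INF \<gamma>\<in>couplings \<mu> \<nu>. \<integral>\<^sup>+p. ennreal (cost_pair p) \<partial>\<gamma>) \<le> (\<integral>\<^sup>+p. ennreal (cost_pair p) \<partial>\<gamma>)"
    by (rule INF_lower[OF assms(1)])
  also have "\<dots> = ennreal (\<integral>p. cost_pair p \<partial>\<gamma>)"
    using assms(2) by (intro nn_integral_eq_integral) auto
  finally have "transport_cost c \<mu> \<nu> \<le> enn2ereal (ennreal (\<integral>p. cost_pair p \<partial>\<gamma>))"
    by (simp add: transport_cost_def less_eq_ennreal.rep_eq)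
  then show ?thesis by (subst (asm) enn2ereal_ennreal) (auto intro: Bochner_Integration.integral_nonneg)
qed

text \<open>Couplings of infinite cost satisfy any lower bound, so only integrable ones need be
  tested. A negative \<open>L\<close> is treated apart, because its image in \<open>ennreal\<close>
  is 0.\<close>

lemma transport_cost_ge:
  assumes "\<And>\<gamma>. \<gamma> \<in> couplings \<mu> \<nu> \<Longrightarrow> integrable \<gamma> cost_pair \<Longrightarrow> L \<le> (\<integral>p. cost_pair p \<partial>\<gamma>)"
  shows "ereal L \<le> transport_cost c \<mu> \<nu>"
proof -
  have "ennreal L \<le> (INF \<gamma>\<in>couplings \<mu> \<nu>. \<integral>\<^sup>+p. ennreal (cost_pair p) \<partial>\<gamma>)"
  proof (rule INF_greatest)
    fix \<gamma> assume \<gamma>: "\<gamma> \<in> couplings \<mu> \<nu>"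
    show "ennreal L \<le> (\<integral>\<^sup>+p. ennreal (cost_pair p) \<partial>\<gamma>)"
    proof (cases "(\<integral>\<^sup>+p. ennreal (cost_pair p) \<partial>\<gamma>) < \<infinity>")
      case True
      then have i: "integrable \<gamma> cost_pair"
        by (intro integrableI_bounded coupling_measurable_cost[OF \<gamma>]) simp
      then have "(\<integral>\<^sup>+p. ennreal (cost_pair p) \<partial>\<gamma>) = ennreal (\<integral>p. cost_pair p \<partial>\<gamma>)"
        by (intro nn_integral_eq_integral) auto
      then show ?thesis using assms[OF \<gamma> i] by (simp add: ennreal_leI)
    qed (simp add: not_less top_unique)
  qed
  then have le: "enn2ereal (ennreal L) \<le> transport_cost c \<mu> \<nu>"
    by (simp add: transport_cost_def less_eq_ennreal.rep_eq)
  show ?thesis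
  proof (cases "L \<ge> 0")
    case True
    then show ?thesis using le by simp
  next
    case False
    then have "ereal L \<le> 0" by simp
    also have "0 \<le> transport_cost c \<mu> \<nu>" by (simp add: transport_cost_def)
    finally show ?thesis .
  qed
qed

lemma transport_cost_nonneg: "0 \<le> transport_cost c \<mu> \<nu>"
  by (simp add: transport_cost_def)

lemma transport_cost_lessD:
  assumes "transport_cost c \<mu> \<nu> < ereal r"
  obtains \<gamma> where "\<gamma> \<in> couplings \<mu> \<nu>" "integrable \<gamma> cost_pair" "(\<integral>p. cost_pair p \<partial>\<gamma>) < r"
proof -
  have "\<not> (\<forall>\<gamma>. \<gamma> \<in> couplings \<mu> \<nu> \<longrightarrow> integrable \<gamma> cost_pair \<longrightarrow> r \<le> (\<integral>p. cost_pair p \<partial>\<gamma>))"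
    using transport_cost_ge[of \<mu> \<nu> r] assms by (auto simp: not_le[symmetric])
  then show ?thesis using that by (auto simp: not_le)
qed

lemma P_c_integrable:
  assumes "\<mu> \<in> P_c c"
  shows "integrable \<mu> (c z)"
proof -
  note \<mu> = P_c_borel_probs[OF assms]
  interpret prob_space \<mu> by (rule borel_probsD[OF \<mu>])
  have m [measurable]: "c w \<in> borel_measurable \<mu>" for w
    by (simp add: borel_probs_measurable[OF \<mu>])
  obtain w where "(\<integral>\<^sup>+x. ennreal (c w x) \<partial>\<mu>) < \<infinity>"
    using assms by (auto simp: P_c_def)
  then have "integrable \<mu> (c w)" by (intro integrableI_bounded m) simp
  then have "integrable \<mu> (\<lambda>x. K * (c z w + c w x))" by (intro integrable_mult_right integrable_add) auto
  then show ?thesis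
    by (rule Bochner_Integration.integrable_bound) (use K_ge_1 quasi_triangle in \<open>auto simp: abs_of_nonneg\<close>)
qed

lemma integrable_cost_coupling:
  assumes "\<mu> \<in> P_c c" "\<nu> \<in> P_c c" "\<gamma> \<in> couplings \<mu> \<nu>"
  shows "integrable \<gamma> cost_pair"
proof -
  \<comment> \<open>An arbitrary base point; the claim does not depend on it.\<close>
  fix z
  have "integrable \<gamma> (\<lambda>p. K * (c z (fst p) + c z (snd p)))"
    using assms by (intro integrable_mult_right integrable_add)
      (simp_all add: couplings_integral[OF assms(3)] P_c_integrable)
  then show ?thesis
  proof (rule Bochner_Integration.integrable_bound)
    show "AE p in \<gamma>. norm (cost_pair p) \<le> norm (K * (c z (fst p) + c z (snd p)))"
      using K_ge_1 quasi_triangle[of _ _ z] by (auto simp: abs_of_nonneg cost_sym[of _ z])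
  qed (rule coupling_measurable_cost[OF assms(3)])
qed

lemma transport_cost_finite:
  assumes "\<mu> \<in> P_c c" "\<nu> \<in> P_c c"
  obtains r where "r \<ge> 0" "transport_cost c \<mu> \<nu> = ereal r"
proof -
  have \<gamma>: "\<mu> \<Otimes>\<^sub>M \<nu> \<in> couplings \<mu> \<nu>" using assms by (intro pair_couplings P_c_borel_probs)
  have "transport_cost c \<mu> \<nu> \<noteq> \<infinity>"
    using transport_cost_le[OF \<gamma> integrable_cost_coupling[OF assms \<gamma>]] by auto
  then show ?thesis
    using transport_cost_nonneg[of \<mu> \<nu>] that by (cases "transport_cost c \<mu> \<nu>") auto
qed

lemma dirac_borel_probs: "dirac (x :: 'a) \<in> borel_probs"
  by (simp add: borel_probs_def prob_space_return)

lemma dirac_P_c: "dirac (x :: 'a) \<in> P_c c"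
  unfolding P_c_def using dirac_borel_probs by (auto simp: nn_integral_return)

text \<open>Every coupling of two point masses is concentrated on the single pair
  \<open>(x, y)\<close>.\<close>

lemma transport_cost_dirac: "transport_cost c (dirac x) (dirac y) = ereal (c x y)"
proof -
  have eq: "(\<integral>p. cost_pair p \<partial>\<gamma>) = c x y" if \<gamma>: "\<gamma> \<in> couplings (dirac x) (dirac y)" for \<gamma>
  proof -
    interpret prob_space \<gamma> by (rule couplingsD[OF \<gamma>])
    have "AE z in distr \<gamma> borel fst. z = x" "AE z in distr \<gamma> borel snd. z = y"
      unfolding couplingsD(3,4)[OF \<gamma>] by (subst AE_return; simp add: pred_def)+
    moreover have "{w \<in> space borel. w = v} \<in> sets borel" for v :: 'a
      using singleton_sets[of v] by simp
    note AE_distr_iff[OF couplingsD(5)[OF \<gamma>] this] AE_distr_iff[OF couplingsD(6)[OF \<gamma>] this]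
    ultimately have "AE p in \<gamma>. fst p = x" "AE p in \<gamma>. snd p = y" by simp_all
    then have "AE p in \<gamma>. cost_pair p = c x y" by eventually_elim simp
    then have "(\<integral>p. cost_pair p \<partial>\<gamma>) = (\<integral>p. c x y \<partial>\<gamma>)"
      by (intro integral_cong_AE coupling_measurable_cost[OF \<gamma>]) auto
    then show ?thesis by (simp add: prob_space)
  qed
  have \<gamma>: "dirac x \<Otimes>\<^sub>M dirac y \<in> couplings (dirac x) (dirac y)" by (intro pair_couplings dirac_borel_probs)
  show ?thesis
    using transport_cost_le[OF \<gamma> integrable_cost_coupling[OF dirac_P_c dirac_P_c \<gamma>]]
    by (intro antisym transport_cost_ge) (simp_all add: eq[OF \<gamma>] eq)
qed

text \<open>Moves the base point of the growth bound to any \<open>z\<close>, at the price of larger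
  constants.\<close>

lemma C_bc_bound:
  assumes "f \<in> C_bc c"
  obtains M0 M1 where "M0 \<ge> 0" "M1 \<ge> 0" "\<And>x. \<bar>f x\<bar> \<le> M0 + M1 * c z x"
proof -
  obtain w M0 M1 where M: "M0 \<ge> 0" "M1 \<ge> 0" "\<And>x. \<bar>f x\<bar> \<le> M0 + M1 * c w x"
    using assms by (auto simp: C_bc_def)
  show ?thesis
  proof (rule that)
    show "M0 + M1 * K * c w z \<ge> 0" "M1 * K \<ge> 0" using M K_ge_1 by auto
    fix x
    have "\<bar>f x\<bar> \<le> M0 + M1 * c w x" by (rule M)
    also have "\<dots> \<le> M0 + M1 * (K * (c w z + c z x))"
      using M by (intro add_left_mono mult_left_mono quasi_triangle)
    finally show "\<bar>f x\<bar> \<le> M0 + M1 * K * c w z + M1 * K * c z x" by (simp add: algebra_simps)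
  qed
qed

lemma C_bc_integrable:
  assumes "\<mu> \<in> P_c c" "f \<in> C_bc c"
  shows "integrable \<mu> f"
proof -
  fix z
  interpret prob_space \<mu> by (rule borel_probsD[OF P_c_borel_probs[OF assms(1)]])
  obtain M0 M1 where M: "M0 \<ge> 0" "M1 \<ge> 0" "\<And>x. \<bar>f x\<bar> \<le> M0 + M1 * c z x"
    using assms(2) by (rule C_bc_bound) (rule that)
  have "integrable \<mu> (\<lambda>x. M0 + M1 * c z x)"
    using P_c_integrable[OF assms(1)] by simp
  then show ?thesis
    by (rule Bochner_Integration.integrable_bound)
      (use M C_bc_measurable[OF assms(2)] borel_probs_measurable[OF P_c_borel_probs[OF assms(1)]]
        in \<open>auto simp: abs_of_nonneg\<close>)
qed

text \<open>A function in \<open>C_bc c\<close> need not be Lipschitz for \<open>c\<close>. Still,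
  its increment over a coupled pair is bounded by a small constant, an integrable function of
  \<open>y\<close> on a set that shrinks away, and a large multiple of \<open>c x y\<close>. Since
  \<open>\<mu>\<close> is fixed, the second term depends on \<open>\<mu>\<close> alone, and a small
  transport cost handles the third.\<close>

lemma transport_cost_controls_integral:
  assumes \<mu>: "\<mu> \<in> P_c c" and f: "f \<in> C_bc c" and "\<eta> > 0"
  obtains \<rho> where "\<rho> > 0"
    "\<And>\<nu>. \<nu> \<in> P_c c \<Longrightarrow> transport_cost c \<nu> \<mu> < ereal \<rho> \<Longrightarrow> \<bar>(\<integral>x. f x \<partial>\<nu>) - (\<integral>x. f x \<partial>\<mu>)\<bar> \<le> \<eta>"
proof -
  fix z
  interpret prob_space \<mu> by (rule borel_probsD[OF P_c_borel_probs[OF \<mu>]])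
  note meas_eq = borel_probs_measurable[OF P_c_borel_probs[OF \<mu>]]
  have sets_eq: "sets \<mu> = sets borel" using borel_probsD[OF P_c_borel_probs[OF \<mu>]] by simp
  obtain M0 M1 where M: "M0 \<ge> 0" "M1 \<ge> 0" "\<And>x. \<bar>f x\<bar> \<le> M0 + M1 * c z x"
    using f by (rule C_bc_bound) (rule that)
  \<comment> \<open>Bounding the growth of \<open>f\<close> at \<open>x\<close> through
    \<open>y\<close> costs \<open>M1 * K * c x y\<close>; everything else in the two bounds depends
    on \<open>y\<close> and is collected here.\<close>
  define G where "G y = 2 * M0 + M1 * (K + 1) * c z y" for y
  have G_nn: "0 \<le> G y" for y using M K_ge_1 by (simp add: G_def)
  have G_int: "integrable \<mu> G" unfolding G_def using P_c_integrable[OF \<mu>] by simp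
  have G_meas [measurable]: "G \<in> borel_measurable borel" unfolding G_def by measurable
  have fG: "\<bar>f x - f y\<bar> \<le> G y + M1 * K * c x y" for x y
  proof -
    have "\<bar>f x\<bar> \<le> M0 + M1 * (K * (c z y + c y x))"
      using M(3)[of x] mult_left_mono[OF quasi_triangle[of z x y] M(2)] by simp
    then show ?thesis using M(3)[of y] by (simp add: G_def algebra_simps cost_sym[of y x])
  qed
  \<comment> \<open>Off the small set \<open>E n\<close>, points closer than \<open>1 / Suc n\<close> have close values of \<open>f\<close> and
    \<open>G y \<le> n\<close> can be absorbed into the cost of the remaining pairs.\<close>
  define E1 where "E1 n = (\<Union>x. {y. c x y < 1 / real (Suc n)} \<inter> {y. \<eta> / 4 < \<bar>f x - f y\<bar>})" for n :: nat
  define E where "E n = E1 n \<union> {y. real n < G y}" for n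
  have "open (E1 n)" for n
    unfolding E1_def
    by (intro open_UN ballI open_Int open_cball open_Collect_less continuous_intros C_bc_continuous[OF f])
  then have E_sets [measurable]: "E n \<in> sets borel" for n
    unfolding E_def by measurable
  have "(\<lambda>n. \<integral>y. G y * indicator (E n) y \<partial>\<mu>) \<longlonglongrightarrow> (\<integral>y. 0 \<partial>\<mu>)"
  proof (rule integral_dominated_convergence[where w = G])
    show "AE y in \<mu>. (\<lambda>n. G y * indicator (E n) y) \<longlonglongrightarrow> 0"
    proof (rule AE_I2)
      fix y
      have "(f \<longlongrightarrow> f y) (nhds y)"
        using C_bc_continuous[OF f] by (simp add: continuous_on_def tendsto_at_iff_tendsto_nhds)
      then have "\<forall>\<^sub>F x in nhds y. dist (f x) (f y) < \<eta> / 4" using \<open>\<eta> > 0\<close> by (intro tendstoD) auto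
      then obtain r where r: "r > 0" "\<And>x. c y x < r \<Longrightarrow> \<bar>f x - f y\<bar> < \<eta> / 4"
        by (auto simp: eventually_nhds_cball dist_real_def)
      obtain N where N: "1 / real (Suc N) < r"
        using reals_Archimedean[OF r(1)] by (auto simp: inverse_eq_divide)
      obtain N' :: nat where N': "G y \<le> real N'" using real_arch_simple by blast
      have "y \<notin> E n" if n: "n \<ge> max N N'" for n
      proof -
        have "1 / real (Suc n) \<le> 1 / real (Suc N)" using n by (intro divide_left_mono) auto
        then have "c y x < 1 / real (Suc n) \<Longrightarrow> \<bar>f x - f y\<bar> < \<eta> / 4" for x using N r(2)[of x] by simp
        then have "y \<notin> E1 n" by (force simp: E1_def cost_sym[of _ y])
        then show ?thesis using N' n by (auto simp: E_def)
      qed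
      then have "\<forall>\<^sub>F n in sequentially. G y * indicator (E n) y = 0"
        by (auto simp: eventually_sequentially intro!: exI[of _ "max N N'"])
      then show "(\<lambda>n. G y * indicator (E n) y) \<longlonglongrightarrow> 0" by (rule tendsto_eventually)
    qed
    show "AE y in \<mu>. norm (G y * indicator (E n) y) \<le> G y" for n
      using G_nn by (auto simp: indicator_def)
  qed (use G_int in \<open>auto simp: meas_eq\<close>)
  then have "\<forall>\<^sub>F n in sequentially. (\<integral>y. G y * indicator (E n) y \<partial>\<mu>) < \<eta> / 4"
    by (rule order_tendstoD) (use \<open>\<eta> > 0\<close> in simp)
  then obtain n where n: "(\<integral>y. G y * indicator (E n) y \<partial>\<mu>) < \<eta> / 4"
    by (auto simp: eventually_sequentially)
  \<comment> \<open>Off \<open>E n\<close>, a pair with \<open>c x y \<ge> 1 / Suc n\<close>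
    satisfies \<open>G y \<le> real n \<le> real n * real (Suc n) * c x y\<close>, which explains
    the second summand.\<close>
  define C where "C = M1 * K + real n * real (Suc n)"
  have C: "C \<ge> 0" using M K_ge_1 by (simp add: C_def)
  have pointwise: "\<bar>f x - f y\<bar> \<le> \<eta> / 4 + G y * indicator (E n) y + C * c x y" for x y
  proof (cases "y \<in> E n")
    case True
    have "M1 * K * c x y \<le> C * c x y" by (intro mult_right_mono) (auto simp: C_def)
    then show ?thesis using fG[of x y] True \<open>\<eta> > 0\<close> by simp
  next
    case False
    show ?thesis
    proof (cases "c x y < 1 / real (Suc n)")
      case True
      then have "\<bar>f x - f y\<bar> \<le> \<eta> / 4" using False by (force simp: E_def E1_def)
      moreover have "0 \<le> C * c x y" using C by simp
      ultimately show ?thesis using False by simp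
    next
      case far: False
      have "G y \<le> real n * 1" using False by (simp add: E_def)
      also have "\<dots> \<le> real n * (real (Suc n) * c x y)"
        using far by (intro mult_left_mono) (simp_all add: field_simps del: of_nat_Suc)
      finally have "G y + M1 * K * c x y \<le> C * c x y" by (simp add: C_def algebra_simps)
      then show ?thesis using fG[of x y] False \<open>\<eta> > 0\<close> by simp
    qed
  qed
  show ?thesis
  \<comment> \<open>Makes \<open>C\<close> times the transport cost at most
    \<open>\<eta> / 4\<close>; the \<open>+ 1\<close> covers the case \<open>C = 0\<close>.\<close>
  proof (rule that[of "\<eta> / (4 * (C + 1))"])
    show "\<eta> / (4 * (C + 1)) > 0" using C \<open>\<eta> > 0\<close> by simp
    fix \<nu> assume \<nu>: "\<nu> \<in> P_c c" and tc: "transport_cost c \<nu> \<mu> < ereal (\<eta> / (4 * (C + 1)))"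
    obtain \<gamma> where \<gamma>: "\<gamma> \<in> couplings \<nu> \<mu>" "integrable \<gamma> cost_pair"
      "(\<integral>p. cost_pair p \<partial>\<gamma>) < \<eta> / (4 * (C + 1))"
      using tc by (rule transport_cost_lessD) (rule that)
    interpret G: prob_space \<gamma> by (rule couplingsD[OF \<gamma>(1)])
    note ci = couplings_integral[OF \<gamma>(1)]
    have GE: "integrable \<mu> (\<lambda>y. G y * indicator (E n) y)"
      using G_int by (intro integrable_mult_indicator[of "E n" \<mu> G, simplified mult.commute[of "indicator _ _"] real_scaleR_def])
        (simp_all add: sets_eq)
    have i1: "integrable \<gamma> (\<lambda>p. f (fst p))" "integrable \<gamma> (\<lambda>p. f (snd p))"
      using C_bc_integrable[OF \<nu> f] C_bc_integrable[OF \<mu> f] C_bc_measurable[OF f] by (simp_all add: ci)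
    have i2: "integrable \<gamma> (\<lambda>p. G (snd p) * indicator (E n) (snd p))"
      using ci(3)[of "\<lambda>y. G y * indicator (E n) y"] GE by simp
    have "(\<integral>x. f x \<partial>\<nu>) - (\<integral>x. f x \<partial>\<mu>) = (\<integral>p. f (fst p) - f (snd p) \<partial>\<gamma>)"
      using i1 C_bc_measurable[OF f] by (simp add: ci)
    also have "\<bar>\<dots>\<bar> \<le> (\<integral>p. \<bar>f (fst p) - f (snd p)\<bar> \<partial>\<gamma>)" by (rule integral_abs_bound)
    also have "\<dots> \<le> (\<integral>p. \<eta> / 4 + G (snd p) * indicator (E n) (snd p) + C * cost_pair p \<partial>\<gamma>)"
      using i1 i2 \<gamma>(2) pointwise by (intro integral_mono) auto
    also have "\<dots> = \<eta> / 4 + (\<integral>y. G y * indicator (E n) y \<partial>\<mu>) + C * (\<integral>p. cost_pair p \<partial>\<gamma>)"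
      using i2 \<gamma>(2) ci(4)[of "\<lambda>y. G y * indicator (E n) y"] by (simp add: G.prob_space)
    also have "C * (\<integral>p. cost_pair p \<partial>\<gamma>) \<le> C * (\<eta> / (4 * (C + 1)))"
      using C \<gamma>(3) by (intro mult_left_mono) auto
    also have "\<dots> \<le> \<eta> / 4" using C \<open>\<eta> > 0\<close> by (simp add: field_simps)
    finally show "\<bar>(\<integral>x. f x \<partial>\<nu>) - (\<integral>x. f x \<partial>\<mu>)\<bar> \<le> \<eta>" using n \<open>\<eta> > 0\<close> by simp
  qed
qed

lemma tendsto_integral_C_bc:
  assumes \<mu>: "\<mu> \<in> P_c c" and \<nu>: "\<forall>\<^sub>F s in F. \<nu> s \<in> P_c c"
    and lim: "((\<lambda>s. transport_cost c (\<nu> s) \<mu>) \<longlongrightarrow> 0) F" and f: "f \<in> C_bc c"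
  shows "((\<lambda>s. \<integral>x. f x \<partial>\<nu> s) \<longlongrightarrow> (\<integral>x. f x \<partial>\<mu>)) F"
proof (rule tendstoI)
  fix e :: real assume "e > 0"
  then have "e / 2 > 0" by simp
  with \<mu> f obtain \<rho> where \<rho>: "\<rho> > 0" "\<And>\<nu>. \<nu> \<in> P_c c \<Longrightarrow> transport_cost c \<nu> \<mu> < ereal \<rho> \<Longrightarrow>
      \<bar>(\<integral>x. f x \<partial>\<nu>) - (\<integral>x. f x \<partial>\<mu>)\<bar> \<le> e / 2"
    by (rule transport_cost_controls_integral) (rule that)
  have "\<forall>\<^sub>F s in F. transport_cost c (\<nu> s) \<mu> < ereal \<rho>"
    using lim by (rule order_tendstoD) (use \<rho> in simp)
  with \<nu> show "\<forall>\<^sub>F s in F. dist (\<integral>x. f x \<partial>\<nu> s) (\<integral>x. f x \<partial>\<mu>) < e"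
  proof eventually_elim
    case (elim s)
    then show ?case using \<rho>(2)[of "\<nu> s"] \<open>e > 0\<close> by (simp add: dist_real_def)
  qed
qed

end

section \<open>Kantorovich duality\<close>

lemma has_bochner_integral_pair_mult:
  fixes f g :: "_ \<Rightarrow> real"
  assumes "prob_space M" "prob_space N" and f: "integrable M f" and g: "integrable N g"
  shows "has_bochner_integral (M \<Otimes>\<^sub>M N) (\<lambda>p. f (fst p) * g (snd p)) ((\<integral>x. f x \<partial>M) * (\<integral>y. g y \<partial>N))"
proof -
  interpret M: prob_space M by fact
  interpret N: prob_space N by fact
  interpret P: pair_prob_space M N ..
  note [measurable] = borel_measurable_integrable[OF f] borel_measurable_integrable[OF g]
  have int: "integrable (M \<Otimes>\<^sub>M N) (\<lambda>p. f (fst p) * g (snd p))"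
    by (rule P.Fubini_integrable) (auto simp: abs_mult f g)
  have "(\<integral>p. f (fst p) * g (snd p) \<partial>(M \<Otimes>\<^sub>M N)) = (\<integral>x. f x \<partial>M) * (\<integral>y. g y \<partial>N)"
    using P.integral_fst'[OF int] by (simp add: mult.commute)
  with int show ?thesis by (simp add: has_bochner_integral_iff)
qed

text \<open>The weights \<open>\<pi> i j / (p i * q j)\<close> may have a zero denominator and are
  then 0. This is harmless: a nonnegative row or column with zero sum vanishes, and \<open>F\<close>
  vanishes wherever \<open>p\<close> does.\<close>

lemma weighted_marginal_sum:
  fixes \<pi> :: "nat \<Rightarrow> nat \<Rightarrow> real"
  assumes \<pi>: "\<And>i j. 0 \<le> \<pi> i j" and p: "\<And>i. i < m \<Longrightarrow> (\<Sum>j<m. \<pi> i j) = p i"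
    and q: "\<And>j. j < m \<Longrightarrow> (\<Sum>i<m. \<pi> i j) = q j" and F: "\<And>i. p i = 0 \<Longrightarrow> F i = 0"
  shows "(\<Sum>i<m. \<Sum>j<m. \<pi> i j / (p i * q j) * (F i * q j)) = (\<Sum>i<m. F i)"
proof (rule sum.cong)
  fix i assume i: "i \<in> {..<m}"
  show "(\<Sum>j<m. \<pi> i j / (p i * q j) * (F i * q j)) = F i"
  proof (cases "p i = 0")
    case False
    have "\<pi> i j / (p i * q j) * (F i * q j) = \<pi> i j * (F i / p i)" if "j < m" for j
    proof (cases "q j = 0")
      case True
      then have "\<pi> i j = 0" using q[OF that] i \<pi> by (simp add: sum_nonneg_eq_0_iff)
      then show ?thesis by simp
    qed simp
    then have "(\<Sum>j<m. \<pi> i j / (p i * q j) * (F i * q j)) = (\<Sum>j<m. \<pi> i j * (F i / p i))"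
      by (intro sum.cong) auto
    also have "\<dots> = F i" using p[of i] i False by (simp flip: sum_distrib_right sum_divide_distrib)
    finally show ?thesis .
  qed (simp add: F)
qed simp

lemma C_b_mult: "\<phi> \<in> C_b \<Longrightarrow> \<psi> \<in> C_b \<Longrightarrow> (\<lambda>x. \<phi> x * \<psi> x) \<in> C_b"
proof -
  assume *: "\<phi> \<in> C_b" "\<psi> \<in> C_b"
  then obtain M N where b: "\<And>x. \<bar>\<phi> x\<bar> \<le> M" "\<And>x. \<bar>\<psi> x\<bar> \<le> N" by (auto simp: C_b_def)
  have "\<bar>\<phi> x * \<psi> x\<bar> \<le> M * N" for x
    unfolding abs_mult using b[of x] by (intro mult_mono) auto
  then show ?thesis using * by (intro C_bI) (auto intro!: continuous_intros simp: C_b_continuous)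
qed

lemma C_b_const: "(\<lambda>x. a) \<in> C_b"
  by (rule C_bI[of _ "\<bar>a\<bar>"]) auto

lemma C_b_add: "\<phi> \<in> C_b \<Longrightarrow> \<psi> \<in> C_b \<Longrightarrow> (\<lambda>x. \<phi> x + \<psi> x) \<in> C_b"
  using C_b_diff[of \<phi> "\<lambda>x. (- 1) * \<psi> x"] C_b_mult[OF C_b_const[of "- 1"], of \<psi>] by simp

lemma C_b_sum: "finite I \<Longrightarrow> (\<And>i. i \<in> I \<Longrightarrow> \<phi> i \<in> C_b) \<Longrightarrow> (\<lambda>x. \<Sum>i\<in>I. \<phi> i x) \<in> C_b"
  by (induction I rule: finite_induct) (auto intro: C_b_add C_b_const)

section \<open>Passing from discrete plans to couplings, and from potentials on cells to continuous
  potentials\<close>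

context cost_space
begin

text \<open>Given a partition of unity \<open>\<theta>\<close> and a discrete coupling \<open>\<pi>\<close> of the weights, spread the mass
  \<open>\<pi> i j\<close> over \<open>\<theta> i \<otimes> \<theta> j\<close>.\<close>

lemma transport_cost_le_partition:
  fixes \<theta> :: "nat \<Rightarrow> 'a \<Rightarrow> real"
  assumes \<mu>: "\<mu> \<in> P_c c" and \<nu>: "\<nu> \<in> P_c c"
    and \<theta>: "\<And>i. \<theta> i \<in> C_b" "\<And>i x. 0 \<le> \<theta> i x" "\<And>x. (\<Sum>i<m. \<theta> i x) = 1"
    and \<pi>: "\<And>i j. 0 \<le> \<pi> i j" "\<And>i. i < m \<Longrightarrow> (\<Sum>j<m. \<pi> i j) = (\<integral>x. \<theta> i x \<partial>\<mu>)"
      "\<And>j. j < m \<Longrightarrow> (\<Sum>i<m. \<pi> i j) = (\<integral>x. \<theta> j x \<partial>\<nu>)"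
    and g: "g \<in> borel_measurable borel" "integrable \<mu> g" "integrable \<nu> g"
    and bound: "\<And>i j x y. i < m \<Longrightarrow> j < m \<Longrightarrow>
      \<theta> i x * \<theta> j y * c x y \<le> \<theta> i x * \<theta> j y * (a i j + g x + g y)"
  shows "transport_cost c \<mu> \<nu> \<le> ereal ((\<Sum>i<m. \<Sum>j<m. \<pi> i j * a i j) + (\<integral>x. g x \<partial>\<mu>) + (\<integral>y. g y \<partial>\<nu>))"
proof -
  note \<mu>b = P_c_borel_probs[OF \<mu>] and \<nu>b = P_c_borel_probs[OF \<nu>]
  interpret M: prob_space \<mu> by (rule borel_probsD[OF \<mu>b])
  interpret N: prob_space \<nu> by (rule borel_probsD[OF \<nu>b])
  interpret P: pair_prob_space \<mu> \<nu> ..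
  let ?P = "\<mu> \<Otimes>\<^sub>M \<nu>"
  have sets_P: "sets ?P = sets (borel \<Otimes>\<^sub>M borel)"
    using borel_probsD[OF \<mu>b] borel_probsD[OF \<nu>b] by (intro sets_pair_measure_cong) auto
  define p where "p i = (\<integral>x. \<theta> i x \<partial>\<mu>)" for i
  define q where "q i = (\<integral>x. \<theta> i x \<partial>\<nu>)" for i
  define w where "w i j = \<pi> i j / (p i * q j)" for i j
  \<comment> \<open>The density, relative to the product measure, of the coupling that puts mass
    \<open>\<pi> i j\<close> on the product of the normalized restrictions of \<open>\<mu>\<close>
    by \<open>\<theta> i\<close> and of \<open>\<nu>\<close> by \<open>\<theta> j\<close>.\<close>
  define h where "h z = (\<Sum>i<m. \<Sum>j<m. w i j * (\<theta> i (fst z) * \<theta> j (snd z)))" for z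
  have pq: "0 \<le> p i" "0 \<le> q i" for i
    by (auto simp: p_def q_def \<theta> intro: Bochner_Integration.integral_nonneg)
  then have w: "0 \<le> w i j" for i j by (simp add: w_def \<pi>)
  then have h_nn: "0 \<le> h z" for z
    unfolding h_def by (intro sum_nonneg mult_nonneg_nonneg \<theta>) auto
  \<comment> \<open>Cells of zero weight contribute nothing to any bounded integral, which is the
    hypothesis on \<open>F\<close> in \<open>weighted_marginal_sum\<close>.\<close>
  have zero: "(\<integral>x. \<phi> x * \<theta> i x \<partial>\<xi>) = 0"
    if \<xi>: "\<xi> \<in> borel_probs" "(\<integral>x. \<theta> i x \<partial>\<xi>) = 0" "\<phi> \<in> C_b" for \<phi> i \<xi>
  proof -
    obtain B where B: "\<And>x. \<bar>\<phi> x\<bar> \<le> B" using \<xi>(3) by (auto simp: C_b_def)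
    have "\<bar>\<integral>x. \<phi> x * \<theta> i x \<partial>\<xi>\<bar> \<le> (\<integral>x. \<bar>\<phi> x * \<theta> i x\<bar> \<partial>\<xi>)" by (rule integral_abs_bound)
    also have "\<dots> \<le> (\<integral>x. B * \<theta> i x \<partial>\<xi>)"
      using B \<theta> by (intro integral_mono integrable_abs integrable_mult_right C_b_integrable that C_b_mult)
        (auto simp: abs_mult intro!: mult_right_mono)
    also have "\<dots> = 0" using that(2) by simp
    finally show ?thesis by simp
  qed
  have sum_int: "(\<Sum>i<m. \<integral>x. \<phi> x * \<theta> i x \<partial>\<xi>) = (\<integral>x. \<phi> x \<partial>\<xi>)"
    if "\<xi> \<in> borel_probs" "\<phi> \<in> C_b" for \<phi> \<xi>
  proof -
    have "(\<Sum>i<m. \<integral>x. \<phi> x * \<theta> i x \<partial>\<xi>) = (\<integral>x. (\<Sum>i<m. \<phi> x * \<theta> i x) \<partial>\<xi>)"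
      by (intro Bochner_Integration.integral_sum[symmetric] C_b_integrable C_b_mult that \<theta>)
    then show ?thesis by (simp add: \<theta> flip: sum_distrib_left)
  qed
  have fst_int: "has_bochner_integral ?P (\<lambda>z. h z * \<phi> (fst z)) (\<integral>x. \<phi> x \<partial>\<mu>)" if \<phi>: "\<phi> \<in> C_b" for \<phi>
  proof -
    have "has_bochner_integral ?P (\<lambda>z. \<Sum>i<m. \<Sum>j<m. w i j * ((\<phi> (fst z) * \<theta> i (fst z)) * \<theta> j (snd z)))
        (\<Sum>i<m. \<Sum>j<m. w i j * ((\<integral>x. \<phi> x * \<theta> i x \<partial>\<mu>) * q j))"
      unfolding q_def
      by (intro has_bochner_integral_sum has_bochner_integral_mult_right
          has_bochner_integral_pair_mult[where f = "\<lambda>x. \<phi> x * \<theta> _ x"]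
          borel_probsD(1)[OF \<mu>b] borel_probsD(1)[OF \<nu>b] C_b_integrable[OF \<mu>b] C_b_integrable[OF \<nu>b]
          C_b_mult \<phi> \<theta>)
    moreover have "(\<Sum>i<m. \<Sum>j<m. w i j * ((\<integral>x. \<phi> x * \<theta> i x \<partial>\<mu>) * q j)) = (\<integral>x. \<phi> x \<partial>\<mu>)"
      unfolding w_def sum_int[OF \<mu>b \<phi>, symmetric]
      by (rule weighted_marginal_sum[where F = "\<lambda>i. \<integral>x. \<phi> x * \<theta> i x \<partial>\<mu>" and p = p and q = q and \<pi> = \<pi>]) (auto simp: \<pi> p_def q_def zero[OF \<mu>b _ \<phi>])
    moreover have "(\<lambda>z. \<Sum>i<m. \<Sum>j<m. w i j * ((\<phi> (fst z) * \<theta> i (fst z)) * \<theta> j (snd z)))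
        = (\<lambda>z. h z * \<phi> (fst z))"
      by (simp add: h_def sum_distrib_left mult_ac)
    ultimately show ?thesis by simp
  qed
  have snd_int: "has_bochner_integral ?P (\<lambda>z. h z * \<phi> (snd z)) (\<integral>x. \<phi> x \<partial>\<nu>)" if \<phi>: "\<phi> \<in> C_b" for \<phi>
  proof -
    have "has_bochner_integral ?P (\<lambda>z. \<Sum>i<m. \<Sum>j<m. w i j * (\<theta> i (fst z) * (\<phi> (snd z) * \<theta> j (snd z))))
        (\<Sum>i<m. \<Sum>j<m. w i j * (p i * (\<integral>x. \<phi> x * \<theta> j x \<partial>\<nu>)))"
      unfolding p_def
      by (intro has_bochner_integral_sum has_bochner_integral_mult_right
          has_bochner_integral_pair_mult[where g = "\<lambda>x. \<phi> x * \<theta> _ x"]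
          borel_probsD(1)[OF \<mu>b] borel_probsD(1)[OF \<nu>b] C_b_integrable[OF \<mu>b] C_b_integrable[OF \<nu>b]
          C_b_mult \<phi> \<theta>)
    moreover have "(\<Sum>i<m. \<Sum>j<m. w i j * (p i * (\<integral>x. \<phi> x * \<theta> j x \<partial>\<nu>)))
        = (\<Sum>j<m. \<Sum>i<m. \<pi> i j / (q j * p i) * ((\<integral>x. \<phi> x * \<theta> j x \<partial>\<nu>) * p i))"
      by (subst sum.swap) (simp add: w_def mult_ac)
    moreover have "\<dots> = (\<integral>x. \<phi> x \<partial>\<nu>)"
      unfolding sum_int[OF \<nu>b \<phi>, symmetric]
      by (rule weighted_marginal_sum[where F = "\<lambda>i. \<integral>x. \<phi> x * \<theta> i x \<partial>\<nu>" and p = q and q = p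
          and \<pi> = "\<lambda>j i. \<pi> i j"]) (auto simp: \<pi> p_def q_def zero[OF \<nu>b _ \<phi>])
    moreover have "(\<lambda>z. \<Sum>i<m. \<Sum>j<m. w i j * (\<theta> i (fst z) * (\<phi> (snd z) * \<theta> j (snd z))))
        = (\<lambda>z. h z * \<phi> (snd z))"
      by (simp add: h_def sum_distrib_left mult_ac)
    ultimately show ?thesis by simp
  qed
  have h1: "has_bochner_integral ?P h 1"
    using fst_int[OF C_b_const[of 1]] by (simp add: M.prob_space)
  then have h_meas [measurable]: "h \<in> borel_measurable ?P"
    by (auto simp: has_bochner_integral_iff)
  define \<gamma> where "\<gamma> = density ?P h"
  have sets_\<gamma>: "sets \<gamma> = sets (borel \<Otimes>\<^sub>M borel)" by (simp add: \<gamma>_def sets_P)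
  have "emeasure \<gamma> (space \<gamma>) = (\<integral>\<^sup>+z. ennreal (h z) \<partial>?P)"
    by (simp add: \<gamma>_def emeasure_density cong: nn_integral_cong)
  also have "\<dots> = ennreal 1"
    using h1 h_nn by (subst nn_integral_eq_integral) (auto simp: has_bochner_integral_iff)
  finally have prob: "prob_space \<gamma>" by (intro prob_spaceI) simp
  have fm: "fst \<in> \<gamma> \<rightarrow>\<^sub>M borel" "snd \<in> \<gamma> \<rightarrow>\<^sub>M borel"
    by (simp_all add: measurable_cong_sets[OF sets_\<gamma> refl])
  have probs: "distr \<gamma> borel fst \<in> borel_probs" "distr \<gamma> borel snd \<in> borel_probs"
    using prob_space.prob_space_distr[OF prob fm(1)] prob_space.prob_space_distr[OF prob fm(2)]
    by (auto simp: borel_probs_def)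
  have cm: "fst \<in> ?P \<rightarrow>\<^sub>M borel" "snd \<in> ?P \<rightarrow>\<^sub>M borel"
    by (simp_all add: measurable_cong_sets[OF sets_P refl])
  have "distr \<gamma> borel fst = \<mu>"
  proof (rule borel_probs_eqI[OF probs(1) \<mu>b])
    fix \<phi> :: "'a \<Rightarrow> real" assume "\<phi> \<in> C_0"
    then have \<phi>: "\<phi> \<in> C_b" by (rule C_0_C_b)
    have "(\<integral>x. \<phi> x \<partial>distr \<gamma> borel fst) = (\<integral>z. \<phi> (fst z) \<partial>\<gamma>)"
      by (intro integral_distr fm C_b_measurable \<phi>)
    also have "\<dots> = (\<integral>z. h z * \<phi> (fst z) \<partial>?P)"
      unfolding \<gamma>_def using h_nn measurable_compose[OF cm(1) C_b_measurable[OF \<phi>]]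
      by (subst integral_density) auto
    finally show "(\<integral>x. \<phi> x \<partial>distr \<gamma> borel fst) = (\<integral>x. \<phi> x \<partial>\<mu>)"
      using fst_int[OF \<phi>] by (simp add: has_bochner_integral_iff)
  qed
  moreover have "distr \<gamma> borel snd = \<nu>"
  proof (rule borel_probs_eqI[OF probs(2) \<nu>b])
    fix \<phi> :: "'a \<Rightarrow> real" assume "\<phi> \<in> C_0"
    then have \<phi>: "\<phi> \<in> C_b" by (rule C_0_C_b)
    have "(\<integral>x. \<phi> x \<partial>distr \<gamma> borel snd) = (\<integral>z. \<phi> (snd z) \<partial>\<gamma>)"
      by (intro integral_distr fm C_b_measurable \<phi>)
    also have "\<dots> = (\<integral>z. h z * \<phi> (snd z) \<partial>?P)"
      unfolding \<gamma>_def using h_nn measurable_compose[OF cm(2) C_b_measurable[OF \<phi>]]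
      by (subst integral_density) auto
    finally show "(\<integral>x. \<phi> x \<partial>distr \<gamma> borel snd) = (\<integral>x. \<phi> x \<partial>\<nu>)"
      using snd_int[OF \<phi>] by (simp add: has_bochner_integral_iff)
  qed
  ultimately have \<gamma>: "\<gamma> \<in> couplings \<mu> \<nu>" by (simp add: couplings_def prob sets_\<gamma>)
  have int_cost: "integrable \<gamma> cost_pair" by (rule integrable_cost_coupling[OF \<mu> \<nu> \<gamma>])
  have gf: "integrable \<gamma> (\<lambda>z. g (fst z) + g (snd z))"
    "(\<integral>z. g (fst z) + g (snd z) \<partial>\<gamma>) = (\<integral>x. g x \<partial>\<mu>) + (\<integral>y. g y \<partial>\<nu>)"
    using couplings_integral[OF \<gamma> g(1)] g by auto
  have cost_m: "cost_pair \<in> borel_measurable ?P"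
    using measurable_cost_pair by (simp add: measurable_cong_sets[OF sets_P refl])
  have g_m: "(\<lambda>z. g (fst z) + g (snd z)) \<in> borel_measurable ?P"
    using measurable_compose[OF cm(1) g(1)] measurable_compose[OF cm(2) g(1)] by simp
  have dens: "integrable ?P (\<lambda>z. h z * F z)" "(\<integral>z. F z \<partial>\<gamma>) = (\<integral>z. h z * F z \<partial>?P)"
    if "F \<in> borel_measurable ?P" "integrable \<gamma> F" for F :: "'a \<times> 'a \<Rightarrow> real"
    using that h_nn integrable_density[of F ?P h] integral_density[of F ?P h] by (auto simp: \<gamma>_def)
  have step: "has_bochner_integral ?P (\<lambda>z. \<Sum>i<m. \<Sum>j<m. w i j * (\<theta> i (fst z) * \<theta> j (snd z)) * a i j)
      (\<Sum>i<m. \<Sum>j<m. w i j * (p i * q j) * a i j)"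
    unfolding p_def q_def
    by (intro has_bochner_integral_sum has_bochner_integral_mult_right has_bochner_integral_mult_left
        has_bochner_integral_pair_mult borel_probsD(1)[OF \<mu>b] borel_probsD(1)[OF \<nu>b]
        C_b_integrable[OF \<mu>b] C_b_integrable[OF \<nu>b] \<theta>)
  \<comment> \<open>In a cell of weight zero both sides vanish, since the corresponding row or
    column of \<open>\<pi>\<close> is zero.\<close>
  have wpq: "w i j * (p i * q j) = \<pi> i j" if "i < m" "j < m" for i j
  proof (cases "p i * q j = 0")
    case True
    then have "(\<Sum>j<m. \<pi> i j) = 0 \<or> (\<Sum>i<m. \<pi> i j) = 0"
      using \<pi>(2,3) that by (auto simp: p_def q_def)
    then have "\<pi> i j = 0" using \<pi>(1) that by (auto simp: sum_nonneg_eq_0_iff)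
    then show ?thesis by (simp add: w_def)
  qed (simp add: w_def)
  have "transport_cost c \<mu> \<nu> \<le> ereal (\<integral>z. cost_pair z \<partial>\<gamma>)"
    by (rule transport_cost_le[OF \<gamma> int_cost])
  also have "(\<integral>z. cost_pair z \<partial>\<gamma>) = (\<integral>z. h z * cost_pair z \<partial>?P)"
    by (rule dens(2)[OF cost_m int_cost])
  also have "\<dots> \<le> (\<integral>z. (\<Sum>i<m. \<Sum>j<m. w i j * (\<theta> i (fst z) * \<theta> j (snd z)) * a i j)
      + h z * (g (fst z) + g (snd z)) \<partial>?P)"
  proof (rule integral_mono[OF dens(1)[OF cost_m int_cost]])
    show "integrable ?P (\<lambda>z. (\<Sum>i<m. \<Sum>j<m. w i j * (\<theta> i (fst z) * \<theta> j (snd z)) * a i j)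
      + h z * (g (fst z) + g (snd z)))"
      using step dens(1)[OF g_m gf(1)] by (intro Bochner_Integration.integrable_add) (auto simp: has_bochner_integral_iff)
    fix z
    have "w i j * (\<theta> i (fst z) * \<theta> j (snd z)) * cost_pair z \<le> w i j * (\<theta> i (fst z) * \<theta> j (snd z)) * a i j
        + w i j * (\<theta> i (fst z) * \<theta> j (snd z)) * (g (fst z) + g (snd z))" if "i < m" "j < m" for i j
      using mult_left_mono[OF bound[OF that, of "fst z" "snd z"] w[of i j]] by (simp add: algebra_simps)
    then have "(\<Sum>i<m. \<Sum>j<m. w i j * (\<theta> i (fst z) * \<theta> j (snd z)) * cost_pair z)
      \<le> (\<Sum>i<m. \<Sum>j<m. w i j * (\<theta> i (fst z) * \<theta> j (snd z)) * a i j
        + w i j * (\<theta> i (fst z) * \<theta> j (snd z)) * (g (fst z) + g (snd z)))"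
      by (intro sum_mono) auto
    then show "h z * cost_pair z \<le> (\<Sum>i<m. \<Sum>j<m. w i j * (\<theta> i (fst z) * \<theta> j (snd z)) * a i j)
      + h z * (g (fst z) + g (snd z))"
      by (simp add: h_def sum_distrib_right sum.distrib del: distrib_left_numeral)
  qed
  also have "\<dots> = (\<Sum>i<m. \<Sum>j<m. w i j * (p i * q j) * a i j) + ((\<integral>x. g x \<partial>\<mu>) + (\<integral>y. g y \<partial>\<nu>))"
    using step dens[OF g_m gf(1)] gf(2)
    by (subst Bochner_Integration.integral_add) (auto simp: has_bochner_integral_iff)
  also have "(\<Sum>i<m. \<Sum>j<m. w i j * (p i * q j) * a i j) = (\<Sum>i<m. \<Sum>j<m. \<pi> i j * a i j)"
    by (intro sum.cong refl) (simp add: wpq)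
  finally show ?thesis by (simp add: add.assoc)
qed

text \<open>Tents around a finite net of \<open>S\<close>, with the leftover mass collected in the
  last function. Two points in the supports of given cells have nearly the cost of the two centres,
  which is the value \<open>D i j\<close>.\<close>

lemma partition_of_unity:
  assumes "compact (S :: 'a set)" "\<epsilon> > 0"
  obtains n :: nat and \<theta> :: "nat \<Rightarrow> 'a \<Rightarrow> real" and D :: "nat \<Rightarrow> nat \<Rightarrow> real"
  where "\<And>i. \<theta> i \<in> C_b" "\<And>i x. 0 \<le> \<theta> i x" "\<And>x. (\<Sum>i<Suc n. \<theta> i x) = 1" "\<And>x. x \<in> S \<Longrightarrow> \<theta> n x = 0"
    "\<And>i j x y. i < n \<Longrightarrow> j < n \<Longrightarrow> \<theta> i x \<noteq> 0 \<Longrightarrow> \<theta> j y \<noteq> 0 \<Longrightarrow> \<bar>c x y - D i j\<bar> < \<epsilon>"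
proof -
  obtain \<delta> where \<delta>: "\<delta> > 0"
    "\<And>x y x' y'. x \<in> S \<Longrightarrow> y \<in> S \<Longrightarrow> c x x' < \<delta> \<Longrightarrow> c y y' < \<delta> \<Longrightarrow> \<bar>c x' y' - c x y\<bar> < \<epsilon>"
    using uniform_continuity_cost[OF assms] by blast
  obtain P where P: "P \<subseteq> S" "finite P" "S \<subseteq> (\<Union>p\<in>P. cball p \<delta>)"
  proof (rule compactE_image[OF assms(1), of S "\<lambda>p. cball p \<delta>"])
    show "S \<subseteq> (\<Union>p\<in>S. cball p \<delta>)" using \<delta>(1) by force
  qed (rule open_cball)
  obtain xs where xs: "set xs = P" using finite_list[OF P(2)] by blast
  define n where "n = length xs"
  define b where "b i x = max 0 (\<delta> - c (xs ! i) x)" for i x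
  define B where "B x = (\<Sum>i<n. b i x)" for x
  have b_nn: "0 \<le> b i x" for i x by (simp add: b_def)
  have B_nn: "0 \<le> B x" for x by (simp add: B_def sum_nonneg b_nn)
  have b_cont: "continuous_on UNIV (b i)" for i
    unfolding b_def by (intro continuous_intros)
  have B_cont: "continuous_on UNIV B" unfolding B_def by (intro continuous_intros b_cont)
  have B_pos: "B x > 0" if x: "x \<in> S" for x
  proof -
    obtain p where p: "p \<in> set xs" "c p x < \<delta>" using P(3) x xs by auto
    from p(1) obtain i where "i < n" "xs ! i = p" unfolding in_set_conv_nth n_def by blast
    with p(2) have "i < n" "c (xs ! i) x < \<delta>" by auto
    then show ?thesis
      unfolding B_def by (intro sum_pos2[of _ i] b_nn) (auto simp: b_def)
  qed
  obtain m where m: "m > 0" "\<And>x. x \<in> S \<Longrightarrow> m \<le> B x"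
  proof (cases "S = {}")
    case True
    then show ?thesis using that[of 1] by auto
  next
    case False
    have "\<exists>x\<in>S. \<forall>y\<in>S. B x \<le> B y"
      by (intro continuous_attains_inf assms(1) False continuous_on_subset[OF B_cont]) simp
    then show ?thesis using B_pos that by blast
  qed
  \<comment> \<open>\<open>m\<close> bounds the total \<open>B\<close> from below on
    \<open>S\<close>. Dividing by \<open>max m (B x)\<close> instead of \<open>B x\<close> keeps the
    quotient continuous where all tents vanish, and on \<open>S\<close> leaves the remainder zero.
    Only the indices below \<open>Suc n\<close> are ever summed.\<close>
  define \<theta> where "\<theta> i x = (if i < n then b i x / max m (B x) else 1 - B x / max m (B x))" for i x
  have pos: "max m (B x) > 0" for x using m(1) by simp
  have ratio: "0 \<le> B x / max m (B x)" "B x / max m (B x) \<le> 1" for x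
    using pos[of x] B_nn[of x] by (auto simp: divide_le_eq)
  have \<theta>_nn: "0 \<le> \<theta> i x" for i x
    using ratio pos[of x] b_nn by (auto simp: \<theta>_def)
  have sum1: "(\<Sum>i<n. \<theta> i x) = B x / max m (B x)" for x
    by (simp add: \<theta>_def B_def sum_divide_distrib)
  have "\<theta> i x \<le> 1" for i x
  proof (cases "i < n")
    case True
    then have "\<theta> i x \<le> (\<Sum>i<n. \<theta> i x)" by (intro member_le_sum \<theta>_nn) auto
    then show ?thesis using sum1[of x] ratio[of x] by linarith
  next
    case False
    then show ?thesis using ratio[of x] by (simp add: \<theta>_def)
  qed
  then have "\<bar>\<theta> i x\<bar> \<le> 1" for i x using \<theta>_nn[of i x] by simp
  moreover have "continuous_on UNIV (\<theta> i)" for i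
  proof (cases "i < n")
    case True
    then have "\<theta> i = (\<lambda>x. b i x / max m (B x))" by (auto simp: \<theta>_def)
    then show ?thesis using pos by (auto intro!: continuous_intros b_cont B_cont simp: less_imp_neq[symmetric])
  next
    case False
    then have "\<theta> i = (\<lambda>x. 1 - B x / max m (B x))" by (auto simp: \<theta>_def)
    then show ?thesis using pos by (auto intro!: continuous_intros b_cont B_cont simp: less_imp_neq[symmetric])
  qed
  ultimately have \<theta>_Cb: "\<theta> i \<in> C_b" for i by (intro C_bI)
  show ?thesis
  proof (rule that[of \<theta> n "\<lambda>i j. c (xs ! i) (xs ! j)"])
    show "(\<Sum>i<Suc n. \<theta> i x) = 1" for x
      using sum1[of x] by (simp add: \<theta>_def[of n])
    show "\<theta> n x = 0" if "x \<in> S" for x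
      using m(2)[OF that] m(1) by (simp add: \<theta>_def max_def)
    fix i j x y assume ij: "i < n" "j < n" and nz: "\<theta> i x \<noteq> 0" "\<theta> j y \<noteq> 0"
    have "c (xs ! i) x < \<delta>" "c (xs ! j) y < \<delta>"
      using nz ij by (auto simp: \<theta>_def b_def max_def split: if_splits)
    moreover have "xs ! i \<in> S" "xs ! j \<in> S"
      using ij P(1) xs by (auto simp: n_def)
    ultimately show "\<bar>c x y - c (xs ! i) (xs ! j)\<bar> < \<epsilon>" by (intro \<delta>(2))
  qed (rule \<theta>_Cb \<theta>_nn)+
qed

lemma tail_integral_tendsto:
  assumes "\<mu> \<in> P_c c"
  shows "(\<lambda>n. \<integral>x. max 0 (c z x - real n) \<partial>\<mu>) \<longlonglongrightarrow> 0"
proof -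
  note m = borel_probs_measurable[OF P_c_borel_probs[OF assms]]
  have "(\<lambda>n. \<integral>x. max 0 (c z x - real n) \<partial>\<mu>) \<longlonglongrightarrow> (\<integral>x. 0 \<partial>\<mu>)"
  proof (rule integral_dominated_convergence[where w = "c z"])
    show "AE x in \<mu>. (\<lambda>n. max 0 (c z x - real n)) \<longlonglongrightarrow> 0"
    proof (rule AE_I2)
      fix x
      obtain N :: nat where "c z x \<le> real N" using real_arch_simple by blast
      then have "\<forall>\<^sub>F n in sequentially. max 0 (c z x - real n) = 0"
        by (auto simp: eventually_sequentially max_def intro!: exI[of _ N])
      then show "(\<lambda>n. max 0 (c z x - real n)) \<longlonglongrightarrow> 0" by (rule tendsto_eventually)
    qed
  qed (use P_c_integrable[OF assms] in \<open>auto simp: m\<close>)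
  then show ?thesis by simp
qed

text \<open>Discretize by a partition of unity that is fine on a compact set carrying almost all of
  both measures. The discrete costs are rounded down, so that discrete potentials lift to admissible
  continuous ones; the resulting loss in the primal bound is a multiple of
  \<open>\<epsilon>\<close>.\<close>

theorem transport_duality:
  assumes \<mu>: "\<mu> \<in> P_c c" and \<nu>: "\<nu> \<in> P_c c"
    and dual: "\<And>\<phi> \<psi>. \<phi> \<in> C_b \<Longrightarrow> \<psi> \<in> C_b \<Longrightarrow> (\<And>x y. \<phi> x + \<psi> y \<le> c x y) \<Longrightarrow>
      (\<integral>x. \<phi> x \<partial>\<mu>) + (\<integral>y. \<psi> y \<partial>\<nu>) \<le> L"
  shows "transport_cost c \<mu> \<nu> \<le> ereal L"
proof (rule ereal_le_epsilon2)
  fix e :: real assume "e > 0"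
  \<comment> \<open>The errors add up to \<open>2 * \<epsilon> + 6 * K * \<epsilon>\<close>:
    rounding of the cells, the remainder cell of each measure, and the tail beyond \<open>R\<close>
    of each measure. Since \<open>K \<ge> 1\<close>, this is at most \<open>e\<close>.\<close>
  define \<epsilon> where "\<epsilon> = e / (8 * K)"
  have \<epsilon>: "\<epsilon> > 0" using \<open>e > 0\<close> K_ge_1 by (simp add: \<epsilon>_def)
  fix z
  note \<mu>b = P_c_borel_probs[OF \<mu>] and \<nu>b = P_c_borel_probs[OF \<nu>]
  interpret M: prob_space \<mu> by (rule borel_probsD[OF \<mu>b])
  interpret N: prob_space \<nu> by (rule borel_probsD[OF \<nu>b])
  have "\<forall>\<^sub>F n in sequentially. (\<integral>x. max 0 (c z x - real n) \<partial>\<mu>) < \<epsilon> \<and> (\<integral>x. max 0 (c z x - real n) \<partial>\<nu>) < \<epsilon>"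
    using tail_integral_tendsto[OF \<mu>] tail_integral_tendsto[OF \<nu>] \<epsilon>
    by (intro eventually_conj) (rule order_tendstoD(2); assumption)+
  then obtain R :: nat where R: "(\<integral>x. max 0 (c z x - real R) \<partial>\<mu>) < \<epsilon>" "(\<integral>x. max 0 (c z x - real R) \<partial>\<nu>) < \<epsilon>"
    by (auto simp: eventually_sequentially)
  obtain \<phi> :: "nat \<Rightarrow> 'a \<Rightarrow> real" where \<phi>: "\<And>n. \<phi> n \<in> C_0" "\<And>n x. 0 \<le> \<phi> n x" "\<And>n x. \<phi> n x \<le> 1"
    "\<And>x. incseq (\<lambda>n. \<phi> n x)" "\<And>x. (\<lambda>n. \<phi> n x) \<longlonglongrightarrow> indicator UNIV x"
    by (rule open_indicator_approx[OF open_UNIV]) (rule that)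
  have lim: "(\<lambda>n. \<integral>x. 2 * (1 - \<phi> n x) \<partial>\<xi>) \<longlonglongrightarrow> 0" if \<xi>: "\<xi> \<in> borel_probs" for \<xi>
  proof -
    interpret prob_space \<xi> by (rule borel_probsD[OF \<xi>])
    have [measurable]: "\<phi> n \<in> borel_measurable \<xi>" for n
      unfolding borel_probs_measurable[OF \<xi>] by (intro C_b_measurable C_0_C_b \<phi>)
    have "(\<lambda>n. \<integral>x. 2 * (1 - \<phi> n x) \<partial>\<xi>) \<longlonglongrightarrow> (\<integral>x. 2 * (1 - indicator UNIV x) \<partial>\<xi>)"
    proof (rule integral_dominated_convergence[where w = "\<lambda>_. 2"])
      show "AE x in \<xi>. (\<lambda>n. 2 * (1 - \<phi> n x)) \<longlonglongrightarrow> 2 * (1 - indicator UNIV x)"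
        by (intro AE_I2 tendsto_intros \<phi>)
    qed (use \<phi> in \<open>auto simp: abs_le_iff\<close>)
    then show ?thesis by simp
  qed
  \<comment> \<open>The remainder cell is charged \<open>R\<close> per unit of mass, so its mass has
    to be small compared with \<open>1 / R\<close>.\<close>
  have "\<epsilon> / (real R + 1) > 0" using \<epsilon> by simp
  then have "\<forall>\<^sub>F n in sequentially. (\<integral>x. 2 * (1 - \<phi> n x) \<partial>\<mu>) < \<epsilon> / (real R + 1) \<and>
      (\<integral>x. 2 * (1 - \<phi> n x) \<partial>\<nu>) < \<epsilon> / (real R + 1)"
    using lim[OF \<mu>b] lim[OF \<nu>b] by (intro eventually_conj) (rule order_tendstoD(2); assumption)+
  then obtain k where k: "(\<integral>x. 2 * (1 - \<phi> k x) \<partial>\<mu>) < \<epsilon> / (real R + 1)"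
      "(\<integral>x. 2 * (1 - \<phi> k x) \<partial>\<nu>) < \<epsilon> / (real R + 1)"
    by (auto simp: eventually_sequentially)
  have half: "(1/2 :: real) > 0" by simp
  obtain S where S: "compact S" "\<And>x. x \<notin> S \<Longrightarrow> \<bar>\<phi> k x\<bar> < 1/2"
    by (rule C_0_vanishes[OF \<phi>(1) half]) (rule that)
  obtain n \<theta> D where \<theta>: "\<And>i. \<theta> i \<in> C_b" "\<And>i x. 0 \<le> \<theta> i x" "\<And>x. (\<Sum>i<Suc n. \<theta> i x) = 1"
      "\<And>x. x \<in> S \<Longrightarrow> \<theta> n x = 0"
    and D: "\<And>i j x y. i < n \<Longrightarrow> j < n \<Longrightarrow> \<theta> i x \<noteq> 0 \<Longrightarrow> \<theta> j y \<noteq> 0 \<Longrightarrow> \<bar>c x y - D i j\<bar> < \<epsilon>"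
    by (rule partition_of_unity[OF S(1) \<epsilon>]) (rule that)
  define p where "p i = (\<integral>x. \<theta> i x \<partial>\<mu>)" for i
  define q where "q i = (\<integral>x. \<theta> i x \<partial>\<nu>)" for i
  have p_nn: "0 \<le> p i" and q_nn: "0 \<le> q i" for i
    by (auto simp: p_def q_def \<theta> intro: Bochner_Integration.integral_nonneg)
  have psum: "(\<Sum>i<Suc n. p i) = 1"
    unfolding p_def by (subst Bochner_Integration.integral_sum[symmetric]) (simp_all only: C_b_integrable[OF \<mu>b \<theta>(1)] \<theta>(3), simp add: M.prob_space)
  have qsum: "(\<Sum>i<Suc n. q i) = 1"
    unfolding q_def by (subst Bochner_Integration.integral_sum[symmetric]) (simp_all only: C_b_integrable[OF \<nu>b \<theta>(1)] \<theta>(3), simp add: N.prob_space)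
  \<comment> \<open>Off \<open>S\<close> the function \<open>\<phi> k\<close> is below 1/2, so the
    factor 2 makes the right side exceed 1, while on \<open>S\<close> the remainder
    vanishes.\<close>
  have \<theta>n: "\<theta> n x \<le> 2 * (1 - \<phi> k x)" for x
  proof (cases "x \<in> S")
    case True
    then show ?thesis using \<theta>(4) \<phi>(3)[of k x] by simp
  next
    case False
    have "\<theta> n x \<le> (\<Sum>i<Suc n. \<theta> i x)" by (intro member_le_sum \<theta>) auto
    then have "\<theta> n x \<le> 1" by (simp only: \<theta>(3))
    then show ?thesis using S(2)[OF False] by (auto simp: abs_less_iff)
  qed
  have small: "(\<integral>x. \<theta> n x \<partial>\<xi>) \<le> (\<integral>x. 2 * (1 - \<phi> k x) \<partial>\<xi>)" if "\<xi> \<in> borel_probs" for \<xi>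
    by (intro integral_mono \<theta>n C_b_integrable[OF that] \<theta> C_b_mult C_b_diff C_b_const C_0_C_b \<phi>)
  have pn: "real R * p n \<le> \<epsilon>" "real R * q n \<le> \<epsilon>"
  proof -
    have *: "real R * s \<le> \<epsilon>" if "s \<le> \<epsilon> / (real R + 1)" for s
    proof -
      have "real R * s \<le> real R * (\<epsilon> / (real R + 1))" using that by (intro mult_left_mono) auto
      also have "\<dots> \<le> \<epsilon>" using \<epsilon> by (simp add: field_simps)
      finally show ?thesis .
    qed
    show "real R * p n \<le> \<epsilon>" "real R * q n \<le> \<epsilon>"
      using small[OF \<mu>b] small[OF \<nu>b] k by (auto intro!: * simp: p_def q_def)
  qed
  \<comment> \<open>Lowered by \<open>\<epsilon>\<close> and set to 0 on the remainder cell: a cost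
    that never exceeds \<open>c x y\<close> on the cells it stands for.\<close>
  define C where "C i j = (if i < n \<and> j < n then max 0 (D i j - \<epsilon>) else 0)" for i j
  have C_nn: "0 \<le> C i j" for i j by (simp add: C_def)
  have C_le: "\<theta> i x * \<theta> j y * C i j \<le> \<theta> i x * \<theta> j y * c x y" for i j x y
  proof (cases "\<theta> i x * \<theta> j y = 0")
    case False
    then have "C i j \<le> c x y" using D[of i j x y] by (auto simp: C_def)
    then show ?thesis using \<theta>(2) by (intro mult_left_mono) auto
  qed auto
  have dual_n: "(\<Sum>i<Suc n. a i * p i) + (\<Sum>j<Suc n. b j * q j) \<le> L"
    if ab: "\<And>i j. i < Suc n \<Longrightarrow> j < Suc n \<Longrightarrow> a i + b j \<le> C i j" for a b
  proof -
    \<comment> \<open>Each single sum may be multiplied by the other partition, which sums to 1; the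
      dual constraint can then be applied cell by cell.\<close>
    have split: "(\<Sum>i<Suc n. a i * \<theta> i x) + (\<Sum>j<Suc n. b j * \<theta> j y)
        = (\<Sum>i<Suc n. \<Sum>j<Suc n. \<theta> i x * \<theta> j y * (a i + b j))" for x y
    proof -
      have "(\<Sum>i<Suc n. \<Sum>j<Suc n. \<theta> i x * \<theta> j y * (a i + b j))
        = (\<Sum>i<Suc n. (a i * \<theta> i x) * (\<Sum>j<Suc n. \<theta> j y)) + (\<Sum>i<Suc n. \<theta> i x * (\<Sum>j<Suc n. b j * \<theta> j y))"
        unfolding sum_distrib_left sum.distrib[symmetric]
        by (intro sum.cong refl) (simp add: algebra_simps)
      then show ?thesis by (simp only: \<theta>(3) sum_distrib_right[symmetric] mult_1_right mult_1_left)
    qed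
    have "(\<Sum>i<Suc n. a i * \<theta> i x) + (\<Sum>j<Suc n. b j * \<theta> j y) \<le> c x y" for x y
    proof -
      have "(\<Sum>i<Suc n. \<Sum>j<Suc n. \<theta> i x * \<theta> j y * (a i + b j)) \<le> (\<Sum>i<Suc n. \<Sum>j<Suc n. \<theta> i x * \<theta> j y * c x y)"
        by (intro sum_mono order_trans[OF mult_left_mono[OF ab] C_le] mult_nonneg_nonneg \<theta>) auto
      also have "\<dots> = (\<Sum>i<Suc n. \<theta> i x) * (\<Sum>j<Suc n. \<theta> j y) * c x y"
        by (subst sum_product) (simp only: sum_distrib_right)
      finally show ?thesis by (simp only: split \<theta>(3))
    qed
    moreover have "(\<lambda>x. \<Sum>i<Suc n. a i * \<theta> i x) \<in> C_b" "(\<lambda>x. \<Sum>i<Suc n. b i * \<theta> i x) \<in> C_b"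
      by (intro C_b_sum C_b_mult C_b_const \<theta> finite_lessThan)+
    ultimately have "(\<integral>x. (\<Sum>i<Suc n. a i * \<theta> i x) \<partial>\<mu>) + (\<integral>y. (\<Sum>j<Suc n. b j * \<theta> j y) \<partial>\<nu>) \<le> L"
      by (intro dual)
    moreover have "(\<integral>x. (\<Sum>i<Suc n. a i * \<theta> i x) \<partial>\<mu>) = (\<Sum>i<Suc n. a i * p i)"
      unfolding p_def by (subst Bochner_Integration.integral_sum) (simp_all add: C_b_integrable[OF \<mu>b \<theta>(1)] del: sum.lessThan_Suc)
    moreover have "(\<integral>x. (\<Sum>i<Suc n. b i * \<theta> i x) \<partial>\<nu>) = (\<Sum>i<Suc n. b i * q i)"
      unfolding q_def by (subst Bochner_Integration.integral_sum) (simp_all add: C_b_integrable[OF \<nu>b \<theta>(1)] del: sum.lessThan_Suc)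
    ultimately show ?thesis by simp
  qed
  obtain \<pi> where \<pi>: "\<And>i j. 0 \<le> \<pi> i j" "(\<Sum>i<Suc n. \<Sum>j<Suc n. \<pi> i j * C i j) \<le> L"
    "\<And>i. i < Suc n \<Longrightarrow> (\<Sum>j<Suc n. \<pi> i j) = p i" "\<And>j. j < Suc n \<Longrightarrow> (\<Sum>i<Suc n. \<pi> i j) = q j"
    by (rule finite_transport_duality[of C p "Suc n" q L, OF C_nn p_nn psum q_nn qsum dual_n]) (assumption, rule that)
  \<comment> \<open>With \<open>a\<close>, this is the price of far cells:
    \<open>c z x \<le> R + max 0 (c z x - R)\<close>, where the constant is charged to the remainder
    cell and the excess to the tail integrals. On cells inside the net only
    \<open>C i j + 2 * \<epsilon>\<close> is used.\<close>
  define g where "g x = K * max 0 (c z x - real R)" for x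
  define a where "a i j = C i j + 2 * \<epsilon> + 2 * K * real R * (of_bool (i = n) + of_bool (j = n))" for i j
  have bound: "\<theta> i x * \<theta> j y * c x y \<le> \<theta> i x * \<theta> j y * (a i j + g x + g y)"
    if ij: "i < Suc n" "j < Suc n" for i j x y
  proof (cases "\<theta> i x * \<theta> j y = 0")
    case False
    have "c x y \<le> a i j + g x + g y"
    proof (cases "i < n \<and> j < n")
      case True
      then have "c x y \<le> C i j + 2 * \<epsilon>" using False D[of i j x y] by (auto simp: C_def)
      then show ?thesis using K_ge_1 True by (simp add: a_def g_def add_increasing2)
    next
      case far: False
      have "c x y \<le> K * (c z x + c z y)" using quasi_triangle[of x y z] by (simp add: cost_sym[of x z])
      also have "\<dots> \<le> K * (max 0 (c z x - real R) + max 0 (c z y - real R) + 2 * real R)"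
        using K_ge_1 by (intro mult_left_mono) auto
      also have "\<dots> = g x + g y + 2 * K * real R * 1" by (simp add: g_def algebra_simps)
      also have "\<dots> \<le> g x + g y + 2 * K * real R * (of_bool (i = n) + of_bool (j = n))"
        using far ij K_ge_1 by (intro add_left_mono mult_left_mono) auto
      finally show ?thesis using C_nn[of i j] \<epsilon> by (simp add: a_def)
    qed
    then show ?thesis using \<theta>(2) by (intro mult_left_mono) auto
  qed auto
  have g_meas: "g \<in> borel_measurable borel" unfolding g_def by measurable
  have g_int: "integrable \<xi> g" if "\<xi> \<in> P_c c" for \<xi>
    unfolding g_def using P_c_integrable[OF that] borel_probsD(1)[OF P_c_borel_probs[OF that]]
    by (intro integrable_mult_right integrable_max Bochner_Integration.integrable_diff)
      (auto simp: prob_space.finite_measure finite_measure.integrable_const)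
  have "transport_cost c \<mu> \<nu> \<le> ereal ((\<Sum>i<Suc n. \<Sum>j<Suc n. \<pi> i j * a i j) + (\<integral>x. g x \<partial>\<mu>) + (\<integral>y. g y \<partial>\<nu>))"
    using \<pi>(3,4) unfolding p_def q_def
    by (intro transport_cost_le_partition[OF \<mu> \<nu> \<theta>(1,2,3) \<pi>(1) _ _ g_meas g_int[OF \<mu>] g_int[OF \<nu>] bound])
  also have "(\<Sum>i<Suc n. \<Sum>j<Suc n. \<pi> i j * a i j) = (\<Sum>i<Suc n. \<Sum>j<Suc n. \<pi> i j * C i j)
      + 2 * \<epsilon> + 2 * K * (real R * p n) + 2 * K * (real R * q n)"
  proof -
    have "(\<Sum>i<Suc n. \<Sum>j<Suc n. \<pi> i j * a i j) = (\<Sum>i<Suc n. \<Sum>j<Suc n. \<pi> i j * C i j)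
      + 2 * \<epsilon> * (\<Sum>i<Suc n. \<Sum>j<Suc n. \<pi> i j)
      + 2 * K * real R * (\<Sum>i<Suc n. of_bool (i = n) * (\<Sum>j<Suc n. \<pi> i j))
      + 2 * K * real R * (\<Sum>j<Suc n. of_bool (j = n) * (\<Sum>i<Suc n. \<pi> i j))"
      unfolding sum_distrib_left sum.swap[of "\<lambda>j i. 2 * K * real R * (of_bool (j = n) * \<pi> i j)"] sum.distrib[symmetric]
      by (intro sum.cong refl) (simp add: a_def algebra_simps)
    also have "(\<Sum>i<Suc n. \<Sum>j<Suc n. \<pi> i j) = 1" unfolding psum[symmetric] by (intro sum.cong refl \<pi>(3)) simp
    also have "(\<Sum>i<Suc n. of_bool (i = n) * (\<Sum>j<Suc n. \<pi> i j)) = p n"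
      unfolding sum.lessThan_Suc[of _ n] using \<pi>(3)[of n] by simp
    also have "(\<Sum>j<Suc n. of_bool (j = n) * (\<Sum>i<Suc n. \<pi> i j)) = q n"
      unfolding sum.lessThan_Suc[of _ n] using \<pi>(4)[of n] by simp
    finally show ?thesis by simp
  qed
  also have "(\<Sum>i<Suc n. \<Sum>j<Suc n. \<pi> i j * C i j) + 2 * \<epsilon> + 2 * K * (real R * p n) + 2 * K * (real R * q n)
      + (\<integral>x. g x \<partial>\<mu>) + (\<integral>y. g y \<partial>\<nu>) \<le> L + 2 * \<epsilon> + 2 * K * \<epsilon> + 2 * K * \<epsilon> + K * \<epsilon> + K * \<epsilon>"
    using \<pi>(2) pn R K_ge_1 unfolding g_def
    by (intro add_mono) (auto intro!: mult_left_mono)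
  also have "\<dots> \<le> L + 8 * K * \<epsilon>" using K_ge_1 \<epsilon> by simp
  also have "8 * K * \<epsilon> = e" using K_ge_1 by (simp add: \<epsilon>_def)
  finally show "transport_cost c \<mu> \<nu> \<le> ereal L + ereal e" by simp
qed

end

section \<open>Time integrals along a semigroup\<close>

lemma exp_minus_lipschitz:
  fixes \<beta> :: real
  assumes "\<beta> \<ge> 0" "s \<ge> 0" "t \<ge> 0"
  shows "\<bar>exp (- \<beta> * s) - exp (- \<beta> * t)\<bar> \<le> \<beta> * \<bar>s - t\<bar>"
proof -
  have le: "\<bar>exp (- \<beta> * s) - exp (- \<beta> * t)\<bar> \<le> \<beta> * (t - s)" if "s \<ge> 0" "s \<le> t" for s t
  proof -
    have 1: "exp (- \<beta> * t) = exp (- \<beta> * s) * exp (- \<beta> * (t - s))"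
      unfolding exp_add[symmetric] by (rule arg_cong[of _ _ exp]) (simp add: algebra_simps)
    have 2: "1 - exp (- \<beta> * (t - s)) \<le> \<beta> * (t - s)"
      using exp_ge_add_one_self[of "- \<beta> * (t - s)"] by simp
    have 3: "exp (- \<beta> * (t - s)) \<le> 1" using assms(1) that by simp
    have 4: "exp (- \<beta> * s) \<le> 1" using assms(1) that by simp
    have "exp (- \<beta> * s) - exp (- \<beta> * t) = exp (- \<beta> * s) * (1 - exp (- \<beta> * (t - s)))"
      by (simp only: 1 right_diff_distrib mult_1_right)
    also have "\<bar>\<dots>\<bar> \<le> 1 * (1 - exp (- \<beta> * (t - s)))"
      using 3 4 by (simp add: abs_mult mult_left_le_one_le del: minus_mult_left)
    also have "\<dots> \<le> \<beta> * (t - s)" using 2 by (simp only: mult_1_left)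
    finally show ?thesis .
  qed
  show ?thesis
    using le[of s t] le[of t s] assms by (cases "s \<le> t") (auto simp: abs_minus_commute)
qed

lemma integral_abs_le:
  fixes f :: "real \<Rightarrow> real"
  assumes "a \<le> b" "continuous_on {a..b} f" "\<And>s. s \<in> {a..b} \<Longrightarrow> \<bar>f s\<bar> \<le> B"
  shows "\<bar>integral {a..b} f\<bar> \<le> B * (b - a)"
proof -
  have "norm (integral {a..b} f) \<le> integral {a..b} (\<lambda>_. B)"
    using assms by (intro integral_norm_bound_integral integrable_continuous_real) auto
  then show ?thesis using assms(1) by (simp add: mult.commute)
qed

text \<open>Links the Lebesgue time integrals of the theorem with the gauge integral, in which
  differentiation and shifts of the limits are carried out.\<close>

lemma set_integral_eq_integral:
  fixes f :: "real \<Rightarrow> real"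
  assumes "continuous_on {a..b} f"
  shows "(LINT s:{a..b}|lborel. f s) = integral {a..b} f"
  using set_borel_integral_eq_integral(2)[OF borel_integrable_atLeastAtMost'[OF assms]] .

section \<open>Discounted orbits of \<open>C_0\<close> functions and their time integrals\<close>

context cost_semigroup
begin

text \<open>Formally the semigroup whose generator is that of \<open>\<kappa>\<close> minus
  \<open>\<beta>\<close>.\<close>

definition orbit :: "real \<Rightarrow> ('a \<Rightarrow> real) \<Rightarrow> real \<Rightarrow> 'a \<Rightarrow> real" where
  "orbit \<beta> h s x = exp (- \<beta> * s) * kernel_op \<kappa> s h x"

text \<open>What remains of the time integral in the theorem after the factor
  \<open>exp (\<beta> * t)\<close> is taken out.\<close>

definition orbit_integral :: "real \<Rightarrow> ('a \<Rightarrow> real) \<Rightarrow> real \<Rightarrow> 'a \<Rightarrow> real" where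
  "orbit_integral \<beta> h t x = integral {0..t} (\<lambda>s. orbit \<beta> h s x)"

lemma orbit_zero [simp]: "h \<in> C_0 \<Longrightarrow> orbit \<beta> h 0 x = h x"
  by (simp add: orbit_def kernel_op_0)

lemma orbit_C_0: "s \<ge> 0 \<Longrightarrow> h \<in> C_0 \<Longrightarrow> orbit \<beta> h s \<in> C_0"
  unfolding orbit_def[abs_def] by (intro C_0_scale kernel_op_C_0)

lemma measurable_orbit:
  assumes "f \<in> borel_measurable borel"
  shows "(\<lambda>(s, x). indicator {0..t} s *\<^sub>R orbit \<beta> f s x) \<in> borel_measurable (borel \<Otimes>\<^sub>M borel)"
proof -
  have "(\<lambda>p. \<integral>y. f y \<partial>\<kappa> (max 0 (fst p)) (snd p)) \<in> borel_measurable (borel \<Otimes>\<^sub>M borel)"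
    using measurable_compose[OF measurable_kernel_joint integral_measurable_subprob_algebra[OF assms]] .
  then have "(\<lambda>p. indicator {0..t} (fst p) * (exp (- \<beta> * fst p) * (\<integral>y. f y \<partial>\<kappa> (max 0 (fst p)) (snd p))))
      \<in> borel_measurable (borel \<Otimes>\<^sub>M borel)"
    by measurable
  also have "(\<lambda>p. indicator {0..t} (fst p) * (exp (- \<beta> * fst p) * (\<integral>y. f y \<partial>\<kappa> (max 0 (fst p)) (snd p))))
      = (\<lambda>(s, x). indicator {0..t} s *\<^sub>R orbit \<beta> f s x)"
    by (auto simp: fun_eq_iff orbit_def kernel_op_def indicator_def)
  finally show ?thesis .
qed

context
  fixes \<beta> :: real and h :: "'a \<Rightarrow> real"
  assumes beta: "\<beta> \<ge> 0" and h: "h \<in> C_0"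
begin

lemma orbit_bound:
  assumes "\<And>x. \<bar>h x\<bar> \<le> M" "s \<ge> 0"
  shows "\<bar>orbit \<beta> h s x\<bar> \<le> M"
proof -
  have "\<bar>orbit \<beta> h s x\<bar> \<le> 1 * M"
    unfolding orbit_def abs_mult
    using beta assms kernel_op_bound[OF assms(2) C_0_C_b[OF h] assms(1)] by (intro mult_mono) auto
  then show ?thesis by simp
qed

lemma orbit_equicontinuous:
  assumes "\<epsilon> > 0"
  obtains \<delta> where "\<delta> > 0"
    "\<And>s t x. 0 \<le> s \<Longrightarrow> 0 \<le> t \<Longrightarrow> \<bar>s - t\<bar> < \<delta> \<Longrightarrow> \<bar>orbit \<beta> h s x - orbit \<beta> h t x\<bar> \<le> \<epsilon>"
proof -
  obtain M where M: "M \<ge> 0" "\<And>x. \<bar>h x\<bar> \<le> M" by (rule C_0_bounded[OF h]) (rule that)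
  have "\<epsilon> / 2 > 0" using assms by simp
  then obtain \<delta> where \<delta>: "\<delta> > 0" "\<And>s t x. 0 \<le> s \<Longrightarrow> 0 \<le> t \<Longrightarrow> \<bar>s - t\<bar> < \<delta> \<Longrightarrow>
      \<bar>kernel_op \<kappa> t h x - kernel_op \<kappa> s h x\<bar> \<le> \<epsilon> / 2"
    by (rule kernel_op_equicontinuous[OF h]) (rule that)
  define \<eta> where "\<eta> = \<epsilon> / 2 / (\<beta> * M + 1)"
  have \<eta>: "\<eta> > 0" "\<beta> * M * \<eta> \<le> \<epsilon> / 2"
    using assms beta M(1) by (auto simp: \<eta>_def field_simps add_pos_nonneg)
  show ?thesis
  proof (rule that[of "min \<delta> \<eta>"])
    show "min \<delta> \<eta> > 0" using \<delta> \<eta> by simp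
    fix s t x assume st: "0 \<le> s" "0 \<le> t" "\<bar>s - t\<bar> < min \<delta> \<eta>"
    let ?P = "\<lambda>s. kernel_op \<kappa> s h x"
    have "orbit \<beta> h s x - orbit \<beta> h t x = exp (- \<beta> * s) * (?P s - ?P t) + (exp (- \<beta> * s) - exp (- \<beta> * t)) * ?P t"
      by (simp add: orbit_def algebra_simps)
    also have "\<bar>\<dots>\<bar> \<le> \<bar>exp (- \<beta> * s) * (?P s - ?P t)\<bar> + \<bar>(exp (- \<beta> * s) - exp (- \<beta> * t)) * ?P t\<bar>"
      by (rule abs_triangle_ineq)
    also have "\<bar>exp (- \<beta> * s) * (?P s - ?P t)\<bar> \<le> 1 * (\<epsilon> / 2)"
      unfolding abs_mult using beta st \<delta>(2)[of t s x] by (intro mult_mono) (auto simp: abs_minus_commute)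
    also have "\<bar>(exp (- \<beta> * s) - exp (- \<beta> * t)) * ?P t\<bar> \<le> (\<beta> * \<bar>s - t\<bar>) * M"
      unfolding abs_mult using beta st M
      by (intro mult_mono exp_minus_lipschitz kernel_op_bound C_0_C_b h) auto
    also have "\<dots> \<le> \<beta> * M * \<eta>"
      using st beta M by (simp add: mult.commute mult.left_commute mult_left_mono)
    finally show "\<bar>orbit \<beta> h s x - orbit \<beta> h t x\<bar> \<le> \<epsilon>" using \<eta> by simp
  qed
qed

lemma continuous_on_orbit: "continuous_on {0..} (\<lambda>s. orbit \<beta> h s x)"
  unfolding continuous_on_iff
proof (intro ballI allI impI)
  fix s e :: real assume "s \<in> {0..}" "e > 0"
  then have "e / 2 > 0" by simp
  then obtain \<delta> where \<delta>: "\<delta> > 0" "\<And>s t x. 0 \<le> s \<Longrightarrow> 0 \<le> t \<Longrightarrow> \<bar>s - t\<bar> < \<delta> \<Longrightarrow>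
      \<bar>orbit \<beta> h s x - orbit \<beta> h t x\<bar> \<le> e / 2"
    by (rule orbit_equicontinuous) (rule that)
  show "\<exists>d>0. \<forall>t\<in>{0..}. dist t s < d \<longrightarrow> dist (orbit \<beta> h t x) (orbit \<beta> h s x) < e"
  proof (intro exI conjI ballI impI)
    fix t assume "t \<in> {0..}" "dist t s < \<delta>"
    then have "\<bar>orbit \<beta> h t x - orbit \<beta> h s x\<bar> \<le> e / 2"
      using \<open>s \<in> {0..}\<close> by (intro \<delta>(2)) (auto simp: dist_real_def)
    then show "dist (orbit \<beta> h t x) (orbit \<beta> h s x) < e" using \<open>e > 0\<close> by (simp add: dist_real_def)
  qed (rule \<delta>)
qed

lemma continuous_on_orbit_subset: "a \<ge> 0 \<Longrightarrow> continuous_on {a..b} (\<lambda>s. orbit \<beta> h s x)"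
  by (rule continuous_on_subset[OF continuous_on_orbit]) auto

text \<open>Equicontinuity in time makes the orbit over a bounded interval totally bounded in sup
  norm. Continuity and decay of time integrals thereby reduce to finitely many functions in
  \<open>C_0\<close>.\<close>

lemma orbit_finite_net:
  assumes "\<epsilon> > 0"
  obtains N where "finite N" "N \<subseteq> {0..t}"
    "\<And>s. s \<in> {0..t} \<Longrightarrow> \<exists>k\<in>N. \<forall>x. \<bar>orbit \<beta> h s x - orbit \<beta> h k x\<bar> \<le> \<epsilon>"
proof -
  obtain \<delta> where \<delta>: "\<delta> > 0" "\<And>s t x. 0 \<le> s \<Longrightarrow> 0 \<le> t \<Longrightarrow> \<bar>s - t\<bar> < \<delta> \<Longrightarrow>
      \<bar>orbit \<beta> h s x - orbit \<beta> h t x\<bar> \<le> \<epsilon>"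
    by (rule orbit_equicontinuous[OF assms]) (rule that)
  have cover: "{0..t} \<subseteq> (\<Union>k\<in>{0..t}. ball k \<delta>)" using \<delta>(1) by force
  obtain N where N: "N \<subseteq> {0..t}" "finite N" "{0..t} \<subseteq> (\<Union>k\<in>N. ball k \<delta>)"
    by (rule compactE_image[OF compact_Icc open_ball cover]) (rule that)
  show ?thesis
  proof (rule that[OF N(2,1)])
    fix s assume s: "s \<in> {0..t}"
    then obtain k where k: "k \<in> N" "\<bar>s - k\<bar> < \<delta>"
      using N(3) by (auto simp: dist_real_def abs_minus_commute)
    then have "0 \<le> k" "0 \<le> s" using N(1) s by auto
    then show "\<exists>k\<in>N. \<forall>x. \<bar>orbit \<beta> h s x - orbit \<beta> h k x\<bar> \<le> \<epsilon>"
      using k \<delta>(2)[of s k] by (intro bexI[of _ k]) auto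
  qed
qed

text \<open>The union of the compact sets belonging to a finite net. A compact set independent of
  time confines the maximization in the comparison principle.\<close>

lemma orbit_equivanishing:
  assumes "\<epsilon> > 0"
  obtains C where "compact C" "\<And>s x. s \<in> {0..t} \<Longrightarrow> x \<notin> C \<Longrightarrow> \<bar>orbit \<beta> h s x\<bar> < \<epsilon>"
proof -
  have e2: "\<epsilon> / 2 > 0" using assms by simp
  obtain N where N: "finite N" "N \<subseteq> {0..t}"
    "\<And>s. s \<in> {0..t} \<Longrightarrow> \<exists>k\<in>N. \<forall>x. \<bar>orbit \<beta> h s x - orbit \<beta> h k x\<bar> \<le> \<epsilon> / 2"
    by (rule orbit_finite_net[OF e2]) (rule that)
  have "\<forall>k\<in>N. \<exists>C. compact C \<and> (\<forall>x. x \<notin> C \<longrightarrow> \<bar>orbit \<beta> h k x\<bar> < \<epsilon> / 2)"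
  proof
    fix k assume "k \<in> N"
    then have "orbit \<beta> h k \<in> C_0" using N(2) h by (intro orbit_C_0) auto
    obtain C where "compact C" "\<And>x. x \<notin> C \<Longrightarrow> \<bar>orbit \<beta> h k x\<bar> < \<epsilon> / 2"
      by (rule C_0_vanishes[OF \<open>orbit \<beta> h k \<in> C_0\<close> e2]) (rule that)
    then show "\<exists>C. compact C \<and> (\<forall>x. x \<notin> C \<longrightarrow> \<bar>orbit \<beta> h k x\<bar> < \<epsilon> / 2)"
      by (intro exI[of _ C]) auto
  qed
  from bchoice[OF this] obtain C where
    C: "\<forall>k\<in>N. compact (C k) \<and> (\<forall>x. x \<notin> C k \<longrightarrow> \<bar>orbit \<beta> h k x\<bar> < \<epsilon> / 2)" ..
  show ?thesis
  proof (rule that[of "\<Union>k\<in>N. C k"])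
    show "compact (\<Union>k\<in>N. C k)" using N(1) C by (intro compact_UN) auto
    fix s x assume s: "s \<in> {0..t}" and x: "x \<notin> (\<Union>k\<in>N. C k)"
    obtain k where k: "k \<in> N" "\<forall>x. \<bar>orbit \<beta> h s x - orbit \<beta> h k x\<bar> \<le> \<epsilon> / 2" using N(3)[OF s] by auto
    then have "\<bar>orbit \<beta> h k x\<bar> < \<epsilon> / 2" using C x by auto
    then show "\<bar>orbit \<beta> h s x\<bar> < \<epsilon>" using k(2)[rule_format, of x] by linarith
  qed
qed

lemma orbit_integral_C_0:
  assumes "t \<ge> 0"
  shows "orbit_integral \<beta> h t \<in> C_0"
proof -
  have cont: "continuous_on UNIV (orbit_integral \<beta> h t)"
    unfolding continuous_on_def
  proof (intro ballI tendstoI)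
    fix x and e :: real assume "e > 0"
    define \<epsilon> where "\<epsilon> = e / (4 * (t + 1))"
    have \<epsilon>: "\<epsilon> > 0" using \<open>e > 0\<close> assms by (simp add: \<epsilon>_def)
    obtain N where N: "finite N" "N \<subseteq> {0..t}"
      "\<And>s. s \<in> {0..t} \<Longrightarrow> \<exists>k\<in>N. \<forall>x. \<bar>orbit \<beta> h s x - orbit \<beta> h k x\<bar> \<le> \<epsilon>"
      by (rule orbit_finite_net[OF \<epsilon>]) (rule that)
    have "\<forall>\<^sub>F y in at x. dist (orbit \<beta> h k y) (orbit \<beta> h k x) < \<epsilon>" if "k \<in> N" for k
    proof -
      have "continuous_on UNIV (orbit \<beta> h k)"
        using that N(2) h by (intro C_0_continuous orbit_C_0) auto
      then show ?thesis
        using \<epsilon> by (auto simp: continuous_on_def intro: tendstoD)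
    qed
    then have "\<forall>\<^sub>F y in at x. \<forall>k\<in>N. dist (orbit \<beta> h k y) (orbit \<beta> h k x) < \<epsilon>"
      using N(1) by (intro eventually_ball_finite) auto
    then show "\<forall>\<^sub>F y in at x. dist (orbit_integral \<beta> h t y) (orbit_integral \<beta> h t x) < e"
    proof eventually_elim
      case (elim y)
      have "\<bar>orbit \<beta> h s y - orbit \<beta> h s x\<bar> \<le> 3 * \<epsilon>" if "s \<in> {0..t}" for s
      proof -
        obtain k where k: "k \<in> N" "\<forall>x. \<bar>orbit \<beta> h s x - orbit \<beta> h k x\<bar> \<le> \<epsilon>" using N(3)[OF \<open>s \<in> {0..t}\<close>] by auto
        have "\<bar>orbit \<beta> h k y - orbit \<beta> h k x\<bar> < \<epsilon>" using elim k(1) by (auto simp: dist_real_def)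
        then show ?thesis using k(2)[rule_format, of x] k(2)[rule_format, of y] by linarith
      qed
      then have "\<bar>integral {0..t} (\<lambda>s. orbit \<beta> h s y - orbit \<beta> h s x)\<bar> \<le> 3 * \<epsilon> * (t - 0)"
        using assms by (intro integral_abs_le continuous_on_diff continuous_on_orbit_subset) auto
      also have "\<dots> < e" using \<open>e > 0\<close> assms by (simp add: \<epsilon>_def field_simps add_nonneg_pos)
      also have "integral {0..t} (\<lambda>s. orbit \<beta> h s y - orbit \<beta> h s x)
          = orbit_integral \<beta> h t y - orbit_integral \<beta> h t x"
        unfolding orbit_integral_def
        by (intro Henstock_Kurzweil_Integration.integral_diff integrable_continuous_real continuous_on_orbit_subset) auto
      finally show ?case by (simp add: dist_real_def)
    qed
  qed
  have "\<exists>C. compact C \<and> (\<forall>x. x \<notin> C \<longrightarrow> \<bar>orbit_integral \<beta> h t x\<bar> < e)" if "e > 0" for e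
  proof -
    define \<epsilon> where "\<epsilon> = e / (t + 1)"
    have \<epsilon>: "\<epsilon> > 0" using \<open>e > 0\<close> assms by (simp add: \<epsilon>_def)
    obtain C where C: "compact C" "\<And>s x. s \<in> {0..t} \<Longrightarrow> x \<notin> C \<Longrightarrow> \<bar>orbit \<beta> h s x\<bar> < \<epsilon>"
      by (rule orbit_equivanishing[OF \<epsilon>]) (rule that)
    have "\<bar>orbit_integral \<beta> h t x\<bar> < e" if "x \<notin> C" for x
    proof -
      have "\<bar>orbit_integral \<beta> h t x\<bar> \<le> \<epsilon> * (t - 0)"
        unfolding orbit_integral_def using assms C(2) that
        by (intro integral_abs_le continuous_on_orbit_subset) (auto intro: less_imp_le)
      also have "\<dots> < e" using \<open>e > 0\<close> assms by (simp add: \<epsilon>_def field_simps add_nonneg_pos)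
      finally show ?thesis .
    qed
    with C(1) show ?thesis by blast
  qed
  with cont show ?thesis by (simp add: C_0_def)
qed

lemma orbit_integral_shift:
  assumes "r \<ge> 0" "t \<ge> 0"
  shows "integral {r..t + r} (\<lambda>s. orbit \<beta> h s x) = orbit_integral \<beta> h (t + r) x - orbit_integral \<beta> h r x"
proof -
  have "integral {0..r} (\<lambda>s. orbit \<beta> h s x) + integral {r..t + r} (\<lambda>s. orbit \<beta> h s x)
      = integral {0..t + r} (\<lambda>s. orbit \<beta> h s x)"
    using assms by (intro Henstock_Kurzweil_Integration.integral_combine integrable_continuous_real continuous_on_orbit_subset) auto
  then show ?thesis by (simp add: orbit_integral_def)
qed

lemma orbit_integral_lipschitz:
  assumes "\<And>x. \<bar>h x\<bar> \<le> M" "s \<ge> 0" "t \<ge> 0"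
  shows "\<bar>orbit_integral \<beta> h s x - orbit_integral \<beta> h t x\<bar> \<le> M * \<bar>s - t\<bar>"
proof -
  have le: "\<bar>orbit_integral \<beta> h t x - orbit_integral \<beta> h s x\<bar> \<le> M * (t - s)" if "s \<ge> 0" "s \<le> t" for s t
    using orbit_integral_shift[of s "t - s" x] that
      integral_abs_le[of s t "\<lambda>s. orbit \<beta> h s x" M] orbit_bound[OF assms(1)] continuous_on_orbit_subset[of s t x]
    by auto
  show ?thesis
    using le[of s t] le[of t s] assms by (cases "s \<le> t") (auto simp: abs_minus_commute)
qed

lemma orbit_integral_DERIV:
  assumes "t > 0"
  shows "((\<lambda>t. orbit_integral \<beta> h t x) has_real_derivative orbit \<beta> h t x) (at t)"
proof -
  have "((\<lambda>t. orbit_integral \<beta> h t x) has_real_derivative orbit \<beta> h t x) (at t within {0..t + 1})"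
    unfolding orbit_integral_def using assms
    by (intro integral_has_real_derivative continuous_on_orbit_subset) auto
  moreover have "at t within {0..t + 1} = at t"
    using assms by (intro at_within_interior) (simp add: interior_atLeastAtMost_real)
  ultimately show ?thesis by simp
qed

lemma kernel_op_orbit:
  assumes "r \<ge> 0" "s \<ge> 0"
  shows "kernel_op \<kappa> r (orbit \<beta> h s) x = exp (\<beta> * r) * orbit \<beta> h (r + s) x"
proof -
  have "kernel_op \<kappa> r (orbit \<beta> h s) x = exp (- \<beta> * s) * kernel_op \<kappa> r (kernel_op \<kappa> s h) x"
    by (simp add: kernel_op_def[of \<kappa> r] orbit_def[abs_def])
  also have "kernel_op \<kappa> r (kernel_op \<kappa> s h) x = kernel_op \<kappa> (r + s) h x"
    using kernel_op_semigroup[OF assms(2,1) h] by simp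
  also have "exp (- \<beta> * s) = exp (\<beta> * r) * exp (- \<beta> * (r + s))"
    unfolding exp_add[symmetric] by (simp add: algebra_simps)
  finally show ?thesis unfolding orbit_def[of _ _ "r + s"] by (simp add: mult.assoc)
qed

text \<open>Fubini and the semigroup property. Applying the semigroup becomes a shift of the time
  window, so generator quotients turn into difference quotients in time.\<close>

lemma kernel_op_orbit_integral:
  assumes "r \<ge> 0" "t \<ge> 0"
  shows "kernel_op \<kappa> r (orbit_integral \<beta> h t) x
    = exp (\<beta> * r) * (orbit_integral \<beta> h (t + r) x - orbit_integral \<beta> h r x)"
proof -
  note \<kappa>b = kernel_borel_probs[OF assms(1), of x]
  interpret K: prob_space "\<kappa> r x" by (rule borel_probsD[OF \<kappa>b])
  interpret P: pair_sigma_finite lborel "\<kappa> r x" ..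
  obtain M where M: "M \<ge> 0" "\<And>x. \<bar>h x\<bar> \<le> M" by (rule C_0_bounded[OF h]) (rule that)
  have sets_eq: "sets (lborel \<Otimes>\<^sub>M \<kappa> r x) = sets (borel \<Otimes>\<^sub>M borel)"
    using borel_probsD(2)[OF \<kappa>b] by (intro sets_pair_measure_cong) auto
  define F where "F s y = indicator {0..t} s *\<^sub>R orbit \<beta> h s y" for s y
  have meas: "case_prod F \<in> borel_measurable (lborel \<Otimes>\<^sub>M \<kappa> r x)"
    using measurable_orbit[OF C_b_measurable[OF C_0_C_b[OF h]]]
    by (simp add: measurable_cong_sets[OF sets_eq refl] F_def[abs_def])
  have "integrable (lborel \<Otimes>\<^sub>M \<kappa> r x) (case_prod F)"
  proof (rule Bochner_Integration.integrable_bound)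
    have "{0..t} \<times> UNIV \<in> sets (lborel \<Otimes>\<^sub>M \<kappa> r x)"
      using borel_probsD[OF \<kappa>b] by (intro pair_measureI) auto
    moreover have "emeasure (lborel \<Otimes>\<^sub>M \<kappa> r x) ({0..t} \<times> UNIV) < \<infinity>"
      using borel_probsD[OF \<kappa>b] K.emeasure_space_1 assms(2)
      by (subst K.emeasure_pair_measure_Times) auto
    ultimately show "integrable (lborel \<Otimes>\<^sub>M \<kappa> r x) (\<lambda>p. M * indicator ({0..t} \<times> UNIV) p)"
      by (intro integrable_mult_right integrable_real_indicator)
    show "AE p in lborel \<Otimes>\<^sub>M \<kappa> r x. norm (case_prod F p) \<le> norm (M * indicator ({0..t} \<times> UNIV) p)"
      using M orbit_bound[OF M(2)] by (intro AE_I2) (auto simp: F_def indicator_def)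
  qed (rule meas)
  then have Fub: "(\<integral>y. (\<integral>s. F s y \<partial>lborel) \<partial>\<kappa> r x) = (\<integral>s. (\<integral>y. F s y \<partial>\<kappa> r x) \<partial>lborel)"
    by (rule P.Fubini_integral)
  have "kernel_op \<kappa> r (orbit_integral \<beta> h t) x = (\<integral>y. (LINT s:{0..t}|lborel. orbit \<beta> h s y) \<partial>\<kappa> r x)"
    unfolding kernel_op_def orbit_integral_def
    by (simp add: set_integral_eq_integral continuous_on_orbit_subset)
  also have "\<dots> = (LINT s:{0..t}|lborel. \<integral>y. orbit \<beta> h s y \<partial>\<kappa> r x)"
    using Fub by (simp add: F_def set_lebesgue_integral_def)
  also have "\<dots> = (LINT s:{0..t}|lborel. exp (\<beta> * r) * orbit \<beta> h (r + s) x)"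
    using kernel_op_orbit[OF assms(1)] by (intro set_lebesgue_integral_cong) (auto simp: kernel_op_def)
  also have "\<dots> = integral {0..t} (\<lambda>s. exp (\<beta> * r) * orbit \<beta> h (r + s) x)"
  proof (rule set_integral_eq_integral)
    have "continuous_on {0..t} (\<lambda>s. orbit \<beta> h (r + s) x)"
      by (rule continuous_on_compose2[OF continuous_on_orbit]) (use assms in \<open>auto intro!: continuous_intros\<close>)
    then show "continuous_on {0..t} (\<lambda>s. exp (\<beta> * r) * orbit \<beta> h (r + s) x)" by (intro continuous_intros)
  qed
  also have "\<dots> = exp (\<beta> * r) * integral {r..t + r} (\<lambda>s. orbit \<beta> h s x)"
    using integral_shift_Icc_real[of 0 t "\<lambda>s. orbit \<beta> h s x" r] by (simp add: o_def)
  finally show ?thesis using orbit_integral_shift[OF assms] by simp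
qed

lemma orbit_integral_quotient:
  assumes "t \<ge> 0"
  shows "uniform_limit UNIV (\<lambda>r x. (orbit_integral \<beta> h (t + r) x - orbit_integral \<beta> h t x) / r)
    (orbit \<beta> h t) (at_right 0)"
proof (rule uniform_limitI)
  fix e :: real assume "e > 0"
  then have e2: "e / 2 > 0" by simp
  obtain \<delta> where \<delta>: "\<delta> > 0" "\<And>s t x. 0 \<le> s \<Longrightarrow> 0 \<le> t \<Longrightarrow> \<bar>s - t\<bar> < \<delta> \<Longrightarrow>
      \<bar>orbit \<beta> h s x - orbit \<beta> h t x\<bar> \<le> e / 2"
    by (rule orbit_equicontinuous[OF e2]) (rule that)
  have "dist ((orbit_integral \<beta> h (t + r) x - orbit_integral \<beta> h t x) / r) (orbit \<beta> h t x) < e"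
    if r: "0 < r" "r < \<delta>" for r x
  proof -
    have "orbit_integral \<beta> h (t + r) x - orbit_integral \<beta> h t x - orbit \<beta> h t x * r
        = integral {t..t + r} (\<lambda>s. orbit \<beta> h s x) - integral {t..t + r} (\<lambda>s. orbit \<beta> h t x)"
      using orbit_integral_shift[of t r x] r assms by (simp add: add.commute)
    also have "\<dots> = integral {t..t + r} (\<lambda>s. orbit \<beta> h s x - orbit \<beta> h t x)"
      using assms by (intro Henstock_Kurzweil_Integration.integral_diff[symmetric] integrable_continuous_real
          continuous_on_orbit_subset) auto
    also have "\<bar>\<dots>\<bar> \<le> e / 2 * (t + r - t)"
      using assms r by (intro integral_abs_le continuous_on_diff continuous_on_orbit_subset continuous_on_const \<delta>(2)) auto
    finally have "\<bar>orbit_integral \<beta> h (t + r) x - orbit_integral \<beta> h t x - orbit \<beta> h t x * r\<bar> \<le> e / 2 * r" by simp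
    moreover have "(orbit_integral \<beta> h (t + r) x - orbit_integral \<beta> h t x) / r - orbit \<beta> h t x
        = (orbit_integral \<beta> h (t + r) x - orbit_integral \<beta> h t x - orbit \<beta> h t x * r) / r"
      using r by (simp add: field_simps)
    ultimately have "\<bar>(orbit_integral \<beta> h (t + r) x - orbit_integral \<beta> h t x) / r - orbit \<beta> h t x\<bar> \<le> e / 2"
      using r by (simp add: divide_le_eq)
    then show ?thesis using \<open>e > 0\<close> by (simp add: dist_real_def)
  qed
  then show "\<forall>\<^sub>F r in at_right 0. \<forall>x\<in>UNIV.
      dist ((orbit_integral \<beta> h (t + r) x - orbit_integral \<beta> h t x) / r) (orbit \<beta> h t x) < e"
    unfolding eventually_at_right_field using \<delta>(1) by (intro exI[of _ \<delta>]) auto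
qed

lemma bounded_range_C_0: "\<phi> \<in> C_0 \<Longrightarrow> bounded (range \<phi>)"
  by (auto elim!: C_0_bounded simp: bounded_real)

text \<open>Write J for the time integral. Then P_r J_t - J_t = e^(beta r) (J_(t+r) - J_t - J_r) +
  (e^(beta r) - 1) J_t. After division by r the bracket tends uniformly to the orbit at time t minus
  its initial value \<open>h\<close>, and the last term to beta J_t.\<close>

lemma generator_limit_orbit_integral:
  assumes "t \<ge> 0"
  shows "generator_limit \<kappa> (orbit_integral \<beta> h t)
    (\<lambda>x. \<beta> * orbit_integral \<beta> h t x + orbit \<beta> h t x - h x)"
proof -
  let ?J = "orbit_integral \<beta> h"
  have J0: "?J 0 x = 0" for x by (simp add: orbit_integral_def)
  have l1: "uniform_limit UNIV (\<lambda>r x. (?J (t + r) x - ?J t x) / r - (?J (0 + r) x - ?J 0 x) / r)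
      (\<lambda>x. orbit \<beta> h t x - orbit \<beta> h 0 x) (at_right 0)"
    by (intro uniform_limit_intros orbit_integral_quotient assms) auto
  have "((\<lambda>r. (exp (\<beta> * r) - 1) / r) \<longlongrightarrow> \<beta>) (at_right 0)"
  proof -
    have "((\<lambda>r. exp (\<beta> * r)) has_real_derivative \<beta>) (at 0)"
      by (auto intro!: derivative_eq_intros)
    then have "((\<lambda>r. (exp (\<beta> * r) - 1) / r) \<longlongrightarrow> \<beta>) (at 0)"
      by (simp add: has_field_derivative_iff)
    then show ?thesis by (rule tendsto_mono[rotated]) (simp add: at_le)
  qed
  then have e1: "uniform_limit (UNIV :: 'a set) (\<lambda>r x. (exp (\<beta> * r) - 1) / r) (\<lambda>_. \<beta>) (at_right 0)"
    by (auto simp: uniform_limit_iff tendsto_iff)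
  have "((\<lambda>r. exp (\<beta> * r)) \<longlongrightarrow> exp (\<beta> * 0)) (at_right 0)"
    by (intro tendsto_intros)
  then have e2: "uniform_limit (UNIV :: 'a set) (\<lambda>r x. exp (\<beta> * r)) (\<lambda>_. 1) (at_right 0)"
    by (auto simp: uniform_limit_iff tendsto_iff)
  have bd: "bounded (range (\<lambda>x. orbit \<beta> h t x - orbit \<beta> h 0 x))"
    by (intro bounded_range_C_0 C_0_diff orbit_C_0 h assms order_refl)
  have bdc: "bounded (range (\<lambda>_ :: 'a. v :: real))" for v by (simp add: image_constant_conv)
  have l2: "uniform_limit UNIV
     (\<lambda>r x. exp (\<beta> * r) * ((?J (t + r) x - ?J t x) / r - (?J (0 + r) x - ?J 0 x) / r) + (exp (\<beta> * r) - 1) / r * ?J t x)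
     (\<lambda>x. 1 * (orbit \<beta> h t x - orbit \<beta> h 0 x) + \<beta> * ?J t x) (at_right 0)"
    by (intro uniform_limit_add uniform_lim_mult e1 e2 l1 uniform_limit_const bd bdc
        bounded_range_C_0[OF orbit_integral_C_0[OF assms]])
  show ?thesis
    unfolding generator_limit_def
  proof (rule uniform_limitI)
    fix e :: real assume "e > 0"
    from uniform_limitD[OF l2 this] eventually_at_right_less[of "0 :: real"]
    show "\<forall>\<^sub>F r in at_right 0. \<forall>x\<in>UNIV. dist ((kernel_op \<kappa> r (?J t) x - ?J t x) / r)
        (\<beta> * ?J t x + orbit \<beta> h t x - h x) < e"
    proof eventually_elim
      case (elim r)
      have "(kernel_op \<kappa> r (?J t) x - ?J t x) / r = exp (\<beta> * r) * ((?J (t + r) x - ?J t x) / r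
          - (?J (0 + r) x - ?J 0 x) / r) + (exp (\<beta> * r) - 1) / r * ?J t x" for x
        using elim(2) assms by (simp add: kernel_op_orbit_integral J0 field_simps)
      moreover have "\<beta> * ?J t x + orbit \<beta> h t x - h x
          = 1 * (orbit \<beta> h t x - orbit \<beta> h 0 x) + \<beta> * ?J t x" for x
        using h by simp
      ultimately show ?case using elim(1) by (simp only:)
    qed
  qed
qed

end

end

text \<open>The time error is uniform in \<open>x\<close>, so it can be paid at the nearby point;
  only continuity in \<open>x\<close> at the one time \<open>t\<close> enters besides.\<close>

lemma joint_continuity:
  fixes F :: "real \<Rightarrow> 'a::topological_space \<Rightarrow> real"
  assumes cont: "\<And>t. t \<ge> 0 \<Longrightarrow> continuous_on UNIV (F t)"
    and eq: "\<And>\<epsilon>. \<epsilon> > 0 \<Longrightarrow> \<exists>\<delta>>0. \<forall>s t x. 0 \<le> s \<longrightarrow> 0 \<le> t \<longrightarrow> \<bar>s - t\<bar> < \<delta> \<longrightarrow> \<bar>F s x - F t x\<bar> \<le> \<epsilon>"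
  shows "continuous_on ({0..} \<times> UNIV) (\<lambda>p. F (fst p) (snd p))"
  unfolding continuous_on_def
proof (intro ballI tendstoI)
  fix p :: "real \<times> 'a" and e :: real assume p: "p \<in> {0..} \<times> UNIV" and "e > 0"
  obtain t x where tx: "p = (t, x)" by (cases p)
  have t: "t \<ge> 0" using p tx by auto
  have "e / 4 > 0" using \<open>e > 0\<close> by simp
  from eq[OF this] obtain \<delta> where \<delta>: "\<delta> > 0"
    "\<forall>s t x. 0 \<le> s \<longrightarrow> 0 \<le> t \<longrightarrow> \<bar>s - t\<bar> < \<delta> \<longrightarrow> \<bar>F s x - F t x\<bar> \<le> e / 4" by auto
  have "(F t \<longlongrightarrow> F t x) (nhds x)"
    using cont[OF t] by (simp add: continuous_on_def tendsto_at_iff_tendsto_nhds)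
  then have y: "\<forall>\<^sub>F y in nhds x. dist (F t y) (F t x) < e / 4" using \<open>e > 0\<close> by (intro tendstoD) auto
  have s: "\<forall>\<^sub>F s in nhds t. \<bar>s - t\<bar> < \<delta>"
    using eventually_nhds_metric[of "\<lambda>s. \<bar>s - t\<bar> < \<delta>" t] \<delta>(1) by (auto simp: dist_real_def)
  have "\<forall>\<^sub>F q in nhds p. \<bar>fst q - t\<bar> < \<delta> \<and> dist (F t (snd q)) (F t x) < e / 4"
    unfolding tx nhds_prod eventually_prod_filter using s y
    by (intro exI[of _ "\<lambda>s. \<bar>s - t\<bar> < \<delta>"] exI[of _ "\<lambda>y. dist (F t y) (F t x) < e / 4"]) auto
  then have "\<forall>\<^sub>F q in at p within {0..} \<times> UNIV. \<bar>fst q - t\<bar> < \<delta> \<and> dist (F t (snd q)) (F t x) < e / 4"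
    using at_within_le_nhds[of p] by (auto dest: filter_leD)
  moreover have "\<forall>\<^sub>F q in at p within {0..} \<times> UNIV. q \<in> {0..} \<times> UNIV"
    by (simp add: eventually_at_topological) (auto intro: exI[of _ UNIV])
  ultimately show "\<forall>\<^sub>F q in at p within {0..} \<times> UNIV. dist (F (fst q) (snd q)) (F (fst p) (snd p)) < e"
  proof eventually_elim
    case (elim q)
    then have "\<bar>F (fst q) (snd q) - F t (snd q)\<bar> \<le> e / 4" using \<delta>(2) t by (auto simp: mem_Times_iff)
    moreover have "\<bar>F t (snd q) - F t x\<bar> < e / 4" using elim by (simp add: dist_real_def)
    ultimately show ?case using tx \<open>e > 0\<close> unfolding dist_real_def fst_conv snd_conv tx by linarith
  qed
qed

section \<open>Elements of the domain of the generator and solution curves\<close>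

context cost_semigroup
begin

lemma generator_limit_lincomb:
  assumes "\<phi> \<in> C_0" "\<psi> \<in> C_0" "generator_limit \<kappa> \<phi> u" "generator_limit \<kappa> \<psi> v"
  shows "generator_limit \<kappa> (\<lambda>x. a * \<phi> x + b * \<psi> x) (\<lambda>x. a * u x + b * v x)"
proof -
  have l: "uniform_limit UNIV (\<lambda>t x. a * ((kernel_op \<kappa> t \<phi> x - \<phi> x) / t) + b * ((kernel_op \<kappa> t \<psi> x - \<psi> x) / t))
      (\<lambda>x. a * u x + b * v x) (at_right 0)"
    using assms(3,4) unfolding generator_limit_def
    by (intro uniform_limit_add bounded_linear.uniform_limit[OF bounded_linear_mult_right])
  have lin: "kernel_op \<kappa> t (\<lambda>x. a * \<phi> x + b * \<psi> x) x = a * kernel_op \<kappa> t \<phi> x + b * kernel_op \<kappa> t \<psi> x"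
    if "t \<ge> 0" for t x
    unfolding kernel_op_def using C_b_integrable[OF kernel_borel_probs[OF that]] assms(1,2)[THEN C_0_C_b]
    by simp
  show ?thesis
    unfolding generator_limit_def
  proof (rule uniform_limitI)
    fix e :: real assume "e > 0"
    from uniform_limitD[OF l this] eventually_at_right_less[of "0 :: real"]
    show "\<forall>\<^sub>F t in at_right 0. \<forall>x\<in>UNIV. dist ((kernel_op \<kappa> t (\<lambda>x. a * \<phi> x + b * \<psi> x) x - (a * \<phi> x + b * \<psi> x)) / t)
        (a * u x + b * v x) < e"
    proof eventually_elim
      case (elim t)
      have "(kernel_op \<kappa> t (\<lambda>x. a * \<phi> x + b * \<psi> x) x - (a * \<phi> x + b * \<psi> x)) / t
        = a * ((kernel_op \<kappa> t \<phi> x - \<phi> x) / t) + b * ((kernel_op \<kappa> t \<psi> x - \<psi> x) / t)" for x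
        using elim(2) by (simp add: lin field_simps)
      then show ?case using elim(1) by (simp only:)
    qed
  qed
qed

text \<open>Uniform limits are unique, so the definite description in \<open>generator\<close> can
  be replaced by the relation \<open>generator_limit\<close>.\<close>

lemma generator_eq_Some: "generator \<kappa> \<phi> = Some \<psi> \<longleftrightarrow> \<phi> \<in> C_0 \<and> generator_limit \<kappa> \<phi> \<psi>"
proof -
  have uniq: "u = v" if "generator_limit \<kappa> \<phi> u" "generator_limit \<kappa> \<phi> v" for u v
  proof
    fix x
    have "((\<lambda>t. (kernel_op \<kappa> t \<phi> x - \<phi> x) / t) \<longlongrightarrow> u x) (at_right 0)"
      "((\<lambda>t. (kernel_op \<kappa> t \<phi> x - \<phi> x) / t) \<longlongrightarrow> v x) (at_right 0)"
      using that unfolding generator_limit_def by (auto intro: tendsto_uniform_limitI)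
    then show "u x = v x" by (rule tendsto_unique[rotated]) simp
  qed
  have the: "(THE \<psi>. generator_limit \<kappa> \<phi> \<psi>) = u" if "generator_limit \<kappa> \<phi> u" for u
    using that uniq by (intro the_equality)
  show ?thesis
    unfolding generator_def using the by auto
qed

text \<open>Averaging over a short time maps \<open>C_0\<close> into the domain of the generator.\<close>

definition smoothing :: "real \<Rightarrow> ('a \<Rightarrow> real) \<Rightarrow> 'a \<Rightarrow> real" where
  "smoothing \<rho> h x = 1 / \<rho> * orbit_integral 0 h \<rho> x"

lemma smoothing_C_0: "\<rho> > 0 \<Longrightarrow> h \<in> C_0 \<Longrightarrow> smoothing \<rho> h \<in> C_0"
  unfolding smoothing_def[abs_def] by (intro C_0_scale orbit_integral_C_0) auto

lemma smoothing_approx: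
  assumes "h \<in> C_0" "\<epsilon> > 0"
  obtains \<rho> where "\<rho> > 0" "\<And>x. \<bar>smoothing \<rho> h x - h x\<bar> < \<epsilon>"
proof -
  have "\<forall>\<^sub>F r in at_right 0. \<forall>x\<in>UNIV. dist ((orbit_integral 0 h (0 + r) x - orbit_integral 0 h 0 x) / r) (orbit 0 h 0 x) < \<epsilon>"
    by (intro uniform_limitD[OF orbit_integral_quotient] assms order_refl)
  then obtain b where b: "b > 0" "\<And>r. 0 < r \<Longrightarrow> r < b \<Longrightarrow>
      \<forall>x\<in>UNIV. dist ((orbit_integral 0 h (0 + r) x - orbit_integral 0 h 0 x) / r) (orbit 0 h 0 x) < \<epsilon>"
    unfolding eventually_at_right_field by blast
  show ?thesis
  proof (rule that[of "b / 2"])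
    show "b / 2 > 0" using b by simp
    show "\<bar>smoothing (b / 2) h x - h x\<bar> < \<epsilon>" for x
    proof -
      have "smoothing (b / 2) h x = (orbit_integral 0 h (0 + b / 2) x - orbit_integral 0 h 0 x) / (b / 2)"
        by (simp add: smoothing_def orbit_integral_def[of _ _ 0])
      then show ?thesis using b(2)[of "b / 2"] b(1) assms(1) by (simp only: dist_real_def) simp
    qed
  qed
qed

text \<open>The curve \<open>U t = exp (- \<beta> t) P\<^sub>t \<phi> - (\<integral>s = 0..t. exp (- \<beta> s) P\<^sub>s f0)\<close> with \<open>\<phi>\<close> smoothed solves
  \<open>U' = A U - \<beta> U - f0\<close>, where \<open>A\<close> is the generator.\<close>

definition curve :: "real \<Rightarrow> real \<Rightarrow> ('a \<Rightarrow> real) \<Rightarrow> ('a \<Rightarrow> real) \<Rightarrow> real \<Rightarrow> 'a \<Rightarrow> real" where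
  "curve \<beta> \<rho> h f0 t x = orbit \<beta> (smoothing \<rho> h) t x - orbit_integral \<beta> f0 t x"

context
  fixes \<beta> \<rho> :: real and h f0 :: "'a \<Rightarrow> real"
  assumes beta: "\<beta> \<ge> 0" and rho: "\<rho> > 0" and h: "h \<in> C_0" and f0: "f0 \<in> C_0"
begin

lemma curve_C_0: "t \<ge> 0 \<Longrightarrow> curve \<beta> \<rho> h f0 t \<in> C_0"
  unfolding curve_def[abs_def]
  using orbit_C_0[OF _ smoothing_C_0[OF rho h]] orbit_integral_C_0[OF beta f0] by (intro C_0_diff) auto

lemma curve_continuous: "continuous_on ({0..} \<times> UNIV) (\<lambda>p. curve \<beta> \<rho> h f0 (fst p) (snd p))"
proof (rule joint_continuity)
  show "continuous_on UNIV (curve \<beta> \<rho> h f0 t)" if "t \<ge> 0" for t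
    using curve_C_0[OF that] by (rule C_0_continuous)
  fix \<epsilon> :: real assume "\<epsilon> > 0"
  then have e2: "\<epsilon> / 2 > 0" by simp
  obtain M where M: "M \<ge> 0" "\<And>x. \<bar>f0 x\<bar> \<le> M" by (rule C_0_bounded[OF f0]) (rule that)
  obtain \<delta> where \<delta>: "\<delta> > 0" "\<And>s t x. 0 \<le> s \<Longrightarrow> 0 \<le> t \<Longrightarrow> \<bar>s - t\<bar> < \<delta> \<Longrightarrow>
      \<bar>orbit \<beta> (smoothing \<rho> h) s x - orbit \<beta> (smoothing \<rho> h) t x\<bar> \<le> \<epsilon> / 2"
    by (rule orbit_equicontinuous[OF beta smoothing_C_0[OF rho h] e2]) (rule that)
  define \<eta> where "\<eta> = \<epsilon> / 2 / (M + 1)"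
  have \<eta>: "\<eta> > 0" "M * \<eta> \<le> \<epsilon> / 2" using \<open>\<epsilon> > 0\<close> M(1) by (auto simp: \<eta>_def field_simps)
  show "\<exists>\<delta>>0. \<forall>s t x. 0 \<le> s \<longrightarrow> 0 \<le> t \<longrightarrow> \<bar>s - t\<bar> < \<delta> \<longrightarrow> \<bar>curve \<beta> \<rho> h f0 s x - curve \<beta> \<rho> h f0 t x\<bar> \<le> \<epsilon>"
  proof (intro exI[of _ "min \<delta> \<eta>"] conjI allI impI)
    show "min \<delta> \<eta> > 0" using \<delta> \<eta> by simp
    fix s t x assume st: "0 \<le> s" "0 \<le> t" "\<bar>s - t\<bar> < min \<delta> \<eta>"
    have "\<bar>orbit_integral \<beta> f0 s x - orbit_integral \<beta> f0 t x\<bar> \<le> M * \<bar>s - t\<bar>"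
      by (rule orbit_integral_lipschitz[OF beta f0 M(2) st(1,2)])
    also have "\<dots> \<le> M * \<eta>" using st M by (intro mult_left_mono) auto
    finally have "\<bar>orbit_integral \<beta> f0 s x - orbit_integral \<beta> f0 t x\<bar> \<le> \<epsilon> / 2" using \<eta> by simp
    moreover have "\<bar>orbit \<beta> (smoothing \<rho> h) s x - orbit \<beta> (smoothing \<rho> h) t x\<bar> \<le> \<epsilon> / 2"
      using st by (intro \<delta>(2)) auto
    ultimately show "\<bar>curve \<beta> \<rho> h f0 s x - curve \<beta> \<rho> h f0 t x\<bar> \<le> \<epsilon>" unfolding curve_def by linarith
  qed
qed

text \<open>The orbit of a short average is a difference of two undiscounted time integrals. Each
  lies in the domain of the generator and is differentiable in time, which the orbit of
  \<open>h\<close> itself need not be.\<close>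

lemma orbit_smoothing:
  assumes "t \<ge> 0"
  shows "orbit \<beta> (smoothing \<rho> h) t x = exp (- \<beta> * t) / \<rho> * (orbit_integral 0 h (\<rho> + t) x - orbit_integral 0 h t x)"
proof -
  have "kernel_op \<kappa> t (smoothing \<rho> h) x = 1 / \<rho> * kernel_op \<kappa> t (orbit_integral 0 h \<rho>) x"
    by (simp add: kernel_op_def smoothing_def[abs_def])
  also have "kernel_op \<kappa> t (orbit_integral 0 h \<rho>) x = orbit_integral 0 h (\<rho> + t) x - orbit_integral 0 h t x"
    using kernel_op_orbit_integral[OF order_refl h assms, of \<rho> x] rho by simp
  finally show ?thesis by (simp add: orbit_def)
qed

lemma curve_generator:
  assumes "t > 0"
  obtains V where "generator_limit \<kappa> (curve \<beta> \<rho> h f0 t) V"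
    "\<And>x. ((\<lambda>t. curve \<beta> \<rho> h f0 t x) has_real_derivative V x - \<beta> * curve \<beta> \<rho> h f0 t x - f0 x) (at t)"
proof -
  have t: "t \<ge> 0" "\<rho> + t \<ge> 0" "\<rho> + t > 0" using assms rho by auto
  let ?J = "orbit_integral 0 h" and ?E = "exp (- \<beta> * t) / \<rho>"
  have C: "?J s \<in> C_0" if "s \<ge> 0" for s using orbit_integral_C_0[OF order_refl h that] .
  \<comment> \<open>The coefficients 1, -1 and the rate 0 are kept visible so that the expression
    matches linear combinations of time integrals: rate 0 for the smoothed \<open>h\<close>, rate
    \<open>\<beta>\<close> for \<open>f0\<close>.\<close>
  define V where "V x = ?E * (1 * (0 * ?J (\<rho> + t) x + orbit 0 h (\<rho> + t) x - h x)
      + (- 1) * (0 * ?J t x + orbit 0 h t x - h x))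
      + (- 1) * (\<beta> * orbit_integral \<beta> f0 t x + orbit \<beta> f0 t x - f0 x)" for x
  have "generator_limit \<kappa> (\<lambda>x. ?E * (1 * ?J (\<rho> + t) x + (- 1) * ?J t x) + (- 1) * orbit_integral \<beta> f0 t x) V"
    unfolding V_def[abs_def]
    by (intro generator_limit_lincomb generator_limit_orbit_integral C_0_add C_0_scale C
        orbit_integral_C_0 order_refl beta h f0 t)
  moreover have "(\<lambda>x. ?E * (1 * ?J (\<rho> + t) x + (- 1) * ?J t x) + (- 1) * orbit_integral \<beta> f0 t x)
      = curve \<beta> \<rho> h f0 t"
    by (simp add: curve_def fun_eq_iff orbit_smoothing[OF t(1)])
  ultimately have gen: "generator_limit \<kappa> (curve \<beta> \<rho> h f0 t) V" by simp
  have "((\<lambda>t. curve \<beta> \<rho> h f0 t x) has_real_derivative V x - \<beta> * curve \<beta> \<rho> h f0 t x - f0 x) (at t)" for x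
  proof -
    have d1: "((\<lambda>t. ?J (\<rho> + t) x) has_real_derivative orbit 0 h (\<rho> + t) x * 1) (at t)"
      by (rule DERIV_chain2[where f = "\<lambda>t. ?J t x" and g = "\<lambda>t. \<rho> + t"])
        (auto intro!: derivative_eq_intros orbit_integral_DERIV[OF order_refl h t(3)])
    have d2: "((\<lambda>t. ?J t x) has_real_derivative orbit 0 h t x) (at t)"
      by (rule orbit_integral_DERIV[OF order_refl h assms])
    have d3: "((\<lambda>t. orbit_integral \<beta> f0 t x) has_real_derivative orbit \<beta> f0 t x) (at t)"
      by (rule orbit_integral_DERIV[OF beta f0 assms])
    have d0: "((\<lambda>t. exp (- \<beta> * t) / \<rho>) has_real_derivative - \<beta> * ?E) (at t)"
      using rho by (auto intro!: derivative_eq_intros)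
    have "((\<lambda>t. exp (- \<beta> * t) / \<rho> * (?J (\<rho> + t) x - ?J t x) - orbit_integral \<beta> f0 t x) has_real_derivative
        (- \<beta> * ?E * (?J (\<rho> + t) x - ?J t x) + (orbit 0 h (\<rho> + t) x * 1 - orbit 0 h t x) * ?E) - orbit \<beta> f0 t x) (at t)"
      by (intro DERIV_diff DERIV_mult d0 d1 d2 d3)
    also have "(- \<beta> * ?E * (?J (\<rho> + t) x - ?J t x) + (orbit 0 h (\<rho> + t) x * 1 - orbit 0 h t x) * ?E) - orbit \<beta> f0 t x
        = V x - \<beta> * curve \<beta> \<rho> h f0 t x - f0 x"
      unfolding curve_def orbit_smoothing[OF t(1)] V_def by (simp add: algebra_simps)
    finally show ?thesis
    proof (rule has_field_derivative_transform_within_open[of _ _ _ "{0<..}"])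
      show "exp (- \<beta> * s) / \<rho> * (?J (\<rho> + s) x - ?J s x) - orbit_integral \<beta> f0 s x = curve \<beta> \<rho> h f0 s x"
        if "s \<in> {0<..}" for s
        using that by (simp add: curve_def orbit_smoothing)
    qed (use assms in auto)
  qed
  with gen show ?thesis by (rule that)
qed

end

end

section \<open>The comparison principle\<close>

text \<open>The time integral of the discounted orbit of the constant 1, which the
  \<open>C_0\<close> theory cannot supply in general; it accounts for the constant \<open>k\<close>
  added to \<open>f\<close> and \<open>g\<close>.\<close>

definition discount :: "real \<Rightarrow> real \<Rightarrow> real" where
  "discount \<beta> t = integral {0..t} (\<lambda>s. exp (- \<beta> * s))"

lemma discount_zero [simp]: "discount \<beta> 0 = 0"
  by (simp add: discount_def)

lemma discount_DERIV: "t > 0 \<Longrightarrow> (discount \<beta> has_real_derivative exp (- \<beta> * t)) (at t)"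
proof -
  assume t: "t > 0"
  have "((\<lambda>t. integral {0..t} (\<lambda>s. exp (- \<beta> * s))) has_real_derivative exp (- \<beta> * t)) (at t within {0..t + 1})"
    using t by (intro integral_has_real_derivative continuous_intros) auto
  moreover have "at t within {0..t + 1} = at t"
    using t by (intro at_within_interior) (simp add: interior_atLeastAtMost_real)
  ultimately show ?thesis by (simp add: discount_def[abs_def])
qed

lemma discount_eq:
  assumes "t \<ge> 0"
  shows "\<beta> * discount \<beta> t = 1 - exp (- \<beta> * t)"
proof -
  have "((\<lambda>s. \<beta> * exp (- \<beta> * s)) has_integral (- exp (- \<beta> * t) - - exp (- \<beta> * 0))) {0..t}"
    by (rule fundamental_theorem_of_calculus[OF assms])
      (auto intro!: derivative_eq_intros simp: has_real_derivative_iff_has_vector_derivative[symmetric])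
  then show ?thesis by (simp add: integral_unique discount_def flip: integral_mult_right)
qed

lemma discount_bounds:
  assumes "\<beta> \<ge> 0" "t \<ge> 0"
  shows "0 \<le> discount \<beta> t" "discount \<beta> t \<le> t"
proof -
  show "0 \<le> discount \<beta> t"
    unfolding discount_def by (intro integral_nonneg integrable_continuous_real continuous_intros) auto
  have "\<bar>discount \<beta> t\<bar> \<le> 1 * (t - 0)"
    unfolding discount_def using assms by (intro integral_abs_le continuous_intros) auto
  then show "discount \<beta> t \<le> t" by simp
qed

lemma discount_continuous: "continuous_on {0..T} (discount \<beta>)"
  unfolding discount_def by (intro indefinite_integral_continuous_1 integrable_continuous_real continuous_intros)

text \<open>The minimum of \<open>f + k\<close> with a multiple of a cutoff function lies in
  \<open>C_0\<close>. The multiple \<open>M\<close> bounds \<open>f + k\<close> on \<open>S\<close>,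
  where the cutoff is at least 1, so nothing is lost there.\<close>

lemma (in cost_space) truncation_on_compact:
  assumes "compact (S :: 'a set)" "continuous_on UNIV f" "\<And>x. - k \<le> f x"
  obtains f0 where "f0 \<in> C_0" "\<And>x. 0 \<le> f0 x" "\<And>x. f0 x \<le> f x + k" "\<And>x. x \<in> S \<Longrightarrow> f0 x = f x + k"
proof -
  have cont: "continuous_on UNIV (\<lambda>x. f x + k)" by (intro continuous_intros assms)
  obtain M where M: "M \<ge> 0" "\<And>x. x \<in> S \<Longrightarrow> \<bar>f x + k\<bar> \<le> M"
    by (rule continuous_attains_bound[OF assms(1) cont]) (rule that)
  obtain \<theta> where \<theta>: "\<theta> \<in> C_0" "\<And>x. 0 \<le> \<theta> x" "\<And>x. x \<in> S \<Longrightarrow> 1 \<le> \<theta> x"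
    by (rule compact_cutoff[OF assms(1)]) (rule that)
  have nn: "0 \<le> f x + k" for x using assms(3)[of x] by simp
  show ?thesis
  proof (rule that[of "\<lambda>x. min (f x + k) (M * \<theta> x)"])
    show "(\<lambda>x. min (f x + k) (M * \<theta> x)) \<in> C_0"
      by (rule C_0_dominated[OF C_0_scale[OF \<theta>(1), of M]])
        (use nn \<theta> M in \<open>auto intro!: continuous_intros assms C_0_continuous[OF \<theta>(1)]\<close>)
    show "0 \<le> min (f x + k) (M * \<theta> x)" for x using nn \<theta>(2) M(1) by simp
    show "min (f x + k) (M * \<theta> x) = f x + k" if "x \<in> S" for x
      using M(2)[OF that] mult_left_mono[OF \<theta>(3)[OF that] M(1)] by auto
  qed simp
qed

context cost_semigroup
begin

lemma orbit_integral_nonneg: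
  assumes "\<beta> \<ge> 0" "f0 \<in> C_0" "\<And>x. 0 \<le> f0 x"
  shows "0 \<le> orbit_integral \<beta> f0 t x"
proof -
  have "0 \<le> orbit \<beta> f0 s x" for s
    unfolding orbit_def kernel_op_def
    using assms(3) by (intro mult_nonneg_nonneg Bochner_Integration.integral_nonneg) auto
  then show ?thesis
    unfolding orbit_integral_def
    by (intro integral_nonneg integrable_continuous_real continuous_on_orbit_subset assms) auto
qed

text \<open>The time integral of \<open>f0\<close> is nonnegative and may be dropped. Everywhere,
  the discounted semigroup preserves the bound \<open>N\<close> on the shifted function; where the
  orbit itself is below 1, the shift contributes at least \<open>a * exp (- \<beta> * T)\<close>
  downwards.\<close>

lemma curve_bounds:
  assumes beta: "\<beta> \<ge> 0" and rho: "\<rho> > 0" and h: "h \<in> C_0" and f0: "f0 \<in> C_0" "\<And>x. 0 \<le> f0 x"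
    and N: "N \<ge> 0" "\<And>x. smoothing \<rho> h x - a \<le> N" and a: "a \<ge> 0" and k: "k \<ge> 0"
    and t: "t \<in> {0..T}"
  shows "curve \<beta> \<rho> h f0 t x - a * exp (- \<beta> * t) + k * discount \<beta> t \<le> N + k * T"
    and "orbit \<beta> (smoothing \<rho> h) t x < 1 \<Longrightarrow>
      curve \<beta> \<rho> h f0 t x - a * exp (- \<beta> * t) + k * discount \<beta> t \<le> 1 - a * exp (- \<beta> * T) + k * T"
proof -
  let ?\<phi> = "smoothing \<rho> h"
  have J: "0 \<le> orbit_integral \<beta> f0 t x" by (rule orbit_integral_nonneg[OF beta f0])
  have "discount \<beta> t \<le> T" using discount_bounds[OF beta, of t] t by auto
  then have kT: "k * discount \<beta> t \<le> k * T" using k by (rule mult_left_mono)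
  have "kernel_op \<kappa> t ?\<phi> x \<le> N + a"
    unfolding kernel_op_def
  proof (rule borel_probs_integral_le[OF kernel_borel_probs])
    show "integrable (\<kappa> t x) ?\<phi>"
      using t by (intro C_b_integrable kernel_borel_probs C_0_C_b smoothing_C_0 rho h) auto
    show "?\<phi> y \<le> N + a" for y using N(2)[of y] by simp
  qed (use t in auto)
  then have "exp (- \<beta> * t) * (kernel_op \<kappa> t ?\<phi> x - a) \<le> exp (- \<beta> * t) * N"
    by (intro mult_left_mono) auto
  also have "\<dots> \<le> 1 * N" using beta t N(1) by (intro mult_right_mono) auto
  finally have "orbit \<beta> ?\<phi> t x - a * exp (- \<beta> * t) \<le> N" by (simp add: orbit_def algebra_simps)
  then show "curve \<beta> \<rho> h f0 t x - a * exp (- \<beta> * t) + k * discount \<beta> t \<le> N + k * T"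
    using J kT unfolding curve_def by linarith
  assume "orbit \<beta> ?\<phi> t x < 1"
  moreover have "a * exp (- \<beta> * T) \<le> a * exp (- \<beta> * t)"
    using beta t a by (intro mult_left_mono) (auto intro: mult_left_mono)
  ultimately show "curve \<beta> \<rho> h f0 t x - a * exp (- \<beta> * t) + k * discount \<beta> t \<le> 1 - a * exp (- \<beta> * T) + k * T"
    using J kT unfolding curve_def by linarith
qed

end

text \<open>The conditions of \<open>G_c0\<close>, read on the kernels instead of the
  generator.\<close>

locale P_c_semigroup = cost_semigroup c K \<kappa> for c :: "'a::topological_space \<Rightarrow> 'a \<Rightarrow> real" and K \<kappa> +
  assumes bind_P_c: "\<mu> \<in> P_c c \<Longrightarrow> t \<ge> 0 \<Longrightarrow> \<mu> \<bind> \<kappa> t \<in> P_c c"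
    and bind_continuous: "\<mu> \<in> P_c c \<Longrightarrow> t \<ge> 0 \<Longrightarrow>
      ((\<lambda>s. transport_cost c (\<mu> \<bind> \<kappa> s) (\<mu> \<bind> \<kappa> t)) \<longlongrightarrow> 0) (at t within {0..})"

locale two_semigroups = A: P_c_semigroup c K \<kappa> + B: P_c_semigroup c K \<kappa>'
  for c :: "'a::topological_space \<Rightarrow> 'a \<Rightarrow> real" and K \<kappa> \<kappa>'
begin

text \<open>Condition (e), with the values of the generators given by the relation
  \<open>generator_limit\<close> instead of partial maps.\<close>

definition infinitesimal_bound :: "real \<Rightarrow> ('a \<Rightarrow> real) \<Rightarrow> ('a \<Rightarrow> real) \<Rightarrow> bool" where
  "infinitesimal_bound \<beta> f g \<longleftrightarrow> (\<forall>\<phi> \<psi> U V x0 y0. \<phi> \<in> C_0 \<longrightarrow> \<psi> \<in> C_0 \<longrightarrow>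
     generator_limit \<kappa> \<phi> U \<longrightarrow> generator_limit \<kappa>' \<psi> V \<longrightarrow>
     (\<forall>x y. c x0 y0 - \<phi> x0 - \<psi> y0 \<le> c x y - \<phi> x - \<psi> y) \<longrightarrow>
     U x0 + V y0 \<le> f x0 + g y0 + \<beta> * c x0 y0)"

text \<open>At a positive maximum of \<open>w t x y = u t x + v t y - c x y\<close> the pair \<open>(u t, v t)\<close> is admissible in the
  infinitesimal bound, which gives \<open>\<partial>w/\<partial>t \<le> - \<beta> w\<close> there. The shifts \<open>a\<close> and \<open>b\<close> are taken so large that
  \<open>w \<le> 0\<close> outside a compact set; only on that set do \<open>f0\<close>, \<open>g0\<close> have to agree with \<open>f + k\<close>, \<open>g + k\<close>.\<close>

lemma smooth_comparison:
  assumes beta: "\<beta> \<ge> 0" and T: "T > 0" and k: "k \<ge> 0" and N: "N \<ge> 0"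
    and f: "continuous_on UNIV f" "\<And>x. - k \<le> f x" and g: "continuous_on UNIV g" "\<And>x. - k \<le> g x"
    and rho: "\<rho>1 > 0" "\<rho>2 > 0" and h: "h1 \<in> C_0" "h2 \<in> C_0"
    and le: "\<And>x y. A.smoothing \<rho>1 h1 x - a + (B.smoothing \<rho>2 h2 y - b) \<le> c x y"
    and leN: "\<And>x. A.smoothing \<rho>1 h1 x - a \<le> N" "\<And>y. B.smoothing \<rho>2 h2 y - b \<le> N"
    and large: "1 + 2 * k * T + N \<le> a * exp (- \<beta> * T)" "1 + 2 * k * T + N \<le> b * exp (- \<beta> * T)"
    and bound: "infinitesimal_bound \<beta> f g"
  obtains f0 g0 where "f0 \<in> C_0" "g0 \<in> C_0" "\<And>x. f0 x \<le> f x + k" "\<And>y. g0 y \<le> g y + k"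
    "\<And>x y. A.orbit \<beta> (A.smoothing \<rho>1 h1) T x - a * exp (- \<beta> * T)
        + (B.orbit \<beta> (B.smoothing \<rho>2 h2) T y - b * exp (- \<beta> * T))
      \<le> c x y + (A.orbit_integral \<beta> f0 T x - k * discount \<beta> T)
        + (B.orbit_integral \<beta> g0 T y - k * discount \<beta> T)"
proof -
  note phi = A.smoothing_C_0[OF rho(1) h(1)] and psi = B.smoothing_C_0[OF rho(2) h(2)]
  have kT: "k * T \<ge> 0" using k T by simp
  have ab: "a \<ge> 0" "b \<ge> 0"
    using large N kT zero_le_mult_iff[of a "exp (- \<beta> * T)"] zero_le_mult_iff[of b "exp (- \<beta> * T)"] by auto
  obtain S1 where S1: "compact S1" "\<And>s x. s \<in> {0..T} \<Longrightarrow> x \<notin> S1 \<Longrightarrow> \<bar>A.orbit \<beta> (A.smoothing \<rho>1 h1) s x\<bar> < 1"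
    by (rule A.orbit_equivanishing[OF beta phi zero_less_one]) (rule that)
  obtain S2 where S2: "compact S2" "\<And>s x. s \<in> {0..T} \<Longrightarrow> x \<notin> S2 \<Longrightarrow> \<bar>B.orbit \<beta> (B.smoothing \<rho>2 h2) s x\<bar> < 1"
    by (rule B.orbit_equivanishing[OF beta psi zero_less_one]) (rule that)
  obtain f0 where f0: "f0 \<in> C_0" "\<And>x. 0 \<le> f0 x" "\<And>x. f0 x \<le> f x + k" "\<And>x. x \<in> S1 \<Longrightarrow> f0 x = f x + k"
    by (rule A.truncation_on_compact[OF S1(1) f]) (rule that)
  obtain g0 where g0: "g0 \<in> C_0" "\<And>x. 0 \<le> g0 x" "\<And>x. g0 x \<le> g x + k" "\<And>x. x \<in> S2 \<Longrightarrow> g0 x = g x + k"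
    by (rule A.truncation_on_compact[OF S2(1) g]) (rule that)
  let ?U = "A.curve \<beta> \<rho>1 h1 f0" and ?V = "B.curve \<beta> \<rho>2 h2 g0"
  define u where "u t x = ?U t x - a * exp (- \<beta> * t) + k * discount \<beta> t" for t x
  define v where "v t y = ?V t y - b * exp (- \<beta> * t) + k * discount \<beta> t" for t y
  define w where "w t x y = u t x + v t y - c x y" for t x y
  note ub = A.curve_bounds[OF beta rho(1) h(1) f0(1,2) N leN(1) ab(1) k, folded u_def]
  note vb = B.curve_bounds[OF beta rho(2) h(2) g0(1,2) N leN(2) ab(2) k, folded v_def]
  \<comment> \<open>If one point is outside its compact set, its summand is at most
    \<open>1 + k * T\<close> minus the discounted shift, the other at most \<open>N + k * T\<close>.
    The constant \<open>1 + 2 * k * T + N\<close> in \<open>large\<close> cancels both.\<close>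
  have outside: "w t x y \<le> 0" if t: "t \<in> {0..T}" and xy: "\<not> (x \<in> S1 \<and> y \<in> S2)" for t x y
  proof -
    have "u t x + v t y \<le> 0"
    proof (cases "x \<in> S1")
      case True
      then have "v t y \<le> 1 - b * exp (- \<beta> * T) + k * T"
        using xy S2(2)[OF t] by (intro vb(2) t) (auto simp: abs_less_iff)
      then show ?thesis using ub(1)[OF t, of x] large(2) by linarith
    next
      case False
      then have "u t x \<le> 1 - a * exp (- \<beta> * T) + k * T"
        using S1(2)[OF t] by (intro ub(2) t) (auto simp: abs_less_iff)
      then show ?thesis using vb(1)[OF t, of y] large(1) by linarith
    qed
    then show ?thesis using A.cost_nonneg[of x y] unfolding w_def by linarith
  qed
  have start: "w 0 x y \<le> 0" for x y
    using le[of x y] phi psi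
    by (simp add: w_def u_def v_def A.curve_def B.curve_def A.orbit_integral_def B.orbit_integral_def)
  have wpos: "w T x y \<le> 0" for x y
  proof (rule ccontr)
    assume "\<not> w T x y \<le> 0"
    then have pos: "w T x y > 0" by simp
    have TT: "T \<in> {0..T}" using T by simp
    have xy: "x \<in> S1" "y \<in> S2" using outside[OF TT, of x y] pos by auto
    \<comment> \<open>Subtracting \<open>\<epsilon> * t\<close> turns the weak inequality for the
      time derivative into a strict one; this choice leaves half of the positive value at time
      \<open>T\<close>.\<close>
    define \<epsilon> where "\<epsilon> = w T x y / (2 * T)"
    have \<epsilon>: "\<epsilon> > 0" "w T x y - \<epsilon> * T > 0" using pos T by (auto simp: \<epsilon>_def field_simps)
    let ?X = "{0..T} \<times> (S1 \<times> S2)"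
    let ?F = "\<lambda>p. w (fst p) (fst (snd p)) (snd (snd p)) - \<epsilon> * fst p"
    have cu: "continuous_on ?X (\<lambda>p. ?U (fst p) (fst (snd p)))"
    proof -
      have "continuous_on ?X (\<lambda>p. (fst p, fst (snd p)))" by (intro continuous_intros)
      from continuous_on_compose2[OF A.curve_continuous[OF beta rho(1) h(1) f0(1)] this] show ?thesis
        unfolding fst_conv snd_conv by (rule meta_mp) auto
    qed
    have cv: "continuous_on ?X (\<lambda>p. ?V (fst p) (snd (snd p)))"
    proof -
      have "continuous_on ?X (\<lambda>p. (fst p, snd (snd p)))" by (intro continuous_intros)
      from continuous_on_compose2[OF B.curve_continuous[OF beta rho(2) h(2) g0(1)] this] show ?thesis
        unfolding fst_conv snd_conv by (rule meta_mp) auto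
    qed
    have cd: "continuous_on ?X (\<lambda>p. discount \<beta> (fst p))"
      by (rule continuous_on_compose2[OF discount_continuous]) (auto intro!: continuous_intros)
    have "continuous_on ?X ?F"
      unfolding w_def u_def v_def by (intro continuous_intros cu cv cd A.continuous_on_cost)
    moreover have "compact ?X" by (intro compact_Times compact_Icc S1 S2)
    moreover have "?X \<noteq> {}" using xy T by auto
    ultimately have "\<exists>p\<in>?X. \<forall>q\<in>?X. ?F q \<le> ?F p" by (intro continuous_attains_sup)
    then obtain p where p: "p \<in> ?X" "\<forall>q\<in>?X. ?F q \<le> ?F p" by (elim bexE) (rule that)
    obtain t x0 y0 where p_eq: "p = (t, x0, y0)" by (cases p) auto
    have t: "t \<in> {0..T}" and x0: "x0 \<in> S1" and y0: "y0 \<in> S2" using p(1) p_eq by auto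
    have max: "w s x' y' - \<epsilon> * s \<le> w t x0 y0 - \<epsilon> * t" if "s \<in> {0..T}" "x' \<in> S1" "y' \<in> S2" for s x' y'
      using p(2)[rule_format, of "(s, x', y')"] that by (simp add: p_eq)
    have "w t x0 y0 - \<epsilon> * t > 0" using max[OF TT xy] \<epsilon>(2) by simp
    moreover have "\<epsilon> * t \<ge> 0" using \<epsilon> t by simp
    ultimately have wt: "w t x0 y0 > 0" by simp
    then have tpos: "t > 0" using start[of x0 y0] t by (cases "t = 0") auto
    obtain FU where FU: "generator_limit \<kappa> (?U t) FU"
      "\<And>x. ((\<lambda>t. ?U t x) has_real_derivative FU x - \<beta> * ?U t x - f0 x) (at t)"
      by (rule A.curve_generator[OF beta rho(1) h(1) f0(1) tpos]) (rule that)
    obtain FV where FV: "generator_limit \<kappa>' (?V t) FV"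
      "\<And>x. ((\<lambda>t. ?V t x) has_real_derivative FV x - \<beta> * ?V t x - g0 x) (at t)"
      by (rule B.curve_generator[OF beta rho(2) h(2) g0(1) tpos]) (rule that)
    \<comment> \<open>The maximum over the compact set is global in space: at the time
      \<open>t\<close> its value is positive, and \<open>w\<close> is nonpositive elsewhere.\<close>
    have "w t x' y' \<le> w t x0 y0" for x' y'
    proof (cases "x' \<in> S1 \<and> y' \<in> S2")
      case True
      then show ?thesis using max[OF t, of x' y'] by simp
    next
      case False
      then show ?thesis using outside[OF t False] wt by linarith
    qed
    \<comment> \<open>The shifts and discounts depend on time alone and cancel, so the test
      functions are the unshifted curves, which lie in \<open>C_0\<close>.\<close>
    then have "c x0 y0 - ?U t x0 - ?V t y0 \<le> c x' y' - ?U t x' - ?V t y'" for x' y'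
      unfolding w_def u_def v_def by (smt (verit))
    moreover have "?U t \<in> C_0" "?V t \<in> C_0"
      using t by (auto intro!: A.curve_C_0 B.curve_C_0 beta rho h f0 g0)
    ultimately have gen: "FU x0 + FV y0 \<le> f x0 + g y0 + \<beta> * c x0 y0"
      using bound FU(1) FV(1) unfolding infinitesimal_bound_def by blast
    let ?E = "exp (- \<beta> * t)"
    define D where "D = (FU x0 - \<beta> * ?U t x0 - f0 x0 + \<beta> * a * ?E + k * ?E)
      + (FV y0 - \<beta> * ?V t y0 - g0 y0 + \<beta> * b * ?E + k * ?E)"
    have "((\<lambda>t. exp (- \<beta> * t)) has_real_derivative - \<beta> * ?E) (at t)"
      by (auto intro!: derivative_eq_intros)
    then have dE: "((\<lambda>t. d * exp (- \<beta> * t)) has_real_derivative d * (- \<beta> * ?E)) (at t)" for d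
      by (rule DERIV_cmult)
    have "((\<lambda>s. w s x0 y0 - \<epsilon> * s) has_real_derivative
        ((FU x0 - \<beta> * ?U t x0 - f0 x0) - a * (- \<beta> * ?E) + k * ?E
        + ((FV y0 - \<beta> * ?V t y0 - g0 y0) - b * (- \<beta> * ?E) + k * ?E) - 0) - \<epsilon> * 1) (at t)"
      unfolding w_def u_def v_def
      by (intro DERIV_diff DERIV_add FU(2) FV(2) dE DERIV_cmult discount_DERIV tpos DERIV_const DERIV_ident)
    then have deriv: "((\<lambda>s. w s x0 y0 - \<epsilon> * s) has_real_derivative D - \<epsilon>) (at t)"
      by (rule back_subst[where P = "\<lambda>D. (_ has_real_derivative D) _"]) (simp add: D_def algebra_simps)
    \<comment> \<open>The derivative of \<open>k * discount \<beta> t\<close> and its damping by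
      \<open>\<beta>\<close> add up to exactly \<open>k\<close>. This cancels the \<open>k\<close>
      in \<open>f0 x0 = f x0 + k\<close>, and likewise for \<open>g0\<close>.\<close>
    have kd: "\<beta> * (k * discount \<beta> t) = k - k * ?E"
      using discount_eq[of t \<beta>] t by (simp add: mult.left_commute[of \<beta> k] right_diff_distrib)
    have "D = FU x0 + FV y0 - f x0 - g y0 - \<beta> * (u t x0 + v t y0)"
      using kd f0(4)[OF x0] g0(4)[OF y0] unfolding D_def u_def v_def by (simp add: algebra_simps)
    then have "D \<le> - (\<beta> * w t x0 y0)"
      using gen unfolding w_def by (simp add: algebra_simps)
    also have "\<dots> \<le> 0" using beta wt by simp
    finally have "D - \<epsilon> < 0" using \<epsilon> by simp
    \<comment> \<open>Only the left derivative is used: slightly earlier times remain in the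
      interval even if \<open>t = T\<close>, and there the value would be larger than the
      maximum.\<close>
    then obtain d where d: "d > 0" "\<And>r. 0 < r \<Longrightarrow> r < d \<Longrightarrow> w t x0 y0 - \<epsilon> * t < w (t - r) x0 y0 - \<epsilon> * (t - r)"
      using DERIV_neg_dec_left[OF deriv] by auto
    define r where "r = min d t / 2"
    have r: "0 < r" "r < d" "r < t" using d(1) tpos by (auto simp: r_def min_def)
    have "w (t - r) x0 y0 - \<epsilon> * (t - r) \<le> w t x0 y0 - \<epsilon> * t"
      using r t by (intro max x0 y0) auto
    then show False using d(2)[OF r(1,2)] by simp
  qed
  show ?thesis
  proof (rule that[OF f0(1) g0(1) f0(3) g0(3)])
    fix x y
    show "A.orbit \<beta> (A.smoothing \<rho>1 h1) T x - a * exp (- \<beta> * T)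
        + (B.orbit \<beta> (B.smoothing \<rho>2 h2) T y - b * exp (- \<beta> * T))
      \<le> c x y + (A.orbit_integral \<beta> f0 T x - k * discount \<beta> T)
        + (B.orbit_integral \<beta> g0 T y - k * discount \<beta> T)"
      using wpos[of x y] unfolding w_def u_def v_def A.curve_def B.curve_def by linarith
  qed
qed

end

section \<open>Semigroups on \<open>P_c\<close>\<close>

lemma C_bc_abs: "f \<in> C_bc c \<Longrightarrow> (\<lambda>x. \<bar>f x\<bar>) \<in> C_bc c"
  by (auto simp: C_bc_def intro!: continuous_intros)

lemma C_bc_max:
  assumes "f \<in> C_bc c" "\<And>x y. 0 \<le> c x y"
  shows "(\<lambda>x. max (f x) a) \<in> C_bc c"
proof -
  obtain z M0 M1 where M: "0 \<le> M0" "0 \<le> M1" "\<And>x. \<bar>f x\<bar> \<le> M0 + M1 * c z x"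
    using assms(1) by (auto simp: C_bc_def)
  have "\<bar>max (f x) a\<bar> \<le> (M0 + \<bar>a\<bar>) + M1 * c z x" for x
    using M(3)[of x] mult_nonneg_nonneg[OF M(2) assms(2)[of z x]] by (auto simp: max_def abs_le_iff)
  moreover have "0 \<le> M0 + \<bar>a\<bar>" using M(1) by simp
  ultimately have "\<exists>z M0 M1. 0 \<le> M0 \<and> 0 \<le> M1 \<and> (\<forall>x. \<bar>max (f x) a\<bar> \<le> M0 + M1 * c z x)"
    using M(2) by (intro exI[of _ z] exI[of _ "M0 + \<bar>a\<bar>"] exI[of _ M1]) simp
  moreover have "continuous_on UNIV (\<lambda>x. max (f x) a)"
    using C_bc_continuous[OF assms(1)] by (intro continuous_intros)
  ultimately show ?thesis by (simp add: C_bc_def)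
qed

context P_c_semigroup
begin

lemma dirac_bind: "t \<ge> 0 \<Longrightarrow> dirac x \<bind> \<kappa> t = \<kappa> t x"
  by (rule bind_return[OF measurable_kernel]) auto

lemma kernel_P_c: "t \<ge> 0 \<Longrightarrow> \<kappa> t x \<in> P_c c"
  using bind_P_c[OF dirac_P_c, of t x] by (simp add: dirac_bind)

lemma kernel_op_abs_le:
  assumes "t \<ge> 0" "f \<in> C_bc c" "f' \<in> borel_measurable borel" "\<And>x. \<bar>f' x\<bar> \<le> f x"
  shows "\<bar>kernel_op \<kappa> t f' x\<bar> \<le> kernel_op \<kappa> t f x"
proof -
  have i: "integrable (\<kappa> t x) f" by (rule C_bc_integrable[OF kernel_P_c[OF assms(1)] assms(2)])
  have i': "integrable (\<kappa> t x) f'"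
    by (rule Bochner_Integration.integrable_bound[OF i])
      (use assms(3,4) borel_probs_measurable[OF kernel_borel_probs[OF assms(1)]] in
        \<open>auto intro!: AE_I2 order_trans[OF assms(4)]\<close>)
  have "\<bar>kernel_op \<kappa> t f' x\<bar> \<le> (\<integral>y. \<bar>f' y\<bar> \<partial>\<kappa> t x)" unfolding kernel_op_def by (rule integral_abs_bound)
  also have "\<dots> \<le> kernel_op \<kappa> t f x" unfolding kernel_op_def by (intro integral_mono integrable_abs i i' assms)
  finally show ?thesis .
qed

lemma integral_bind_C_bc:
  assumes "\<mu> \<in> P_c c" "t \<ge> 0" "f \<in> C_bc c"
  shows "integrable \<mu> (kernel_op \<kappa> t f)" "(\<integral>y. f y \<partial>(\<mu> \<bind> \<kappa> t)) = (\<integral>x. kernel_op \<kappa> t f x \<partial>\<mu>)"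
  using assms
  by (auto intro!: integral_bind_kernel P_c_borel_probs C_bc_measurable C_bc_integrable[OF bind_P_c])

text \<open>Here \<open>f\<close> is unbounded, so sup-norm continuity does not apply. The integral
  is that of \<open>f\<close> against the evolved measure, which moves continuously in transport
  cost.\<close>

lemma integral_kernel_op_continuous:
  assumes "\<mu> \<in> P_c c" "f \<in> C_bc c"
  shows "continuous_on {0..} (\<lambda>s. \<integral>x. kernel_op \<kappa> s f x \<partial>\<mu>)"
proof -
  have "continuous_on {0..} (\<lambda>s. \<integral>y. f y \<partial>(\<mu> \<bind> \<kappa> s))"
    unfolding continuous_on_def
  proof
    fix t :: real assume "t \<in> {0..}"
    then have t: "t \<ge> 0" by simp
    have "\<forall>\<^sub>F s in at t within {0..}. s \<in> {0..}"
      by (simp add: eventually_at_topological) (auto intro: exI[of _ UNIV])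
    then have "\<forall>\<^sub>F s in at t within {0..}. \<mu> \<bind> \<kappa> s \<in> P_c c"
      by eventually_elim (simp add: bind_P_c assms)
    then show "((\<lambda>s. \<integral>y. f y \<partial>(\<mu> \<bind> \<kappa> s)) \<longlongrightarrow> (\<integral>y. f y \<partial>(\<mu> \<bind> \<kappa> t))) (at t within {0..})"
      by (intro tendsto_integral_C_bc bind_P_c assms t bind_continuous)
  qed
  then show ?thesis
    by (rule continuous_on_eq) (simp add: integral_bind_C_bc assms)
qed

lemma kernel_op_measurable:
  assumes "t \<ge> 0" "f \<in> borel_measurable borel"
  shows "kernel_op \<kappa> t f \<in> borel_measurable borel"
  using measurable_compose[OF measurable_kernel[OF assms(1)] integral_measurable_subprob_algebra[OF assms(2)]]
  by (simp add: kernel_op_def[abs_def])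

lemma kernel_op_continuous_time:
  assumes "f \<in> C_bc c"
  shows "continuous_on {0..} (\<lambda>s. kernel_op \<kappa> s f x)"
proof (rule continuous_on_eq[OF integral_kernel_op_continuous[OF dirac_P_c assms]])
  fix s :: real assume "s \<in> {0..}"
  then show "(\<integral>y. kernel_op \<kappa> s f y \<partial>dirac x) = kernel_op \<kappa> s f x"
    by (intro integral_return kernel_op_measurable C_bc_measurable[OF assms]) auto
qed

lemma orbit_continuous_time: "f \<in> C_bc c \<Longrightarrow> continuous_on {0..t} (\<lambda>s. orbit \<beta> f s x)"
  unfolding orbit_def
  by (intro continuous_intros continuous_on_subset[OF kernel_op_continuous_time]) auto

lemma time_integral_eq_orbit_integral:
  assumes "f \<in> C_bc c"
  shows "(LINT s:{0..t}|lborel. exp (\<beta> * (t - s)) * kernel_op \<kappa> s f x) = exp (\<beta> * t) * orbit_integral \<beta> f t x"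
proof -
  have eq: "exp (\<beta> * (t - s)) * kernel_op \<kappa> s f x = exp (\<beta> * t) * orbit \<beta> f s x" for s
    unfolding orbit_def mult.assoc[symmetric] exp_add[symmetric] by (simp add: algebra_simps)
  have "(LINT s:{0..t}|lborel. exp (\<beta> * t) * orbit \<beta> f s x) = exp (\<beta> * t) * (LINT s:{0..t}|lborel. orbit \<beta> f s x)"
    by simp
  then show ?thesis
    using set_integral_eq_integral[OF orbit_continuous_time[OF assms]] by (simp add: eq orbit_integral_def)
qed

text \<open>Joint measurability of the kernel permits the exchange. Absolute integrability holds
  because the integrals of \<open>\<bar>f\<bar>\<close> against the evolved measures are continuous
  in time, hence integrable on \<open>{0..t}\<close>.\<close>

lemma orbit_integral_Fubini:
  assumes \<mu>: "\<mu> \<in> P_c c" and f: "f \<in> C_bc c" and "t \<ge> 0"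
  shows "integrable \<mu> (orbit_integral \<beta> f t)"
    "(\<integral>x. orbit_integral \<beta> f t x \<partial>\<mu>) = (LINT s:{0..t}|lborel. exp (- \<beta> * s) * (\<integral>x. kernel_op \<kappa> s f x \<partial>\<mu>))"
proof -
  note \<mu>b = P_c_borel_probs[OF \<mu>]
  interpret M: prob_space \<mu> by (rule borel_probsD[OF \<mu>b])
  interpret P: pair_sigma_finite lborel \<mu> ..
  have sets_eq: "sets (lborel \<Otimes>\<^sub>M \<mu>) = sets (borel \<Otimes>\<^sub>M borel)"
    using borel_probsD(2)[OF \<mu>b] by (intro sets_pair_measure_cong) auto
  define F where "F s y = indicator {0..t} s *\<^sub>R orbit \<beta> f s y" for s y
  have meas: "case_prod F \<in> borel_measurable (lborel \<Otimes>\<^sub>M \<mu>)"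
    using measurable_orbit[OF C_bc_measurable[OF f]]
    by (simp add: measurable_cong_sets[OF sets_eq refl] F_def[abs_def])
  have F_int: "integrable \<mu> (F s)" for s
  proof (cases "s \<in> {0..t}")
    case True
    then show ?thesis
      using integral_bind_C_bc(1)[OF \<mu> _ f, of s] by (simp add: F_def[abs_def] orbit_def)
  qed (simp add: F_def[abs_def])
  let ?B = "\<lambda>s. exp (- \<beta> * s) * (\<integral>x. kernel_op \<kappa> s (\<lambda>x. \<bar>f x\<bar>) x \<partial>\<mu>)"
  have "integrable (lborel \<Otimes>\<^sub>M \<mu>) (case_prod F)"
  proof (rule P.Fubini_integrable[OF meas])
    have "continuous_on {0..t} ?B"
      using integral_kernel_op_continuous[OF \<mu> C_bc_abs[OF f]]
      by (intro continuous_intros) (auto elim: continuous_on_subset)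
    then have B: "integrable lborel (\<lambda>s. indicator {0..t} s *\<^sub>R ?B s)"
      using borel_integrable_atLeastAtMost' unfolding set_integrable_def by blast
    show "integrable lborel (\<lambda>s. \<integral>y. norm (case_prod F (s, y)) \<partial>\<mu>)"
    proof (rule Bochner_Integration.integrable_bound[OF B])
      show "(\<lambda>s. \<integral>y. norm (case_prod F (s, y)) \<partial>\<mu>) \<in> borel_measurable lborel"
        using meas by (intro M.borel_measurable_lebesgue_integral) (simp add: case_prod_unfold)
      show "AE s in lborel. norm (\<integral>y. norm (case_prod F (s, y)) \<partial>\<mu>) \<le> norm (indicator {0..t} s *\<^sub>R ?B s)"
      proof (rule AE_I2)
        fix s :: real
        show "norm (\<integral>y. norm (case_prod F (s, y)) \<partial>\<mu>) \<le> norm (indicator {0..t} s *\<^sub>R ?B s)"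
        proof (cases "s \<in> {0..t}")
          case True
          then have s: "s \<ge> 0" by simp
          have "(\<integral>y. norm (case_prod F (s, y)) \<partial>\<mu>) \<le> (\<integral>y. exp (- \<beta> * s) * kernel_op \<kappa> s (\<lambda>x. \<bar>f x\<bar>) y \<partial>\<mu>)"
          proof (rule integral_mono)
            show "integrable \<mu> (\<lambda>y. norm (case_prod F (s, y)))" using F_int[of s] by simp
            show "integrable \<mu> (\<lambda>y. exp (- \<beta> * s) * kernel_op \<kappa> s (\<lambda>x. \<bar>f x\<bar>) y)"
              using integral_bind_C_bc(1)[OF \<mu> s C_bc_abs[OF f]] by simp
            show "norm (case_prod F (s, y)) \<le> exp (- \<beta> * s) * kernel_op \<kappa> s (\<lambda>x. \<bar>f x\<bar>) y" for y
              using kernel_op_abs_le[OF s C_bc_abs[OF f] C_bc_measurable[OF f], of y] True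
              by (simp add: F_def orbit_def abs_mult mult_left_mono)
          qed
          moreover have "0 \<le> (\<integral>y. norm (case_prod F (s, y)) \<partial>\<mu>)" by simp
          ultimately show ?thesis using True by simp
        qed (simp add: F_def)
      qed
    qed
    show "AE s in lborel. integrable \<mu> (\<lambda>y. case_prod F (s, y))"
      using F_int by simp
  qed
  then have int: "integrable (lborel \<Otimes>\<^sub>M \<mu>) (case_prod F)" .
  have J: "orbit_integral \<beta> f t x = (\<integral>s. F s x \<partial>lborel)" for x
    using set_integral_eq_integral[OF orbit_continuous_time[OF f], of t \<beta> x]
    by (simp add: F_def orbit_integral_def set_lebesgue_integral_def)
  have "integrable \<mu> (\<lambda>x. \<integral>s. F s x \<partial>lborel)" by (rule P.integrable_snd[OF int])
  then show "integrable \<mu> (orbit_integral \<beta> f t)" using J by (simp add: fun_eq_iff cong: Bochner_Integration.integrable_cong)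
  have "(\<integral>x. orbit_integral \<beta> f t x \<partial>\<mu>) = (\<integral>s. (\<integral>x. F s x \<partial>\<mu>) \<partial>lborel)"
    unfolding J by (rule P.Fubini_integral[OF int])
  then show "(\<integral>x. orbit_integral \<beta> f t x \<partial>\<mu>) = (LINT s:{0..t}|lborel. exp (- \<beta> * s) * (\<integral>x. kernel_op \<kappa> s f x \<partial>\<mu>))"
    by (simp add: F_def orbit_def set_lebesgue_integral_def)
qed

text \<open>Dominated convergence, once in space and once in time; truncating below at
  \<open>- real n\<close> never increases the absolute value.\<close>

lemma orbit_integral_truncation_limit:
  assumes f: "f \<in> C_bc c"
  shows "(\<lambda>n. orbit_integral \<beta> (\<lambda>x. max (f x) (- real n)) t x) \<longlonglongrightarrow> orbit_integral \<beta> f t x"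
proof -
  let ?f = "\<lambda>n x. max (f x) (- real n)"
  have fn: "?f n \<in> C_bc c" for n by (rule C_bc_max[OF f cost_nonneg])
  have bd: "\<bar>?f n x\<bar> \<le> \<bar>f x\<bar>" for n x by (auto simp: max_def)
  have J: "orbit_integral \<beta> f' t x = (\<integral>s. indicator {0..t} s *\<^sub>R orbit \<beta> f' s x \<partial>lborel)" if "f' \<in> C_bc c" for f'
    using set_integral_eq_integral[OF orbit_continuous_time[OF that], of t \<beta> x]
    by (simp add: orbit_integral_def set_lebesgue_integral_def)
  have int: "integrable lborel (\<lambda>s. indicator {0..t} s *\<^sub>R orbit \<beta> f' s x)" if "f' \<in> C_bc c" for f'
    using borel_integrable_atLeastAtMost'[OF orbit_continuous_time[OF that, of t \<beta> x]]
    unfolding set_integrable_def .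
  have pt: "(\<lambda>n. kernel_op \<kappa> s (?f n) x) \<longlonglongrightarrow> kernel_op \<kappa> s f x" if s: "s \<ge> 0" for s
    unfolding kernel_op_def
  proof (rule integral_dominated_convergence[where w = "\<lambda>y. \<bar>f y\<bar>"])
    note m = borel_probs_measurable[OF kernel_borel_probs[OF s]]
    show "f \<in> borel_measurable (\<kappa> s x)" "?f n \<in> borel_measurable (\<kappa> s x)" for n
      unfolding m by (rule C_bc_measurable[OF f] C_bc_measurable[OF fn])+
    show "integrable (\<kappa> s x) (\<lambda>y. \<bar>f y\<bar>)" by (rule C_bc_integrable[OF kernel_P_c[OF s] C_bc_abs[OF f]])
    show "AE y in \<kappa> s x. (\<lambda>n. ?f n y) \<longlonglongrightarrow> f y"
    proof (rule AE_I2)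
      fix y
      obtain N :: nat where "- f y \<le> real N" using real_arch_simple by blast
      then have "\<forall>\<^sub>F n in sequentially. ?f n y = f y"
        by (auto simp: eventually_sequentially max_def intro!: exI[of _ N])
      then show "(\<lambda>n. ?f n y) \<longlonglongrightarrow> f y" by (rule tendsto_eventually)
    qed
    show "AE y in \<kappa> s x. norm (?f n y) \<le> \<bar>f y\<bar>" for n using bd by simp
  qed
  show ?thesis
    unfolding J[OF f] J[OF fn]
  proof (rule integral_dominated_convergence)
    show "integrable lborel (\<lambda>s. indicator {0..t} s *\<^sub>R orbit \<beta> (\<lambda>x. \<bar>f x\<bar>) s x)" by (rule int[OF C_bc_abs[OF f]])
    show "AE s in lborel. (\<lambda>n. indicator {0..t} s *\<^sub>R orbit \<beta> (?f n) s x) \<longlonglongrightarrow> indicator {0..t} s *\<^sub>R orbit \<beta> f s x"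
    proof (rule AE_I2)
      fix s :: real
      show "(\<lambda>n. indicator {0..t} s *\<^sub>R orbit \<beta> (?f n) s x) \<longlonglongrightarrow> indicator {0..t} s *\<^sub>R orbit \<beta> f s x"
      proof (cases "s \<in> {0..t}")
        case True
        then show ?thesis unfolding orbit_def by (intro tendsto_intros pt) auto
      qed simp
    qed
    show "AE s in lborel. norm (indicator {0..t} s *\<^sub>R orbit \<beta> (?f n) s x)
        \<le> indicator {0..t} s *\<^sub>R orbit \<beta> (\<lambda>x. \<bar>f x\<bar>) s x" for n
    proof (rule AE_I2)
      fix s :: real
      show "norm (indicator {0..t} s *\<^sub>R orbit \<beta> (?f n) s x) \<le> indicator {0..t} s *\<^sub>R orbit \<beta> (\<lambda>x. \<bar>f x\<bar>) s x"
        using kernel_op_abs_le[OF _ C_bc_abs[OF f] C_bc_measurable[OF fn], of s n x] bd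
        by (auto simp: indicator_def orbit_def abs_mult intro!: mult_left_mono)
    qed
  qed (use int[OF f] int[OF fn] in \<open>auto dest: borel_measurable_integrable\<close>)
qed

text \<open>Undoes the addition of \<open>k\<close>: a probability kernel leaves a constant
  unchanged, so its discounted time integral is \<open>k * discount \<beta> t\<close>.\<close>

lemma orbit_integral_le:
  assumes "\<beta> \<ge> 0" "f0 \<in> C_0" "f \<in> C_bc c" "\<And>x. f0 x \<le> f x + k" "t \<ge> 0"
  shows "orbit_integral \<beta> f0 t x - k * discount \<beta> t \<le> orbit_integral \<beta> f t x"
proof -
  have pt: "orbit \<beta> f0 s x \<le> orbit \<beta> f s x + k * exp (- \<beta> * s)" if s: "s \<ge> 0" for s
  proof -
    interpret K: prob_space "\<kappa> s x" by (rule borel_probsD[OF kernel_borel_probs[OF s]])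
    have "kernel_op \<kappa> s f0 x \<le> (\<integral>y. f y + k \<partial>\<kappa> s x)"
      unfolding kernel_op_def
      by (rule integral_mono[OF C_b_integrable[OF kernel_borel_probs[OF s] C_0_C_b[OF assms(2)]] _ assms(4)])
        (simp add: C_bc_integrable[OF kernel_P_c[OF s] assms(3)])
    also have "\<dots> = kernel_op \<kappa> s f x + k"
      unfolding kernel_op_def using C_bc_integrable[OF kernel_P_c[OF s] assms(3)] by (simp add: K.prob_space)
    finally have "exp (- \<beta> * s) * kernel_op \<kappa> s f0 x \<le> exp (- \<beta> * s) * (kernel_op \<kappa> s f x + k)"
      by (intro mult_left_mono) auto
    then show ?thesis by (simp add: orbit_def algebra_simps)
  qed
  have i: "(\<lambda>s. orbit \<beta> f s x) integrable_on {0..t}" "(\<lambda>s. k * exp (- \<beta> * s)) integrable_on {0..t}"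
    "(\<lambda>s. orbit \<beta> f0 s x) integrable_on {0..t}"
    by (intro integrable_continuous_real continuous_intros orbit_continuous_time assms
        continuous_on_orbit_subset order_refl)+
  have "orbit_integral \<beta> f0 t x \<le> integral {0..t} (\<lambda>s. orbit \<beta> f s x + k * exp (- \<beta> * s))"
    unfolding orbit_integral_def using i pt
    by (intro integral_le Henstock_Kurzweil_Integration.integrable_add) auto
  also have "\<dots> = orbit_integral \<beta> f t x + k * discount \<beta> t"
    unfolding orbit_integral_def discount_def using i
    by (simp add: Henstock_Kurzweil_Integration.integral_add)
  finally show ?thesis by simp
qed

end

section \<open>Removing smoothness, decay and lower bounds from the comparison\<close>

context two_semigroups
begin

text \<open>Smoothing perturbs the potentials by at most \<open>\<epsilon>\<close> in sup norm.
  Enlarging both shifts by \<open>\<epsilon>\<close> keeps the smoothed pair below the cost, and the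
  resulting error disappears as \<open>\<epsilon>\<close> tends to 0.\<close>

lemma C_0_comparison:
  assumes beta: "\<beta> \<ge> 0" and T: "T > 0" and k: "k \<ge> 0" and N: "N \<ge> 0"
    and f: "f \<in> C_bc c" "\<And>x. - k \<le> f x" and g: "g \<in> C_bc c" "\<And>x. - k \<le> g x"
    and phi: "\<phi> \<in> C_0" and psi: "\<psi> \<in> C_0"
    and le: "\<And>x y. \<phi> x - a + (\<psi> y - b) \<le> c x y"
    and leN: "\<And>x. \<phi> x - a \<le> N" "\<And>y. \<psi> y - b \<le> N"
    and large: "1 + 2 * k * T + N \<le> a * exp (- \<beta> * T)" "1 + 2 * k * T + N \<le> b * exp (- \<beta> * T)"
    and bound: "infinitesimal_bound \<beta> f g"
  shows "exp (- \<beta> * T) * (kernel_op \<kappa> T \<phi> x - a) + exp (- \<beta> * T) * (kernel_op \<kappa>' T \<psi> y - b)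
    \<le> c x y + A.orbit_integral \<beta> f T x + B.orbit_integral \<beta> g T y"
proof (rule field_le_epsilon)
  fix e :: real assume "e > 0"
  define \<epsilon> where "\<epsilon> = e / 4"
  have \<epsilon>: "\<epsilon> > 0" using \<open>e > 0\<close> by (simp add: \<epsilon>_def)
  obtain \<rho>1 where r1: "\<rho>1 > 0" "\<And>x. \<bar>A.smoothing \<rho>1 \<phi> x - \<phi> x\<bar> < \<epsilon>"
    by (rule A.smoothing_approx[OF phi \<epsilon>]) (rule that)
  obtain \<rho>2 where r2: "\<rho>2 > 0" "\<And>x. \<bar>B.smoothing \<rho>2 \<psi> x - \<psi> x\<bar> < \<epsilon>"
    by (rule B.smoothing_approx[OF psi \<epsilon>]) (rule that)
  let ?S1 = "A.smoothing \<rho>1 \<phi>" and ?S2 = "B.smoothing \<rho>2 \<psi>" and ?E = "exp (- \<beta> * T)"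
  have s1: "?S1 x \<le> \<phi> x + \<epsilon>" "\<phi> x - \<epsilon> \<le> ?S1 x" for x using r1(2)[of x] by (auto simp: abs_less_iff)
  have s2: "?S2 x \<le> \<psi> x + \<epsilon>" "\<psi> x - \<epsilon> \<le> ?S2 x" for x using r2(2)[of x] by (auto simp: abs_less_iff)
  have shift: "d * ?E \<le> (d + \<epsilon>) * ?E" for d using \<epsilon> by (intro mult_right_mono) auto
  obtain f0 g0 where fg: "f0 \<in> C_0" "g0 \<in> C_0" "\<And>x. f0 x \<le> f x + k" "\<And>y. g0 y \<le> g y + k"
    and main: "\<And>x y. A.orbit \<beta> ?S1 T x - (a + \<epsilon>) * ?E + (B.orbit \<beta> ?S2 T y - (b + \<epsilon>) * ?E)
      \<le> c x y + (A.orbit_integral \<beta> f0 T x - k * discount \<beta> T) + (B.orbit_integral \<beta> g0 T y - k * discount \<beta> T)"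
  proof (rule smooth_comparison[OF beta T k N C_bc_continuous[OF f(1)] f(2) C_bc_continuous[OF g(1)] g(2)
        r1(1) r2(1) phi psi _ _ _ _ _ bound, of "a + \<epsilon>" "b + \<epsilon>"])
    show "?S1 x - (a + \<epsilon>) + (?S2 y - (b + \<epsilon>)) \<le> c x y" for x y
      using le[of x y] s1(1)[of x] s2(1)[of y] by linarith
    show "?S1 x - (a + \<epsilon>) \<le> N" for x using leN(1)[of x] s1(1)[of x] by linarith
    show "?S2 y - (b + \<epsilon>) \<le> N" for y using leN(2)[of y] s2(1)[of y] by linarith
    show "1 + 2 * k * T + N \<le> (a + \<epsilon>) * ?E" "1 + 2 * k * T + N \<le> (b + \<epsilon>) * ?E"
      using large shift[of a] shift[of b] by linarith+
  qed (rule that)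
  \<comment> \<open>One \<open>\<epsilon>\<close> pays for the approximation and one for the
    enlarged shift. With two semigroups this gives \<open>4 * \<epsilon> = e\<close>.\<close>
  have low: "?E * (kernel_op \<kappa>1 T \<phi>1 z - d) \<le> exp (- \<beta> * T) * kernel_op \<kappa>1 T \<phi>2 z - (d + \<epsilon>) * ?E + 2 * \<epsilon>"
    if \<kappa>1: "\<kappa>1 T z \<in> borel_probs" and C: "\<phi>1 \<in> C_0" "\<phi>2 \<in> C_0" and le: "\<And>x. \<phi>1 x - \<epsilon> \<le> \<phi>2 x" for \<kappa>1 :: "'a kernels" and \<phi>1 \<phi>2 z d
  proof -
    interpret K: prob_space "\<kappa>1 T z" by (rule borel_probsD[OF \<kappa>1])
    have i: "integrable (\<kappa>1 T z) \<phi>1" "integrable (\<kappa>1 T z) \<phi>2"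
      using C by (auto intro: C_b_integrable[OF \<kappa>1] C_0_C_b)
    have "kernel_op \<kappa>1 T \<phi>1 z \<le> (\<integral>x. \<phi>2 x + \<epsilon> \<partial>\<kappa>1 T z)"
      unfolding kernel_op_def
    proof (rule integral_mono[OF i(1)])
      show "\<phi>1 x \<le> \<phi>2 x + \<epsilon>" for x using le[of x] by simp
    qed (use i in simp)
    also have "\<dots> = kernel_op \<kappa>1 T \<phi>2 z + \<epsilon>" using i by (simp add: kernel_op_def K.prob_space)
    finally have "?E * kernel_op \<kappa>1 T \<phi>1 z \<le> ?E * (kernel_op \<kappa>1 T \<phi>2 z + \<epsilon>)" by (intro mult_left_mono) auto
    moreover have "?E * \<epsilon> \<le> 1 * \<epsilon>" using beta T \<epsilon> by (intro mult_right_mono) auto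
    ultimately show ?thesis by (simp add: algebra_simps)
  qed
  have "?E * (kernel_op \<kappa> T \<phi> x - a) \<le> A.orbit \<beta> ?S1 T x - (a + \<epsilon>) * ?E + 2 * \<epsilon>"
    unfolding A.orbit_def using T
    by (intro low s1 A.kernel_borel_probs phi A.smoothing_C_0 r1) auto
  moreover have "?E * (kernel_op \<kappa>' T \<psi> y - b) \<le> B.orbit \<beta> ?S2 T y - (b + \<epsilon>) * ?E + 2 * \<epsilon>"
    unfolding B.orbit_def using T
    by (intro low s2 B.kernel_borel_probs psi B.smoothing_C_0 r2) auto
  moreover have "A.orbit_integral \<beta> f0 T x - k * discount \<beta> T \<le> A.orbit_integral \<beta> f T x"
    using T by (intro A.orbit_integral_le beta fg f) auto
  moreover have "B.orbit_integral \<beta> g0 T y - k * discount \<beta> T \<le> B.orbit_integral \<beta> g T y"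
    using T by (intro B.orbit_integral_le beta fg g) auto
  ultimately show "?E * (kernel_op \<kappa> T \<phi> x - a) + ?E * (kernel_op \<kappa>' T \<psi> y - b)
    \<le> c x y + A.orbit_integral \<beta> f T x + B.orbit_integral \<beta> g T y + e"
    using main[of x y] by (simp add: \<epsilon>_def)
qed

text \<open>A bounded continuous \<open>\<xi>\<close> is approximated by shifting it up to a
  nonnegative function, multiplying by cutoffs that increase to 1, and shifting back. Working on the
  nonnegative function ensures that the approximants stay below \<open>\<xi>\<close>, hence the pair
  stays admissible.\<close>

lemma C_b_comparison_bounded_below:
  assumes beta: "\<beta> \<ge> 0" and T: "T > 0" and k: "k \<ge> 0"
    and f: "f \<in> C_bc c" "\<And>x. - k \<le> f x" and g: "g \<in> C_bc c" "\<And>x. - k \<le> g x"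
    and phi: "\<phi> \<in> C_b" and psi: "\<psi> \<in> C_b" and le: "\<And>x y. \<phi> x + \<psi> y \<le> c x y"
    and bound: "infinitesimal_bound \<beta> f g"
  shows "exp (- \<beta> * T) * kernel_op \<kappa> T \<phi> x + exp (- \<beta> * T) * kernel_op \<kappa>' T \<psi> y
    \<le> c x y + A.orbit_integral \<beta> f T x + B.orbit_integral \<beta> g T y"
proof -
  obtain N1 N2 where "\<And>x. \<bar>\<phi> x\<bar> \<le> N1" "\<And>x. \<bar>\<psi> x\<bar> \<le> N2"
    using phi psi by (auto simp: C_b_def)
  then have N: "\<bar>\<phi> x\<bar> \<le> max N1 N2" "\<bar>\<psi> x\<bar> \<le> max N1 N2" for x by (auto intro: max.coboundedI1 max.coboundedI2)
  define N where "N = max N1 N2"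
  have bN: "\<bar>\<phi> x\<bar> \<le> N" "\<bar>\<psi> x\<bar> \<le> N" for x using N by (auto simp: N_def)
  have N0: "N \<ge> 0" using bN(1)[of x] by simp
  let ?E = "exp (- \<beta> * T)"
  \<comment> \<open>Gives equality in the largeness condition. As \<open>?E \<le> 1\<close>, it also
    gives \<open>a \<ge> N\<close>, so that \<open>\<xi> + a\<close> is nonnegative.\<close>
  define a where "a = (1 + 2 * k * T + N) / ?E"
  have kT: "k * T \<ge> 0" using k T by simp
  have aE: "1 + 2 * k * T + N \<le> a * ?E" by (simp add: a_def)
  have "(1 + 2 * k * T + N) / 1 \<le> a"
    unfolding a_def using beta T kT N0 by (intro divide_left_mono) auto
  then have aN: "a \<ge> N" using kT by simp
  obtain \<theta> :: "nat \<Rightarrow> 'a \<Rightarrow> real" where \<theta>: "\<And>n. \<theta> n \<in> C_0" "\<And>n x. 0 \<le> \<theta> n x" "\<And>n x. \<theta> n x \<le> 1"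
    "\<And>x. incseq (\<lambda>n. \<theta> n x)" "\<And>x. (\<lambda>n. \<theta> n x) \<longlonglongrightarrow> indicator UNIV x"
    by (rule A.open_indicator_approx[OF open_UNIV]) (rule that)
  define cut where "cut n \<xi> x = \<theta> n x * (\<xi> x + a)" for n \<xi> and x :: 'a
  have cut: "cut n \<xi> \<in> C_0" "cut n \<xi> x - a \<le> \<xi> x" "\<bar>cut n \<xi> x\<bar> \<le> N + a"
    "(\<lambda>n. cut n \<xi> x) \<longlonglongrightarrow> \<xi> x + a" if \<xi>: "\<xi> \<in> C_b" "\<And>x. \<bar>\<xi> x\<bar> \<le> N" for n \<xi> x
  proof -
    have nn: "0 \<le> \<xi> x + a" "\<xi> x + a \<le> N + a" for x using \<xi>(2)[of x] aN by auto
    have b1: "\<bar>cut n \<xi> x\<bar> \<le> \<bar>(N + a) * \<theta> n x\<bar>" for x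
      using mult_left_mono[OF nn(2)[of x] \<theta>(2)[of n x]] nn[of x] \<theta>(2)[of n x]
      unfolding cut_def abs_mult by (simp only: abs_of_nonneg order_trans[OF nn] mult.commute)
    have "continuous_on UNIV (cut n \<xi>)"
      unfolding cut_def[abs_def] by (intro continuous_intros C_0_continuous[OF \<theta>(1)] C_b_continuous[OF \<xi>(1)])
    then show "cut n \<xi> \<in> C_0" by (rule C_0_dominated[OF C_0_scale[OF \<theta>(1)] _ b1])
    show "cut n \<xi> x - a \<le> \<xi> x"
      using mult_right_mono[OF \<theta>(3) nn(1), of n x x] by (simp add: cut_def)
    have "(N + a) * \<theta> n x \<le> (N + a) * 1" using nn[of x] \<theta>(3) by (intro mult_left_mono) auto
    then show "\<bar>cut n \<xi> x\<bar> \<le> N + a" using b1[of x] nn[of x] \<theta>(2)[of n x] by (simp add: abs_mult abs_of_nonneg)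
    have "(\<lambda>n. \<theta> n x * (\<xi> x + a)) \<longlonglongrightarrow> indicator UNIV x * (\<xi> x + a)" by (intro tendsto_intros \<theta>)
    then show "(\<lambda>n. cut n \<xi> x) \<longlonglongrightarrow> \<xi> x + a" by (simp add: cut_def)
  qed
  have lim: "(\<lambda>n. ?E * ((\<integral>y. cut n \<xi> y \<partial>\<mu>) - a)) \<longlonglongrightarrow> ?E * (\<integral>y. \<xi> y \<partial>\<mu>)"
    if \<mu>: "\<mu> \<in> borel_probs" and \<xi>: "\<xi> \<in> C_b" "\<And>x. \<bar>\<xi> x\<bar> \<le> N" for \<mu> \<xi>
  proof -
    interpret K: prob_space \<mu> by (rule borel_probsD[OF \<mu>])
    have "(\<lambda>n. \<integral>y. cut n \<xi> y \<partial>\<mu>) \<longlonglongrightarrow> (\<integral>y. \<xi> y + a \<partial>\<mu>)"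
    proof (rule integral_dominated_convergence[where w = "\<lambda>_. N + a"])
      show "(\<lambda>y. \<xi> y + a) \<in> borel_measurable \<mu>"
        unfolding borel_probs_measurable[OF \<mu>] using C_b_measurable[OF \<xi>(1)] by measurable
      show "cut n \<xi> \<in> borel_measurable \<mu>" for n
        unfolding borel_probs_measurable[OF \<mu>] by (intro C_b_measurable C_0_C_b cut \<xi>)
    qed (use cut[OF \<xi>] in auto)
    also have "(\<integral>y. \<xi> y + a \<partial>\<mu>) = (\<integral>y. \<xi> y \<partial>\<mu>) + a"
      using C_b_integrable[OF \<mu> \<xi>(1)] by (simp add: K.prob_space)
    finally have "(\<lambda>n. ?E * ((\<integral>y. cut n \<xi> y \<partial>\<mu>) - a)) \<longlonglongrightarrow> ?E * ((\<integral>y. \<xi> y \<partial>\<mu>) + a - a)"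
      by (intro tendsto_intros)
    then show ?thesis by simp
  qed
  have lim': "(\<lambda>n. ?E * (kernel_op \<kappa> T (cut n \<phi>) x - a) + ?E * (kernel_op \<kappa>' T (cut n \<psi>) y - a))
      \<longlonglongrightarrow> ?E * kernel_op \<kappa> T \<phi> x + ?E * kernel_op \<kappa>' T \<psi> y"
    unfolding kernel_op_def using T
    by (intro tendsto_add lim A.kernel_borel_probs B.kernel_borel_probs phi psi bN) auto
  have "?E * (kernel_op \<kappa> T (cut n \<phi>) x - a) + ?E * (kernel_op \<kappa>' T (cut n \<psi>) y - a)
      \<le> c x y + A.orbit_integral \<beta> f T x + B.orbit_integral \<beta> g T y" for n
  proof (rule C_0_comparison[OF beta T k N0 f g cut(1)[OF phi bN(1)] cut(1)[OF psi bN(2)] _ _ _ aE aE bound])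
    have c1: "cut n \<phi> x - a \<le> \<phi> x" for x by (rule cut(2)[OF phi bN(1)])
    have c2: "cut n \<psi> x - a \<le> \<psi> x" for x by (rule cut(2)[OF psi bN(2)])
    show "cut n \<phi> x - a + (cut n \<psi> y - a) \<le> c x y" for x y
      using le[of x y] c1[of x] c2[of y] by linarith
    show "cut n \<phi> x - a \<le> N" for x using c1[of x] bN(1)[of x] by linarith
    show "cut n \<psi> x - a \<le> N" for x using c2[of x] bN(2)[of x] by linarith
  qed
  then show ?thesis by (intro LIMSEQ_le_const2[OF lim']) auto
qed

text \<open>Truncating \<open>f\<close> and \<open>g\<close> from below only enlarges the right side
  of the infinitesimal bound, so the bounded-below case applies for every \<open>n\<close>. Passing
  to the limit before using duality keeps the potentials fixed.\<close>

theorem comparison: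
  assumes beta: "\<beta> \<ge> 0" and t: "t \<ge> 0" and f: "f \<in> C_bc c" and g: "g \<in> C_bc c"
    and bound: "infinitesimal_bound \<beta> f g"
  shows "transport_cost c (\<kappa> t x) (\<kappa>' t y)
    \<le> ereal (exp (\<beta> * t) * (c x y + A.orbit_integral \<beta> f t x + B.orbit_integral \<beta> g t y))"
proof (cases "t = 0")
  case True
  then show ?thesis
    by (simp add: A.kernel_0 B.kernel_0 A.transport_cost_dirac A.orbit_integral_def B.orbit_integral_def)
next
  case False
  then have T: "t > 0" using t by simp
  show ?thesis
  proof (rule A.transport_duality[OF A.kernel_P_c[OF t] B.kernel_P_c[OF t]])
    fix \<phi> \<psi> :: "'a \<Rightarrow> real"
    assume phi: "\<phi> \<in> C_b" and psi: "\<psi> \<in> C_b" and le: "\<And>x y. \<phi> x + \<psi> y \<le> c x y"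
    let ?f = "\<lambda>n x. max (f x) (- real n)" and ?g = "\<lambda>n x. max (g x) (- real n)"
    have "infinitesimal_bound \<beta> (?f n) (?g n)" for n
      unfolding infinitesimal_bound_def
    proof (intro allI impI)
      fix \<phi> \<psi> U V x0 y0
      assume "\<phi> \<in> C_0" "\<psi> \<in> C_0" "generator_limit \<kappa> \<phi> U" "generator_limit \<kappa>' \<psi> V"
        "\<forall>x y. c x0 y0 - \<phi> x0 - \<psi> y0 \<le> c x y - \<phi> x - \<psi> y"
      then have "U x0 + V y0 \<le> f x0 + g y0 + \<beta> * c x0 y0"
        using bound unfolding infinitesimal_bound_def by blast
      then show "U x0 + V y0 \<le> ?f n x0 + ?g n y0 + \<beta> * c x0 y0" by linarith
    qed
    then have le_n: "exp (- \<beta> * t) * kernel_op \<kappa> t \<phi> x + exp (- \<beta> * t) * kernel_op \<kappa>' t \<psi> y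
      \<le> c x y + A.orbit_integral \<beta> (?f n) t x + B.orbit_integral \<beta> (?g n) t y" for n
      by (intro C_b_comparison_bounded_below[where k = "real n"] beta T C_bc_max f g A.cost_nonneg phi psi le) auto
    have "(\<lambda>n. c x y + A.orbit_integral \<beta> (?f n) t x + B.orbit_integral \<beta> (?g n) t y)
      \<longlonglongrightarrow> c x y + A.orbit_integral \<beta> f t x + B.orbit_integral \<beta> g t y"
      by (intro tendsto_intros A.orbit_integral_truncation_limit B.orbit_integral_truncation_limit f g)
    then have "exp (- \<beta> * t) * kernel_op \<kappa> t \<phi> x + exp (- \<beta> * t) * kernel_op \<kappa>' t \<psi> y
      \<le> c x y + A.orbit_integral \<beta> f t x + B.orbit_integral \<beta> g t y"
      by (rule LIMSEQ_le_const) (use le_n in auto)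
    then have "exp (\<beta> * t) * (exp (- \<beta> * t) * (kernel_op \<kappa> t \<phi> x + kernel_op \<kappa>' t \<psi> y))
      \<le> exp (\<beta> * t) * (c x y + A.orbit_integral \<beta> f t x + B.orbit_integral \<beta> g t y)"
      by (intro mult_left_mono) (auto simp: distrib_left)
    moreover have "exp (\<beta> * t) * exp (- \<beta> * t) = 1" unfolding exp_add[symmetric] by simp
    then have "exp (\<beta> * t) * (exp (- \<beta> * t) * r) = r" for r by (simp only: mult.assoc[symmetric] mult_1_left)
    ultimately show "(\<integral>x. \<phi> x \<partial>\<kappa> t x) + (\<integral>y. \<psi> y \<partial>\<kappa>' t y)
      \<le> exp (\<beta> * t) * (c x y + A.orbit_integral \<beta> f t x + B.orbit_integral \<beta> g t y)"
      by (simp only: kernel_op_def)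
  qed
qed

end

section \<open>The equivalences\<close>

lemma (in cost_space) weak_duality:
  assumes "\<mu> \<in> borel_probs" "\<nu> \<in> borel_probs" "\<phi> \<in> C_b" "\<psi> \<in> C_b" "\<And>x y. \<phi> x + \<psi> y \<le> c x y"
  shows "ereal ((\<integral>x. \<phi> x \<partial>\<mu>) + (\<integral>y. \<psi> y \<partial>\<nu>)) \<le> transport_cost c \<mu> \<nu>"
proof (rule transport_cost_ge)
  fix \<gamma> assume \<gamma>: "\<gamma> \<in> couplings \<mu> \<nu>" and i: "integrable \<gamma> cost_pair"
  note ci = couplings_integral[OF \<gamma> C_b_measurable[OF assms(3)]] couplings_integral[OF \<gamma> C_b_measurable[OF assms(4)]]
  have i': "integrable \<gamma> (\<lambda>p. \<phi> (fst p))" "integrable \<gamma> (\<lambda>p. \<psi> (snd p))"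
    using C_b_integrable assms by (simp_all add: ci)
  then have "(\<integral>x. \<phi> x \<partial>\<mu>) + (\<integral>y. \<psi> y \<partial>\<nu>) = (\<integral>p. \<phi> (fst p) + \<psi> (snd p) \<partial>\<gamma>)"
    by (simp add: ci)
  also have "\<dots> \<le> (\<integral>p. cost_pair p \<partial>\<gamma>)"
    using i i' assms(5) by (intro integral_mono Bochner_Integration.integrable_add) auto
  finally show "(\<integral>x. \<phi> x \<partial>\<mu>) + (\<integral>y. \<psi> y \<partial>\<nu>) \<le> (\<integral>p. cost_pair p \<partial>\<gamma>)" .
qed

section \<open>Time integrals averaged over an initial measure\<close>

context P_c_semigroup
begin

lemma time_integral_measure:
  assumes "\<mu> \<in> P_c c" "f \<in> C_bc c" "t \<ge> 0"
  shows "(LINT s:{0..t}|lborel. exp (\<beta> * (t - s)) * (\<integral>x. kernel_op \<kappa> s f x \<partial>\<mu>))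
    = exp (\<beta> * t) * (\<integral>x. orbit_integral \<beta> f t x \<partial>\<mu>)"
proof -
  have eq: "exp (\<beta> * (t - s)) * r = exp (\<beta> * t) * (exp (- \<beta> * s) * r)" for s r
    unfolding mult.assoc[symmetric] exp_add[symmetric] by (simp add: algebra_simps)
  show ?thesis
    unfolding orbit_integral_Fubini(2)[OF assms] eq by simp
qed

text \<open>The integrand is continuous up to time 0, where its value is the integral of
  \<open>f\<close>; the claim is the one-sided fundamental theorem of calculus at the
  endpoint.\<close>

lemma time_integral_quotient:
  assumes "\<mu> \<in> P_c c" "f \<in> C_bc c"
  shows "((\<lambda>t. exp (\<beta> * t) * (\<integral>x. orbit_integral \<beta> f t x \<partial>\<mu>) / t) \<longlongrightarrow> (\<integral>x. f x \<partial>\<mu>)) (at_right 0)"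
proof -
  let ?H = "\<lambda>s. exp (- \<beta> * s) * (\<integral>x. kernel_op \<kappa> s f x \<partial>\<mu>)"
  have cont: "continuous_on {0..t} ?H" for t
    by (intro continuous_intros continuous_on_subset[OF integral_kernel_op_continuous[OF assms]]) auto
  have eq: "(\<integral>x. orbit_integral \<beta> f t x \<partial>\<mu>) = integral {0..t} ?H" if "t \<ge> 0" for t
    using orbit_integral_Fubini(2)[OF assms that, of \<beta>] set_integral_eq_integral[OF cont] by simp
  have H0: "?H 0 = (\<integral>x. f x \<partial>\<mu>)"
    by (simp add: kernel_op_def kernel_0 integral_return C_bc_measurable[OF assms(2)])
  have "((\<lambda>t. integral {0..t} ?H) has_real_derivative ?H 0) (at 0 within {0..1})"
    by (intro integral_has_real_derivative cont) auto
  then have "((\<lambda>t. integral {0..t} ?H / t) \<longlongrightarrow> ?H 0) (at 0 within {0..1})"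
    by (simp add: has_field_derivative_iff)
  moreover have "at 0 within {0..1} = at_right (0 :: real)"
    by (rule at_within_Icc_at_right) simp
  ultimately have q: "((\<lambda>t. integral {0..t} ?H / t) \<longlongrightarrow> (\<integral>x. f x \<partial>\<mu>)) (at_right 0)"
    unfolding H0 by simp
  have "((\<lambda>t. exp (\<beta> * t) * (integral {0..t} ?H / t)) \<longlongrightarrow> exp (\<beta> * 0) * (\<integral>x. f x \<partial>\<mu>)) (at_right 0)"
    by (intro tendsto_mult q tendsto_intros)
  then have "((\<lambda>t. exp (\<beta> * t) * (integral {0..t} ?H / t)) \<longlongrightarrow> (\<integral>x. f x \<partial>\<mu>)) (at_right 0)" by simp
  moreover have "\<forall>\<^sub>F t in at_right 0. exp (\<beta> * t) * (integral {0..t} ?H / t)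
      = exp (\<beta> * t) * (\<integral>x. orbit_integral \<beta> f t x \<partial>\<mu>) / t"
    using eventually_at_right_less[of "0 :: real"] by eventually_elim (simp add: eq)
  ultimately show ?thesis by (rule Lim_transform_eventually)
qed

end

section \<open>The implications between the five conditions, in terms of kernels\<close>

context two_semigroups
begin

definition pointwise_bound :: "real \<Rightarrow> ('a \<Rightarrow> real) \<Rightarrow> ('a \<Rightarrow> real) \<Rightarrow> bool" where
  "pointwise_bound \<beta> f g \<longleftrightarrow> (\<forall>x y. \<forall>t\<ge>0. transport_cost c (\<kappa> t x) (\<kappa>' t y)
     \<le> ereal (exp (\<beta> * t) * (c x y + A.orbit_integral \<beta> f t x + B.orbit_integral \<beta> g t y)))"

definition measure_bound :: "real \<Rightarrow> ('a \<Rightarrow> real) \<Rightarrow> ('a \<Rightarrow> real) \<Rightarrow> bool" where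
  "measure_bound \<beta> f g \<longleftrightarrow> (\<forall>\<mu>\<in>P_c c. \<forall>\<nu>\<in>P_c c. \<forall>t\<ge>0. transport_cost c (\<mu> \<bind> \<kappa> t) (\<nu> \<bind> \<kappa>' t)
     \<le> ereal (exp (\<beta> * t)) * transport_cost c \<mu> \<nu>
       + ereal (exp (\<beta> * t) * (\<integral>x. A.orbit_integral \<beta> f t x \<partial>\<mu>))
       + ereal (exp (\<beta> * t) * (\<integral>y. B.orbit_integral \<beta> g t y \<partial>\<nu>)))"

definition growth :: "'a measure \<Rightarrow> 'a measure \<Rightarrow> ereal" where
  "growth \<mu> \<nu> = Limsup (at_right 0)
     (\<lambda>t. (transport_cost c (\<mu> \<bind> \<kappa> t) (\<nu> \<bind> \<kappa>' t) - transport_cost c \<mu> \<nu>) / ereal t)"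

text \<open>Fix admissible potentials for the evolved measures. Weak duality at the evolved point
  masses bounds their backward evolutions by the pointwise estimate, and this inequality between
  functions of \<open>(x, y)\<close> can be integrated against a coupling of the initial
  measures.\<close>

lemma measure_bound_if_pointwise_bound:
  assumes f: "f \<in> C_bc c" and g: "g \<in> C_bc c" and pw: "pointwise_bound \<beta> f g"
  shows "measure_bound \<beta> f g"
  unfolding measure_bound_def
proof (intro ballI allI impI)
  fix \<mu> \<nu> and t :: real assume \<mu>: "\<mu> \<in> P_c c" and \<nu>: "\<nu> \<in> P_c c" and t: "t \<ge> 0"
  note \<mu>b = P_c_borel_probs[OF \<mu>] and \<nu>b = P_c_borel_probs[OF \<nu>]
  obtain r where r: "r \<ge> 0" "transport_cost c \<mu> \<nu> = ereal r" by (rule A.transport_cost_finite[OF \<mu> \<nu>])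
  let ?E = "exp (\<beta> * t)" and ?IA = "\<integral>x. A.orbit_integral \<beta> f t x \<partial>\<mu>" and ?IB = "\<integral>y. B.orbit_integral \<beta> g t y \<partial>\<nu>"
  have "transport_cost c (\<mu> \<bind> \<kappa> t) (\<nu> \<bind> \<kappa>' t) \<le> ereal (?E * (r + ?IA + ?IB))"
  proof (rule A.transport_duality[OF A.bind_P_c[OF \<mu> t] B.bind_P_c[OF \<nu> t]])
    fix \<phi> \<psi> :: "'a \<Rightarrow> real"
    assume phi: "\<phi> \<in> C_b" and psi: "\<psi> \<in> C_b" and le: "\<And>x y. \<phi> x + \<psi> y \<le> c x y"
    have pt: "kernel_op \<kappa> t \<phi> x + kernel_op \<kappa>' t \<psi> y
      \<le> ?E * (c x y + A.orbit_integral \<beta> f t x + B.orbit_integral \<beta> g t y)" for x y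
    proof -
      have "ereal (kernel_op \<kappa> t \<phi> x + kernel_op \<kappa>' t \<psi> y) \<le> transport_cost c (\<kappa> t x) (\<kappa>' t y)"
        unfolding kernel_op_def
        by (intro A.weak_duality A.kernel_borel_probs B.kernel_borel_probs t phi psi le)
      also have "\<dots> \<le> ereal (?E * (c x y + A.orbit_integral \<beta> f t x + B.orbit_integral \<beta> g t y))"
        using pw t unfolding pointwise_bound_def by simp
      finally show ?thesis by simp
    qed
    note bindA = A.integral_bind_kernel[OF \<mu>b t C_b_measurable[OF phi]
        C_b_integrable[OF A.bind_kernel_borel_probs[OF \<mu>b t] phi]]
    note bindB = B.integral_bind_kernel[OF \<nu>b t C_b_measurable[OF psi]
        C_b_integrable[OF B.bind_kernel_borel_probs[OF \<nu>b t] psi]]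
    have mA: "kernel_op \<kappa> t \<phi> \<in> borel_measurable borel" "A.orbit_integral \<beta> f t \<in> borel_measurable borel"
      using A.kernel_op_measurable[OF t C_b_measurable[OF phi]]
        borel_measurable_integrable[OF A.orbit_integral_Fubini(1)[OF \<mu> f t]]
      by (simp_all add: borel_probs_measurable[OF \<mu>b])
    have mB: "kernel_op \<kappa>' t \<psi> \<in> borel_measurable borel" "B.orbit_integral \<beta> g t \<in> borel_measurable borel"
      using B.kernel_op_measurable[OF t C_b_measurable[OF psi]]
        borel_measurable_integrable[OF B.orbit_integral_Fubini(1)[OF \<nu> g t]]
      by (simp_all add: borel_probs_measurable[OF \<nu>b])
    show "(\<integral>x. \<phi> x \<partial>(\<mu> \<bind> \<kappa> t)) + (\<integral>y. \<psi> y \<partial>(\<nu> \<bind> \<kappa>' t)) \<le> ?E * (r + ?IA + ?IB)"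
    proof (rule field_le_epsilon)
      fix e :: real assume "e > 0"
      \<comment> \<open>A nearly optimal coupling; the excess is divided by \<open>?E\<close>
        because the estimate multiplies it by that factor.\<close>
      then have "transport_cost c \<mu> \<nu> < ereal (r + e / ?E)" by (simp add: r)
      then obtain \<gamma> where \<gamma>: "\<gamma> \<in> couplings \<mu> \<nu>" "integrable \<gamma> A.cost_pair"
        "(\<integral>p. A.cost_pair p \<partial>\<gamma>) < r + e / ?E"
        by (rule A.transport_cost_lessD)
      note ci = couplings_integral[OF \<gamma>(1)]
      have i1: "integrable \<gamma> (\<lambda>p. kernel_op \<kappa> t \<phi> (fst p))" "integrable \<gamma> (\<lambda>p. kernel_op \<kappa>' t \<psi> (snd p))"
        using bindA(1) bindB(1) ci mA mB by simp_all
      have i2: "integrable \<gamma> (\<lambda>p. A.orbit_integral \<beta> f t (fst p))" "integrable \<gamma> (\<lambda>p. B.orbit_integral \<beta> g t (snd p))"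
        using A.orbit_integral_Fubini(1)[OF \<mu> f t] B.orbit_integral_Fubini(1)[OF \<nu> g t] ci mA mB by simp_all
      have "(\<integral>x. \<phi> x \<partial>(\<mu> \<bind> \<kappa> t)) + (\<integral>y. \<psi> y \<partial>(\<nu> \<bind> \<kappa>' t))
          = (\<integral>p. kernel_op \<kappa> t \<phi> (fst p) + kernel_op \<kappa>' t \<psi> (snd p) \<partial>\<gamma>)"
        using i1 ci(2)[OF mA(1)] ci(4)[OF mB(1)] bindA(2) bindB(2) by simp
      also have "\<dots> \<le> (\<integral>p. ?E * (A.cost_pair p + A.orbit_integral \<beta> f t (fst p) + B.orbit_integral \<beta> g t (snd p)) \<partial>\<gamma>)"
        using i1 i2 \<gamma>(2) pt
        by (intro integral_mono Bochner_Integration.integrable_add integrable_mult_right) auto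
      also have "\<dots> = ?E * ((\<integral>p. A.cost_pair p \<partial>\<gamma>) + ?IA + ?IB)"
        using i2 \<gamma>(2) ci(2)[OF mA(2)] ci(4)[OF mB(2)] by simp
      also have "\<dots> \<le> ?E * (r + e / ?E + ?IA + ?IB)" using \<gamma>(3) by (intro mult_left_mono) auto
      also have "\<dots> = ?E * (r + ?IA + ?IB) + e" by (simp add: distrib_left)
      finally show "(\<integral>x. \<phi> x \<partial>(\<mu> \<bind> \<kappa> t)) + (\<integral>y. \<psi> y \<partial>(\<nu> \<bind> \<kappa>' t)) \<le> ?E * (r + ?IA + ?IB) + e" .
    qed
  qed
  then show "transport_cost c (\<mu> \<bind> \<kappa> t) (\<nu> \<bind> \<kappa>' t)
     \<le> ereal ?E * transport_cost c \<mu> \<nu> + ereal (?E * ?IA) + ereal (?E * ?IB)"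
    by (simp add: r distrib_left)
qed

lemma growth_le_if_measure_bound:
  assumes f: "f \<in> C_bc c" and g: "g \<in> C_bc c" and mb: "measure_bound \<beta> f g"
    and \<mu>: "\<mu> \<in> P_c c" and \<nu>: "\<nu> \<in> P_c c"
  shows "growth \<mu> \<nu> \<le> ereal (\<integral>x. f x \<partial>\<mu>) + ereal (\<integral>y. g y \<partial>\<nu>) + ereal \<beta> * transport_cost c \<mu> \<nu>"
proof -
  obtain r where r: "r \<ge> 0" "transport_cost c \<mu> \<nu> = ereal r" by (rule A.transport_cost_finite[OF \<mu> \<nu>])
  \<comment> \<open>The difference quotient of the bound in (b), split into three terms whose limits
    at 0 are \<open>\<beta> * r\<close> and the integrals of \<open>f\<close> and
    \<open>g\<close>.\<close>
  define R where "R t = (exp (\<beta> * t) - 1) / t * r + exp (\<beta> * t) * (\<integral>x. A.orbit_integral \<beta> f t x \<partial>\<mu>) / t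
    + exp (\<beta> * t) * (\<integral>y. B.orbit_integral \<beta> g t y \<partial>\<nu>) / t" for t
  have "\<forall>\<^sub>F t in at_right 0. (transport_cost c (\<mu> \<bind> \<kappa> t) (\<nu> \<bind> \<kappa>' t) - transport_cost c \<mu> \<nu>) / ereal t \<le> ereal (R t)"
    using eventually_at_right_less[of "0 :: real"]
  proof eventually_elim
    case (elim t)
    then have t: "t \<ge> 0" by simp
    obtain q where q: "q \<ge> 0" "transport_cost c (\<mu> \<bind> \<kappa> t) (\<nu> \<bind> \<kappa>' t) = ereal q"
      by (rule A.transport_cost_finite[OF A.bind_P_c[OF \<mu> t] B.bind_P_c[OF \<nu> t]])
    have "ereal q \<le> ereal (exp (\<beta> * t)) * ereal r + ereal (exp (\<beta> * t) * (\<integral>x. A.orbit_integral \<beta> f t x \<partial>\<mu>))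
       + ereal (exp (\<beta> * t) * (\<integral>y. B.orbit_integral \<beta> g t y \<partial>\<nu>))"
      using mb \<mu> \<nu> t unfolding measure_bound_def q(2)[symmetric] r(2)[symmetric] by blast
    then have "q - r \<le> (exp (\<beta> * t) - 1) * r + exp (\<beta> * t) * (\<integral>x. A.orbit_integral \<beta> f t x \<partial>\<mu>)
       + exp (\<beta> * t) * (\<integral>y. B.orbit_integral \<beta> g t y \<partial>\<nu>)"
      by (simp add: algebra_simps)
    then have "(q - r) / t \<le> ((exp (\<beta> * t) - 1) * r + exp (\<beta> * t) * (\<integral>x. A.orbit_integral \<beta> f t x \<partial>\<mu>)
       + exp (\<beta> * t) * (\<integral>y. B.orbit_integral \<beta> g t y \<partial>\<nu>)) / t"
      using elim by (intro divide_right_mono) auto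
    also have "\<dots> = R t" by (simp add: R_def add_divide_distrib)
    finally show ?case using elim by (simp add: q r)
  qed
  then have "growth \<mu> \<nu> \<le> Limsup (at_right 0) (\<lambda>t. ereal (R t))"
    unfolding growth_def by (rule Limsup_mono)
  also have "\<dots> = ereal (\<beta> * r + (\<integral>x. f x \<partial>\<mu>) + (\<integral>y. g y \<partial>\<nu>))"
  proof (rule lim_imp_Limsup)
    have "((\<lambda>t. exp (\<beta> * t)) has_real_derivative \<beta>) (at 0)"
      by (auto intro!: derivative_eq_intros)
    then have "((\<lambda>t. (exp (\<beta> * t) - 1) / t) \<longlongrightarrow> \<beta>) (at 0)"
      by (simp add: has_field_derivative_iff)
    then have "((\<lambda>t. (exp (\<beta> * t) - 1) / t) \<longlongrightarrow> \<beta>) (at_right 0)"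
      by (rule tendsto_mono[rotated]) (simp add: at_le)
    then have "(R \<longlongrightarrow> \<beta> * r + (\<integral>x. f x \<partial>\<mu>) + (\<integral>y. g y \<partial>\<nu>)) (at_right 0)"
      unfolding R_def[abs_def]
      by (intro tendsto_add tendsto_mult_right A.time_integral_quotient B.time_integral_quotient \<mu> \<nu> f g)
    then show "((\<lambda>t. ereal (R t)) \<longlongrightarrow> ereal (\<beta> * r + (\<integral>x. f x \<partial>\<mu>) + (\<integral>y. g y \<partial>\<nu>))) (at_right 0)"
      by simp
  qed simp
  finally show ?thesis by (simp add: r algebra_simps)
qed

text \<open>At a minimum of \<open>c - \<phi> - \<psi>\<close> the two test functions, raised by the
  minimal value, form an admissible dual pair that is exact at \<open>(x0, y0)\<close>. Weak duality
  at small times bounds the growth of the cost below by the generator quotients.\<close>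

lemma infinitesimal_bound_if_growth_le:
  assumes "\<And>x y. growth (dirac x) (dirac y) \<le> ereal (f x + g y + \<beta> * c x y)"
  shows "infinitesimal_bound \<beta> f g"
  unfolding infinitesimal_bound_def
proof (intro allI impI)
  fix \<phi> \<psi> U V x0 y0
  assume phi: "\<phi> \<in> C_0" and psi: "\<psi> \<in> C_0" and U: "generator_limit \<kappa> \<phi> U" and V: "generator_limit \<kappa>' \<psi> V"
    and min: "\<forall>x y. c x0 y0 - \<phi> x0 - \<psi> y0 \<le> c x y - \<phi> x - \<psi> y"
  define R where "R t = (kernel_op \<kappa> t \<phi> x0 - \<phi> x0) / t + (kernel_op \<kappa>' t \<psi> y0 - \<psi> y0) / t" for t
  have "(R \<longlongrightarrow> U x0 + V y0) (at_right 0)"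
    unfolding R_def[abs_def] using U V unfolding generator_limit_def
    by (intro tendsto_add) (auto intro: tendsto_uniform_limitI)
  then have "Limsup (at_right 0) (\<lambda>t. ereal (R t)) = ereal (U x0 + V y0)"
    by (intro lim_imp_Limsup) auto
  moreover have "Limsup (at_right 0) (\<lambda>t. ereal (R t)) \<le> growth (dirac x0) (dirac y0)"
    unfolding growth_def
  proof (rule Limsup_mono)
    show "\<forall>\<^sub>F t in at_right 0. ereal (R t) \<le>
       (transport_cost c (dirac x0 \<bind> \<kappa> t) (dirac y0 \<bind> \<kappa>' t) - transport_cost c (dirac x0) (dirac y0)) / ereal t"
      using eventually_at_right_less[of "0 :: real"]
    proof eventually_elim
      case (elim t)
      then have t: "t \<ge> 0" by simp
      obtain q where q: "q \<ge> 0" "transport_cost c (\<kappa> t x0) (\<kappa>' t y0) = ereal q"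
        by (rule A.transport_cost_finite[OF A.kernel_P_c[OF t] B.kernel_P_c[OF t]])
      interpret KA: prob_space "\<kappa> t x0" by (rule borel_probsD[OF A.kernel_borel_probs[OF t]])
      \<comment> \<open>The minimal value, added to the first potential. The sum need not stay in
        \<open>C_0\<close>, but it is in \<open>C_b\<close>, which weak duality accepts.\<close>
      let ?C = "c x0 y0 - \<phi> x0 - \<psi> y0"
      have "ereal ((\<integral>x. \<phi> x + ?C \<partial>\<kappa> t x0) + (\<integral>y. \<psi> y \<partial>\<kappa>' t y0)) \<le> transport_cost c (\<kappa> t x0) (\<kappa>' t y0)"
      proof (rule A.weak_duality)
        show "\<phi> x + ?C + \<psi> y \<le> c x y" for x y using min[rule_format, of x y] by linarith
      qed (intro A.kernel_borel_probs B.kernel_borel_probs t C_b_add C_b_const C_0_C_b phi psi)+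
      also have "(\<integral>x. \<phi> x + ?C \<partial>\<kappa> t x0) = kernel_op \<kappa> t \<phi> x0 + ?C"
        using C_b_integrable[OF A.kernel_borel_probs[OF t] C_0_C_b[OF phi]]
        by (simp add: kernel_op_def KA.prob_space)
      finally have "(kernel_op \<kappa> t \<phi> x0 - \<phi> x0) + (kernel_op \<kappa>' t \<psi> y0 - \<psi> y0) \<le> q - c x0 y0"
        by (simp add: q kernel_op_def)
      then have "R t \<le> (q - c x0 y0) / t"
        using elim unfolding R_def add_divide_distrib[symmetric] by (intro divide_right_mono) auto
      then show ?case
        using elim t by (simp add: A.dirac_bind B.dirac_bind q A.transport_cost_dirac)
    qed
  qed
  ultimately have "ereal (U x0 + V y0) \<le> ereal (f x0 + g y0 + \<beta> * c x0 y0)"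
    using assms[of x0 y0] by (metis order_trans)
  then show "U x0 + V y0 \<le> f x0 + g y0 + \<beta> * c x0 y0" by simp
qed

end

text \<open>Resolves the choice in \<open>semigroup_of\<close> and moves the hypotheses of the
  theorem onto the chosen kernels.\<close>

lemma (in cost_space) G_c0D:
  fixes A :: "'a operator"
  assumes "A \<in> G_c0 c"
  shows "is_generator A" "P_c_semigroup c K (semigroup_of A)" "generator (semigroup_of A) = A"
proof -
  show gen: "is_generator A" using assms by (simp add: G_c0_def)
  then have sem: "prob_semigroup (semigroup_of A) \<and> generator (semigroup_of A) = A"
    unfolding is_generator_def semigroup_of_def by (rule someI_ex)
  then show "generator (semigroup_of A) = A" by simp
  have eq: "exp_measure \<mu> t A = \<mu> \<bind> semigroup_of A t" if "\<mu> \<in> P_c c" "t \<ge> 0" for \<mu> t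
    using gen that by (intro exp_measure_eq_bind P_c_borel_probs)
  show "P_c_semigroup c K (semigroup_of A)"
  proof unfold_locales
    show "prob_semigroup (semigroup_of A)" using sem by simp
    fix \<mu> :: "'a measure" and t :: real assume \<mu>: "\<mu> \<in> P_c c" and t: "t \<ge> 0"
    show "\<mu> \<bind> semigroup_of A t \<in> P_c c"
      using assms \<mu> t by (simp add: G_c0_def flip: eq)
    have "((\<lambda>s. transport_cost c (exp_measure \<mu> s A) (exp_measure \<mu> t A)) \<longlongrightarrow> 0) (at t within {0..})"
      using assms \<mu> t by (simp add: G_c0_def)
    moreover have "\<forall>\<^sub>F s in at t within {0..}. s \<in> {0..}"
      by (simp add: eventually_at_topological) (auto intro: exI[of _ UNIV])
    then have "\<forall>\<^sub>F s in at t within {0..}. transport_cost c (exp_measure \<mu> s A) (exp_measure \<mu> t A)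
        = transport_cost c (\<mu> \<bind> semigroup_of A s) (\<mu> \<bind> semigroup_of A t)"
      by eventually_elim (simp add: eq \<mu> t)
    ultimately show "((\<lambda>s. transport_cost c (\<mu> \<bind> semigroup_of A s) (\<mu> \<bind> semigroup_of A t)) \<longlongrightarrow> 0) (at t within {0..})"
      by (rule Lim_transform_eventually)
  qed
qed

theorem theorem3p2:
  fixes c :: "'a::topological_space \<Rightarrow> 'a \<Rightarrow> real"
    and K \<beta> :: real
    and A B :: "'a operator"
    and f g :: "'a \<Rightarrow> real"
  assumes "semimetric c"
    and "semimetric_topology c"
    and "semimetric_complete c"
    and "separable_space (euclidean :: 'a topology)"
    and "locally_compact_space (euclidean :: 'a topology)"
    and "semimetric_continuous c"
    and "K \<ge> 1"
    and "\<And>x y z. c x y \<le> K * (c x z + c z y)"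
    and "\<beta> \<ge> 0"
    and "A \<in> G_c0 c"
    and "B \<in> G_c0 c"
    and "f \<in> C_bc c"
    and "g \<in> C_bc c"
  shows
    "let
       a = (\<forall>x y. \<forall>t\<ge>0.
              transport_cost c (exp_measure (dirac x) t A) (exp_measure (dirac y) t B)
                \<le> ereal (exp (\<beta> * t) * c x y
                    + (LINT s:{0..t}|lborel. exp (\<beta> * (t - s)) * exp_op s A f x)
                    + (LINT s:{0..t}|lborel. exp (\<beta> * (t - s)) * exp_op s B g y)));
       b = (\<forall>\<mu>\<in>P_c c. \<forall>\<nu>\<in>P_c c. \<forall>t\<ge>0.
              transport_cost c (exp_measure \<mu> t A) (exp_measure \<nu> t B)
                \<le> ereal (exp (\<beta> * t)) * transport_cost c \<mu> \<nu>
                    + ereal (LINT s:{0..t}|lborel. exp (\<beta> * (t - s)) * (LINT x|\<mu>. exp_op s A f x))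
                    + ereal (LINT s:{0..t}|lborel. exp (\<beta> * (t - s)) * (LINT y|\<nu>. exp_op s B g y)));
       c' = (\<forall>\<mu>\<in>P_c c. \<forall>\<nu>\<in>P_c c.
              \<omega>_c c \<mu> \<nu> A B
                \<le> ereal (LINT x|\<mu>. f x) + ereal (LINT y|\<nu>. g y) + ereal \<beta> * transport_cost c \<mu> \<nu>);
       d = (\<forall>x y. \<omega>_c c (dirac x) (dirac y) A B \<le> ereal (f x + g y + \<beta> * c x y));
       e = (\<forall>\<phi>\<in>dom A. \<forall>\<psi>\<in>dom B. \<forall>x0 y0.
              (\<forall>x y. c x0 y0 - \<phi> x0 - \<psi> y0 \<le> c x y - \<phi> x - \<psi> y) \<longrightarrow>
              the (A \<phi>) x0 + the (B \<psi>) y0 \<le> f x0 + g y0 + \<beta> * c x0 y0)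
     in (a \<longleftrightarrow> b) \<and> (b \<longleftrightarrow> c') \<and> (c' \<longleftrightarrow> d) \<and> (d \<longleftrightarrow> e)"
proof -
  interpret cost_space c K
    by unfold_locales (rule assms)+
  note GA = G_c0D[OF assms(10)] and GB = G_c0D[OF assms(11)]
  let ?\<kappa> = "semigroup_of A" and ?\<kappa>' = "semigroup_of B"
  interpret A: P_c_semigroup c K ?\<kappa> by (rule GA)
  interpret B: P_c_semigroup c K ?\<kappa>' by (rule GB)
  interpret two_semigroups c K ?\<kappa> ?\<kappa>' ..
  have eA: "exp_measure \<mu> t A = \<mu> \<bind> ?\<kappa> t" and eB: "exp_measure \<mu> t B = \<mu> \<bind> ?\<kappa>' t"
    if "\<mu> \<in> P_c c" "t \<ge> 0" for \<mu> t
    using GA GB that by (auto intro!: exp_measure_eq_bind P_c_borel_probs)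
  have a: "(\<forall>x y. \<forall>t\<ge>0. transport_cost c (exp_measure (dirac x) t A) (exp_measure (dirac y) t B)
                \<le> ereal (exp (\<beta> * t) * c x y
                    + (LINT s:{0..t}|lborel. exp (\<beta> * (t - s)) * exp_op s A f x)
                    + (LINT s:{0..t}|lborel. exp (\<beta> * (t - s)) * exp_op s B g y)))
      \<longleftrightarrow> pointwise_bound \<beta> f g"
    unfolding pointwise_bound_def exp_op_def
      A.time_integral_eq_orbit_integral[OF assms(12)] B.time_integral_eq_orbit_integral[OF assms(13)]
    by (simp add: eA eB dirac_P_c A.dirac_bind B.dirac_bind distrib_left cong: imp_cong)
  have b: "(\<forall>\<mu>\<in>P_c c. \<forall>\<nu>\<in>P_c c. \<forall>t\<ge>0.
              transport_cost c (exp_measure \<mu> t A) (exp_measure \<nu> t B)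
                \<le> ereal (exp (\<beta> * t)) * transport_cost c \<mu> \<nu>
                    + ereal (LINT s:{0..t}|lborel. exp (\<beta> * (t - s)) * (LINT x|\<mu>. exp_op s A f x))
                    + ereal (LINT s:{0..t}|lborel. exp (\<beta> * (t - s)) * (LINT y|\<nu>. exp_op s B g y)))
      \<longleftrightarrow> measure_bound \<beta> f g"
    unfolding measure_bound_def exp_op_def
    by (intro ball_cong refl all_cong)
      (simp add: eA eB A.time_integral_measure[OF _ assms(12)] B.time_integral_measure[OF _ assms(13)])
  \<comment> \<open>The upper limit sees only positive times, at which \<open>exp_measure\<close> is
    the mixture of kernels.\<close>
  have om: "\<omega>_c c \<mu> \<nu> A B = growth \<mu> \<nu>" if "\<mu> \<in> P_c c" "\<nu> \<in> P_c c" for \<mu> \<nu>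
    unfolding \<omega>_c_def growth_def
  proof (rule Limsup_eq)
    show "\<forall>\<^sub>F t in at_right 0.
        (transport_cost c (exp_measure \<mu> t A) (exp_measure \<nu> t B) - transport_cost c \<mu> \<nu>) / ereal t
      = (transport_cost c (\<mu> \<bind> ?\<kappa> t) (\<nu> \<bind> ?\<kappa>' t) - transport_cost c \<mu> \<nu>) / ereal t"
      using eventually_at_right_less[of "0 :: real"] by eventually_elim (simp add: eA eB that)
  qed
  have e: "(\<forall>\<phi>\<in>dom A. \<forall>\<psi>\<in>dom B. \<forall>x0 y0.
              (\<forall>x y. c x0 y0 - \<phi> x0 - \<psi> y0 \<le> c x y - \<phi> x - \<psi> y) \<longrightarrow>
              the (A \<phi>) x0 + the (B \<psi>) y0 \<le> f x0 + g y0 + \<beta> * c x0 y0)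
      \<longleftrightarrow> infinitesimal_bound \<beta> f g"
  proof -
    have domA: "A \<phi> = Some U \<longleftrightarrow> \<phi> \<in> C_0 \<and> generator_limit ?\<kappa> \<phi> U" for \<phi> U
      using A.generator_eq_Some[of \<phi> U] by (simp only: GA(3))
    have domB: "B \<phi> = Some U \<longleftrightarrow> \<phi> \<in> C_0 \<and> generator_limit ?\<kappa>' \<phi> U" for \<phi> U
      using B.generator_eq_Some[of \<phi> U] by (simp only: GB(3))
    show ?thesis
    proof
      assume L: "\<forall>\<phi>\<in>dom A. \<forall>\<psi>\<in>dom B. \<forall>x0 y0.
              (\<forall>x y. c x0 y0 - \<phi> x0 - \<psi> y0 \<le> c x y - \<phi> x - \<psi> y) \<longrightarrow>
              the (A \<phi>) x0 + the (B \<psi>) y0 \<le> f x0 + g y0 + \<beta> * c x0 y0"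
      show "infinitesimal_bound \<beta> f g"
        unfolding infinitesimal_bound_def
      proof (intro allI impI)
        fix \<phi> \<psi> U V x0 y0
        assume "\<phi> \<in> C_0" "\<psi> \<in> C_0" "generator_limit ?\<kappa> \<phi> U" "generator_limit ?\<kappa>' \<psi> V"
          and min: "\<forall>x y. c x0 y0 - \<phi> x0 - \<psi> y0 \<le> c x y - \<phi> x - \<psi> y"
        then have "A \<phi> = Some U" "B \<psi> = Some V" by (simp_all add: domA domB)
        then show "U x0 + V y0 \<le> f x0 + g y0 + \<beta> * c x0 y0"
          using L[rule_format, of \<phi> \<psi> x0 y0] min by (simp add: domIff)
      qed
    next
      assume R: "infinitesimal_bound \<beta> f g"
      show "\<forall>\<phi>\<in>dom A. \<forall>\<psi>\<in>dom B. \<forall>x0 y0.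
              (\<forall>x y. c x0 y0 - \<phi> x0 - \<psi> y0 \<le> c x y - \<phi> x - \<psi> y) \<longrightarrow>
              the (A \<phi>) x0 + the (B \<psi>) y0 \<le> f x0 + g y0 + \<beta> * c x0 y0"
      proof (intro ballI allI impI)
        fix \<phi> \<psi> x0 y0
        assume "\<phi> \<in> dom A" "\<psi> \<in> dom B"
          and min: "\<forall>x y. c x0 y0 - \<phi> x0 - \<psi> y0 \<le> c x y - \<phi> x - \<psi> y"
        then obtain U V where "A \<phi> = Some U" "B \<psi> = Some V" by (auto simp: dom_def)
        moreover from this have "\<phi> \<in> C_0" "\<psi> \<in> C_0" "generator_limit ?\<kappa> \<phi> U" "generator_limit ?\<kappa>' \<psi> V"
          by (simp_all add: domA domB)
        ultimately show "the (A \<phi>) x0 + the (B \<psi>) y0 \<le> f x0 + g y0 + \<beta> * c x0 y0"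
          using R min unfolding infinitesimal_bound_def by simp
      qed
    qed
  qed
  define C where "C \<longleftrightarrow> (\<forall>\<mu>\<in>P_c c. \<forall>\<nu>\<in>P_c c. \<omega>_c c \<mu> \<nu> A B
      \<le> ereal (LINT x|\<mu>. f x) + ereal (LINT y|\<nu>. g y) + ereal \<beta> * transport_cost c \<mu> \<nu>)"
  define D where "D \<longleftrightarrow> (\<forall>x y. \<omega>_c c (dirac x) (dirac y) A B \<le> ereal (f x + g y + \<beta> * c x y))"
  have ab: "pointwise_bound \<beta> f g \<Longrightarrow> measure_bound \<beta> f g"
    by (rule measure_bound_if_pointwise_bound[OF assms(12,13)])
  have bc: "measure_bound \<beta> f g \<Longrightarrow> C"
    unfolding C_def using growth_le_if_measure_bound[OF assms(12,13)] by (simp add: om)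
  have cd: "C \<Longrightarrow> D"
    unfolding D_def
  proof (intro allI)
    fix x y assume C
    then have "\<omega>_c c (dirac x) (dirac y) A B \<le> ereal (LINT x|dirac x. f x) + ereal (LINT y|dirac y. g y)
        + ereal \<beta> * transport_cost c (dirac x) (dirac y)"
      unfolding C_def using dirac_P_c by blast
    also have "\<dots> = ereal (f x + g y + \<beta> * c x y)"
      using assms(12,13)[THEN C_bc_measurable] by (simp add: transport_cost_dirac integral_return)
    finally show "\<omega>_c c (dirac x) (dirac y) A B \<le> ereal (f x + g y + \<beta> * c x y)" .
  qed
  have de: "D \<Longrightarrow> infinitesimal_bound \<beta> f g"
    unfolding D_def by (rule infinitesimal_bound_if_growth_le) (simp add: om dirac_P_c)
  have ea: "infinitesimal_bound \<beta> f g \<Longrightarrow> pointwise_bound \<beta> f g"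
    unfolding pointwise_bound_def using comparison[OF assms(9) _ assms(12,13)] by blast
  show ?thesis
    unfolding Let_def a b e C_def[symmetric] D_def[symmetric] using ab bc cd de ea by blast
qed

end
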